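(* The invariant $\Phi^{(A^{(5)},B^{(5)})}_{X_2}$ of oriented links is strictly stronger than the Jones polynomial; that is, for all oriented links $L,L'$, $\Phi^{(A^{(5)},B^{(5)})}_{X_2}(L)=\Phi^{(A^{(5)},B^{(5)})}_{X_2}(L')$ implies $J(L)=J(L')$, and there exist oriented links $L,L'$ with $J(L)=J(L')$ but $\Phi^{(A^{(5)},B^{(5)})}_{X_2}(L)\neq\Phi^{(A^{(5)},B^{(5)})}_{X_2}(L')$.
   Context: $J(L)$ is the Jones polynomial of the oriented link $L$ normalized so that the trivial knot $O$ has $J(O)=-t^{1/2}-t^{-1/2}$. Colorings: $X_2=\mathbb{Z}/2\mathbb{Z}$ with $[a,b,c]=a+b-c$. Let $D$ be a diagram of an oriented link; regions are the components of $\mathbb{R}^2\setminus D$. Rotate a crossing $c$ so that both strands point downward; let the left, top, bottom, right regions have colors $W,N,S,E$. Put $(x_c,y_c,z_c)=(W,N,S)$ if $c$ is positive and $(W,S,N)$ if $c$ is negative. A map $C$ from the regions to $X_2$ is an $X_2$-coloring if $E=[x_c,y_c,z_c]$ at every crossing; $\mathrm{cl}_C(c)=(x_c,y_c,z_c)$; $\mathrm{Col}_{X_2}(D)$ is the set of $X_2$-colorings. The maps $A^{(5)},B^{(5)}:X_2^3\to\mathbb{Z}[x_1^{\pm1},\dots,x_5^{\pm1}]$ are: $A^{(5)}_{0,0,0}=A^{(5)}_{0,1,1}=A^{(5)}_{1,0,0}=A^{(5)}_{1,1,1}=x_1$, $A^{(5)}_{0,0,1}=x_2$, $A^{(5)}_{0,1,0}=x_3$,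 $A^{(5)}_{1,0,1}=x_4$, $A^{(5)}_{1,1,0}=x_2x_3x_4^{-1}$; and $B^{(5)}_{a,b,c}=x_1^{-1}x_5A^{(5)}_{a,b,c}$ for all $a,b,c$. Put $\delta=-x_1x_5^{-1}-x_1^{-1}x_5$ and $w=-x_1^2x_5^{-1}$. A state is a map $s$ from crossings of $D$ to $\{A^{(5)},B^{(5)}\}$; $k_s$ is the number of circles after replacing each crossing with $s(c)=A^{(5)}$ by its orientation-respecting smoothing and each crossing with $s(c)=B^{(5)}$ by the other smoothing. With $p,n$ the numbers of positive and negative crossings, $\beta^{(A^{(5)},B^{(5)})}_{X_2}(D,C)=w^{n-p}\sum_s\delta^{k_s}\prod_c s(c)(\mathrm{cl}_C(c))^{\mathrm{sign}(c)}$, and $\Phi^{(A^{(5)},B^{(5)})}_{X_2}(L)=\sum_{C\in\mathrm{Col}_{X_2}(D)}u^{\beta^{(A^{(5)},B^{(5)})}_{X_2}(D,C)}$, a formal sum (equivalently, the multiset of values $\beta$), which is independent of the diagram $D$ of $L$. *)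

theory Defs
  imports Complex_Main
    "HOL-Library.Poly_Mapping"
    "HOL-Library.Multiset"
    "HOL-Library.FuncSet"
    "HOL-Library.Numeral_Type"
    "HOL-Library.Z2"
begin

section \<open>Diagrams of oriented links\<close>

text \<open>
  A link diagram in the plane, in general position with respect to the height function, is cut by
  horizontal lines (the levels) into slices, each of which contains exactly one elementary piece:
  a local maximum, a local minimum or a crossing. A diagram is the list of its slices, read from
  top to bottom. A slice (i, p) has piece p, with i vertical strands to the left of it (and the
  remaining ones to the right).

  At a level, the strands are numbered 0, 1, ... from left to right, and their directions are
  recorded in a list.

  Cap d is a local maximum, d being the direction of its left leg (the right leg has the other
  direction); Cup is a local minimum. In Cross b, the flag b says whether the strand joining top
  left to bottom right is the overcrossing strand. Any directions of the two strands of a crossing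
  are allowed, so that sideways crossings occur.
\<close>

datatype direction = Down | Up

fun flip :: "direction \<Rightarrow> direction" where
  "flip Down = Up"
| "flip Up = Down"

datatype piece = Cap direction | Cup | Cross bool

type_synonym slice = "nat \<times> piece"

fun step :: "slice \<Rightarrow> direction list \<Rightarrow> direction list option" where
  "step (i, Cap d) v =
     (if i \<le> length v then Some (take i v @ [d, flip d] @ drop i v) else None)"
| "step (i, Cup) v =
     (if i + 1 < length v \<and> v ! i \<noteq> v ! (i + 1) then Some (take i v @ drop (i + 2) v) else None)"
| "step (i, Cross b) v =
     (if i + 1 < length v then Some (take i v @ [v ! (i + 1), v ! i] @ drop (i + 2) v) else None)"

fun run :: "slice list \<Rightarrow> direction list \<Rightarrow> direction list option" where
  "run [] v = Some v"
| "run (a # D) v = Option.bind (step a v) (run D)"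

definition diagram :: "slice list \<Rightarrow> bool" where
  "diagram D \<longleftrightarrow> D \<noteq> [] \<and> run D [] = Some []"

text \<open>The level k lies just above the slice D ! k; the level length D is at the very bottom.\<close>

definition level :: "slice list \<Rightarrow> nat \<Rightarrow> direction list" where
  "level D k = the (run (take k D) [])"

definition crossings :: "slice list \<Rightarrow> nat set" where
  "crossings D = {k. k < length D \<and> (\<exists>i b. D ! k = (i, Cross b))}"

definition pos :: "slice list \<Rightarrow> nat \<Rightarrow> nat" where
  "pos D k = fst (D ! k)"

definition over :: "slice list \<Rightarrow> nat \<Rightarrow> bool" where
  "over D k \<longleftrightarrow> snd (D ! k) = Cross True"

text \<open>Directions of the strands with upper end at the top left and at the top right, respectively.\<close>

definition dir_tl :: "slice list \<Rightarrow> nat \<Rightarrow> direction" where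
  "dir_tl D k = level D k ! pos D k"

definition dir_tr :: "slice list \<Rightarrow> nat \<Rightarrow> direction" where
  "dir_tr D k = level D k ! (pos D k + 1)"

text \<open>
  If both strands point downward (or both upward), the crossing is positive iff the strand from
  top right to bottom left is over; reversing one strand changes the sign.
\<close>

definition sign :: "slice list \<Rightarrow> nat \<Rightarrow> int" where
  "sign D k = (if (dir_tl D k = dir_tr D k) \<noteq> over D k then 1 else -1)"

definition num_pos :: "slice list \<Rightarrow> nat" where
  "num_pos D = card {k \<in> crossings D. sign D k = 1}"

definition num_neg :: "slice list \<Rightarrow> nat" where
  "num_neg D = card {k \<in> crossings D. sign D k = -1}"

section \<open>Oriented links\<close>

text \<open>
  Two diagrams represent isotopic oriented links iff they are related by the following local moves:
  planar isotopies (interchange of the heights of two pieces lying side by side, cancellation of a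
  maximum against a minimum, passing a strand across an extremum) and the three Reidemeister moves.
  The numbers of strands entering and leaving a piece are ins p and outs p. Orientations need no
  extra conditions, since directions are propagated by step and both sides have to be diagrams.

  In R3, the flags a, b, c tell whether strand 1 is over strand 2, 1 over 3, and 2 over 3; the two
  excluded cases are those where there is no top strand.
\<close>

fun ins :: "piece \<Rightarrow> nat" where
  "ins (Cap d) = 0" | "ins Cup = 2" | "ins (Cross b) = 2"

fun outs :: "piece \<Rightarrow> nat" where
  "outs (Cap d) = 2" | "outs Cup = 0" | "outs (Cross b) = 2"

inductive local_move :: "slice list \<Rightarrow> slice list \<Rightarrow> bool" where
  interchange: "local_move [(i, p), (i + outs p + m, q)] [(i + ins p + m, q), (i, p)]"
| snake_left: "local_move [(i + 1, Cap d), (i, Cup)] []"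
| snake_right: "local_move [(i, Cap d), (i + 1, Cup)] []"
| slide_cap: "local_move [(i + 1, Cap d), (i, Cross b)] [(i, Cap d), (i + 1, Cross (\<not> b))]"
| slide_cup: "local_move [(i, Cross b), (i + 1, Cup)] [(i + 1, Cross (\<not> b)), (i, Cup)]"
| R1_cap: "local_move [(i, Cap d), (i, Cross b)] [(i, Cap (flip d))]"
| R1_cup: "local_move [(i, Cross b), (i, Cup)] [(i, Cup)]"
| R2: "local_move [(i, Cross b), (i, Cross (\<not> b))] []"
| R3: "\<not> (a = c \<and> b \<noteq> a) \<Longrightarrow>
    local_move [(i, Cross a), (i + 1, Cross b), (i, Cross c)]
               [(i + 1, Cross c), (i, Cross b), (i + 1, Cross a)]"

definition move :: "(slice list \<times> slice list) set" where
  "move = {(u @ l @ v, u @ r @ v) | u v l r.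
     local_move l r \<and> diagram (u @ l @ v) \<and> diagram (u @ r @ v)}"

definition isotopic :: "(slice list \<times> slice list) set" where
  "isotopic = {(D, D'). diagram D \<and> diagram D' \<and> (D, D') \<in> (move \<union> move\<inverse>)\<^sup>*}"

text \<open>An oriented link (up to isotopy) is identified with the set of all its diagrams.\<close>

definition oriented_links :: "slice list set set" where
  "oriented_links = {D. diagram D} // isotopic"

section \<open>Regions and circles\<close>

definition classes :: "'a set \<Rightarrow> ('a \<times> 'a) set \<Rightarrow> 'a set set" where
  "classes X r = X // {(x, y). x \<in> X \<and> y \<in> X \<and> (x, y) \<in> (Restr r X \<union> (Restr r X)\<inverse>)\<^sup>*}"

text \<open>
  The gap (k, j) is the interval of level k that has j strands to its left. Regions are glued
  from gaps: gap_adj relates the gaps above a piece to those gaps below it that belong to the same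
  region within the slice.
\<close>

definition gaps :: "slice list \<Rightarrow> (nat \<times> nat) set" where
  "gaps D = {(k, j). k \<le> length D \<and> j \<le> length (level D k)}"

fun gap_adj :: "slice \<Rightarrow> (nat \<times> nat) set" where
  "gap_adj (i, Cap d) = {(j, j) | j. j \<le> i} \<union> {(j, j + 2) | j. j \<ge> i}"
| "gap_adj (i, Cup) = {(j, j) | j. j \<le> i} \<union> {(j + 2, j) | j. j \<ge> i}"
| "gap_adj (i, Cross b) = {(j, j) | j. j \<noteq> i + 1}"

definition regions :: "slice list \<Rightarrow> (nat \<times> nat) set set" where
  "regions D = classes (gaps D)
     {((k, j), (k + 1, j')) | k j j'. k < length D \<and> (j, j') \<in> gap_adj (D ! k)}"

definition region_of :: "slice list \<Rightarrow> nat \<times> nat \<Rightarrow> (nat \<times> nat) set" where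
  "region_of D g = (THE R. R \<in> regions D \<and> g \<in> R)"

text \<open>
  The point (k, j) is the intersection of level k with strand j. A set V of crossings determines
  the smoothing of D in which the crossings in V are replaced by two vertical arcs and the others
  by a cup above a cap. Every resulting circle meets some level, so circles are classes of points.
\<close>

definition points :: "slice list \<Rightarrow> (nat \<times> nat) set" where
  "points D = {(k, j). k \<le> length D \<and> j < length (level D k)}"

fun through :: "bool \<Rightarrow> slice \<Rightarrow> (nat \<times> nat) set" where
  "through vert (i, Cap d) = {(j, j) | j. j < i} \<union> {(j, j + 2) | j. j \<ge> i}"
| "through vert (i, Cup) = {(j, j) | j. j < i} \<union> {(j + 2, j) | j. j \<ge> i}"
| "through vert (i, Cross b) = {(j, j) | j. vert \<or> (j \<noteq> i \<and> j \<noteq> i + 1)}"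

fun arc_above :: "bool \<Rightarrow> slice \<Rightarrow> (nat \<times> nat) set" where
  "arc_above vert (i, Cap d) = {}"
| "arc_above vert (i, Cup) = {(i, i + 1)}"
| "arc_above vert (i, Cross b) = (if vert then {} else {(i, i + 1)})"

fun arc_below :: "bool \<Rightarrow> slice \<Rightarrow> (nat \<times> nat) set" where
  "arc_below vert (i, Cap d) = {(i, i + 1)}"
| "arc_below vert (i, Cup) = {}"
| "arc_below vert (i, Cross b) = (if vert then {} else {(i, i + 1)})"

definition circles :: "slice list \<Rightarrow> nat set \<Rightarrow> (nat \<times> nat) set set" where
  "circles D V = classes (points D)
     ({((k, j), (k + 1, j')) | k j j'. k < length D \<and> (j, j') \<in> through (k \<in> V) (D ! k)} \<union>
      {((k, j), (k, j')) | k j j'. k < length D \<and> (j, j') \<in> arc_above (k \<in> V) (D ! k)} \<union>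
      {((k + 1, j), (k + 1, j')) | k j j'. k < length D \<and> (j, j') \<in> arc_below (k \<in> V) (D ! k)})"

section \<open>Laurent polynomials\<close>

text \<open>
  The group algebra of the free abelian group of exponent vectors is the ring of Laurent
  polynomials. The five variables are indexed by the five-element type 5 (in which 5 = 0).
\<close>

type_synonym laurent5 = "(5 \<Rightarrow>\<^sub>0 int) \<Rightarrow>\<^sub>0 int"

definition xvar :: "5 \<Rightarrow> laurent5" where
  "xvar i = Poly_Mapping.single (Poly_Mapping.single i 1) 1"

text \<open>The following two are meaningful for units a only.\<close>

definition unit_inv :: "'a::comm_ring_1 \<Rightarrow> 'a" where
  "unit_inv a = (THE b. a * b = 1)"

definition unit_power_int :: "'a::comm_ring_1 \<Rightarrow> int \<Rightarrow> 'a" (infixr \<open>^^^\<close> 80) where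
  "a ^^^ m = (if m \<ge> 0 then a ^ nat m else unit_inv a ^ nat (- m))"

section \<open>The Jones polynomial\<close>

text \<open>
  The ring of Laurent polynomials over the integers in the fourth root of t (which contains the
  values of the Jones polynomial); t_quarter m is the m-th power of that root.
\<close>

type_synonym laurent_t = "int \<Rightarrow>\<^sub>0 int"

definition t_quarter :: "int \<Rightarrow> laurent_t" where
  "t_quarter m = Poly_Mapping.single m 1"

definition kauffman_var :: laurent_t where
  "kauffman_var = t_quarter (-1)"

text \<open>
  The A-smoothing joins the two regions swept out when the overcrossing strand is rotated
  counterclockwise. If that strand goes from top left to bottom right, these are the left and right
  regions; otherwise, they are the top and bottom regions and the smoothing is vertical. The state
  given by S uses the A-smoothing at the crossings in S and the B-smoothing at the others. No circle
  is left out in the exponent, so that the unknot has bracket -A^2 - A^(-2).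
\<close>

definition kauffman_bracket :: "slice list \<Rightarrow> laurent_t" where
  "kauffman_bracket D =
     (\<Sum>S \<in> Pow (crossings D).
        kauffman_var ^^^ (int (card S) - int (card (crossings D - S))) *
        (- (kauffman_var ^^^ 2) - kauffman_var ^^^ (-2))
          ^ card (circles D {k \<in> crossings D. k \<in> S \<longleftrightarrow> \<not> over D k}))"

definition jones_diagram :: "slice list \<Rightarrow> laurent_t" where
  "jones_diagram D =
     (- (kauffman_var ^ 3)) ^^^ (- (int (num_pos D) - int (num_neg D))) * kauffman_bracket D"

text \<open>The value does not depend on the diagram of the link that is chosen here.\<close>

definition jones :: "slice list set \<Rightarrow> laurent_t" where
  "jones L = jones_diagram (SOME D. D \<in> L)"

section \<open>Colorings by X2\<close>

definition tern :: "bit \<Rightarrow> bit \<Rightarrow> bit \<Rightarrow> bit" where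
  "tern a b c = a + b - c"

text \<open>
  The regions W, N, S, E around a crossing, after rotating it so that both strands point downward.
\<close>

definition corners ::
  "slice list \<Rightarrow> nat \<Rightarrow> (nat \<times> nat) set \<times> (nat \<times> nat) set \<times> (nat \<times> nat) set \<times> (nat \<times> nat) set"
where
  "corners D k =
    (let l = region_of D (k, pos D k);
         t = region_of D (k, pos D k + 1);
         b = region_of D (k + 1, pos D k + 1);
         r = region_of D (k, pos D k + 2)
     in case (dir_tl D k, dir_tr D k) of
          (Down, Down) \<Rightarrow> (l, t, b, r)
        | (Up, Up) \<Rightarrow> (r, b, t, l)
        | (Down, Up) \<Rightarrow> (b, l, r, t)
        | (Up, Down) \<Rightarrow> (t, r, l, b))"

definition cl :: "slice list \<Rightarrow> ((nat \<times> nat) set \<Rightarrow> bit) \<Rightarrow> nat \<Rightarrow> bit \<times> bit \<times> bit" where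
  "cl D C k =
    (case corners D k of (W, N, S, E) \<Rightarrow>
       if sign D k = 1 then (C W, C N, C S) else (C W, C S, C N))"

definition Col :: "slice list \<Rightarrow> ((nat \<times> nat) set \<Rightarrow> bit) set" where
  "Col D = {C \<in> regions D \<rightarrow>\<^sub>E UNIV. \<forall>k \<in> crossings D.
     case corners D k of (W, N, S, E) \<Rightarrow> case cl D C k of (a, b, c) \<Rightarrow> C E = tern a b c}"

section \<open>The invariant\<close>

fun A5 :: "bit \<times> bit \<times> bit \<Rightarrow> laurent5" where
  "A5 (a, b, c) =
    (if (a, b, c) = (0, 0, 1) then xvar 2
     else if (a, b, c) = (0, 1, 0) then xvar 3
     else if (a, b, c) = (1, 0, 1) then xvar 4
     else if (a, b, c) = (1, 1, 0) then xvar 2 * xvar 3 * unit_inv (xvar 4)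
     else xvar 1)"

definition B5 :: "bit \<times> bit \<times> bit \<Rightarrow> laurent5" where
  "B5 abc = unit_inv (xvar 1) * xvar 5 * A5 abc"

definition delta5 :: laurent5 where
  "delta5 = - (xvar 1 * unit_inv (xvar 5)) - unit_inv (xvar 1) * xvar 5"

definition w5 :: laurent5 where
  "w5 = - (xvar 1 ^ 2 * unit_inv (xvar 5))"

text \<open>
  The number k_s of circles: the orientation-respecting smoothing is the vertical one iff the
  strands are both directed downward or both upward.
\<close>

definition num_circles ::
  "slice list \<Rightarrow> (nat \<Rightarrow> bit \<times> bit \<times> bit \<Rightarrow> laurent5) \<Rightarrow> nat"
where
  "num_circles D s =
     card (circles D {k \<in> crossings D. s k = A5 \<longleftrightarrow> dir_tl D k = dir_tr D k})"

definition beta :: "slice list \<Rightarrow> ((nat \<times> nat) set \<Rightarrow> bit) \<Rightarrow> laurent5" where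
  "beta D C =
     w5 ^^^ (int (num_neg D) - int (num_pos D)) *
     (\<Sum>s \<in> crossings D \<rightarrow>\<^sub>E {A5, B5}.
        delta5 ^ num_circles D s * (\<Prod>k \<in> crossings D. s k (cl D C k) ^^^ sign D k))"

definition Phi_diagram :: "slice list \<Rightarrow> laurent5 multiset" where
  "Phi_diagram D = image_mset (beta D) (mset_set (Col D))"

text \<open>The value does not depend on the diagram of the link that is chosen here.\<close>

definition Phi :: "slice list set \<Rightarrow> laurent5 multiset" where
  "Phi L = Phi_diagram (SOME D. D \<in> L)"

end

theory Submission
  imports Defs "HOL-Computational_Algebra.Polynomial"
begin

text \<open>
  Phi determines the Jones polynomial because sending the first four variables to A and the fifth
  to its inverse turns the value of every coloring into the Jones polynomial of the same diagram.

  Under a more general substitution, beta is the Jones polynomial times a monomial that records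
  linking numbers: along a coloring, the colors on the two sides of a strand differ by a constant
  on each component, and the extra factor counts, with signs, the crossings of an over-component
  with difference 1 and an under-component with difference 0. So links with the same Jones
  polynomial but essentially different linking numbers are separated. The example is a pair of
  parallel strands with two full twists, closed up and encircled by a ring, and its mirror image:
  the linking numbers are 2, -1, -1 up to sign, while the Jones polynomial is
  -(A^14 + A^10 + ... + A^(-14)), which is palindromic.

  To evaluate on the arbitrary diagram chosen in an isotopy class, one needs invariance. Instead of
  comparing numbers of circles, A is chosen such that -A^2 - A^(-2) is a natural number N. Then
  N^(number of circles) counts the labelings of the points by N labels that are constant along
  circles, the state sum becomes a product of transfer matrices, and each local move is an identity
  between sums over a few labels. Infinitely many N determine a Laurent polynomial. The sum of the
  linking factors over all colorings is a transfer matrix product of the same kind.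
\<close>

section \<open>Transfer matrices\<close>

text \<open>The derivative of the Jones polynomial at t = 1 determines the total linking number, so
  a link that shares its Jones polynomial with its mirror image has total linking number zero. One
  or two components then leave nothing to detect; three allow 2, -1, -1. The multiset of values is
  out of reach for an unknown diagram, but the sum of its images under a ring homomorphism is a
  state sum. Apart from the Jones factor, this sum runs over the ways to give each component a
  difference 0 or 1, twice, for the two colors of the unbounded region. Each way contributes the
  power of 2 whose exponent is the sum of the linking numbers between components with 1 and
  components with 0. Linking numbers -2, 1, 1 give 2 * (1 + 1/2 + 1/2 + 4) = 12 for the differences
  alone, while 2, -1, -1 give 2 * (1 + 2 + 2 + 1/4) = 21/2. The models for the Jones polynomial and
  for linking numbers satisfy the same local axioms, so invariance is proved once for both.\<close>

definition label_lists :: "'l set \<Rightarrow> nat \<Rightarrow> 'l list set" where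
  "label_lists X n = {y. length y = n \<and> set y \<subseteq> X}"

lemma label_lists_0 [simp]: "label_lists X 0 = {[]}"
  by (auto simp: label_lists_def)

lemma sum_label_lists_Suc:
  "(\<Sum>y\<in>label_lists X (Suc n). f y) = (\<Sum>a\<in>X. \<Sum>y\<in>label_lists X n. f (a # y))"
proof -
  have "(\<Sum>y\<in>label_lists X (Suc n). f y) = (\<Sum>(a, y)\<in>X \<times> label_lists X n. f (a # y))"
    by (rule sum.reindex_bij_witness[where j = "\<lambda>y. (hd y, tl y)" and i = "\<lambda>(a, y). a # y"])
      (auto simp: label_lists_def length_Suc_conv)
  then show ?thesis
    by (simp add: sum.cartesian_product)
qed

lemma sum_label_lists_2:
  "(\<Sum>y\<in>label_lists X 2. f y) = (\<Sum>a\<in>X. \<Sum>b\<in>X. f [a, b])"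
  by (simp add: numeral_2_eq_2 sum_label_lists_Suc)

lemma finite_label_lists: "finite X \<Longrightarrow> finite (label_lists X n)"
  unfolding label_lists_def using finite_lists_length_eq[of X n] by (simp add: conj_commute)

text \<open>The arguments are the directions at the top left and top right, the overcrossing flag,
  and the labels at the top left, top right, bottom left and bottom right.\<close>

type_synonym 'l cross_weight =
  "direction \<Rightarrow> direction \<Rightarrow> bool \<Rightarrow> 'l \<Rightarrow> 'l \<Rightarrow> 'l \<Rightarrow> 'l \<Rightarrow> complex"

fun piece_weight ::
  "'l cross_weight \<Rightarrow> piece \<Rightarrow> direction list \<Rightarrow> 'l list \<Rightarrow> 'l list \<Rightarrow> complex"
where
  "piece_weight W (Cap d) e x y = of_bool (y ! 0 = y ! 1)"
| "piece_weight W Cup e x y = of_bool (x ! 0 = x ! 1)"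
| "piece_weight W (Cross b) e x y = W (e ! 0) (e ! 1) b (x ! 0) (x ! 1) (y ! 0) (y ! 1)"

fun act ::
  "'l set \<Rightarrow> 'l cross_weight \<Rightarrow> slice \<Rightarrow> direction list \<Rightarrow> ('l list \<Rightarrow> complex) \<Rightarrow> 'l list \<Rightarrow> complex"
where
  "act X W (i, p) e F x = (\<Sum>m\<in>label_lists X (outs p).
     piece_weight W p (drop i e) (drop i x) m * F (take i x @ m @ drop (i + ins p) x))"

text \<open>A vector \<open>F\<close> on the labelings of the bottom row is pulled up through the
  slices, the last slice acting first. A piece of a diagram thus becomes a linear operator, and a
  local move an identity of operators, valid for every \<open>F\<close>.\<close>

fun val ::
  "'l set \<Rightarrow> 'l cross_weight \<Rightarrow> slice list \<Rightarrow> direction list \<Rightarrow> ('l list \<Rightarrow> complex) \<Rightarrow> 'l list \<Rightarrow> complex"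
where
  "val X W [] e F x = F x"
| "val X W (a # D) e F x = act X W a e (val X W D (the (step a e)) F) x"

lemma step_length:
  assumes "step (i, p) e = Some e'"
  shows "i + ins p \<le> length e \<and> length e' = length e - ins p + outs p"
  using assms by (cases p) (auto split: if_splits)

lemma act_cong:
  assumes "step a e = Some e'" "x \<in> label_lists X (length e)"
    and "\<And>y. y \<in> label_lists X (length e') \<Longrightarrow> F y = G y"
  shows "act X W a e F x = act X W a e G x"
proof -
  obtain i p where a: "a = (i, p)"
    by fastforce
  note len = step_length[OF assms(1)[unfolded a]]
  have "take i x @ m @ drop (i + ins p) x \<in> label_lists X (length e')"
    if "m \<in> label_lists X (outs p)" for m
    using that assms(2) len
    by (auto simp: label_lists_def dest: in_set_takeD in_set_dropD)
  then show ?thesis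
    by (simp add: a assms(3))
qed

declare act.simps [simp del]

lemma run_Cons_Some:
  "run (a # D) e = Some e'' \<longleftrightarrow> (\<exists>e'. step a e = Some e' \<and> run D e' = Some e'')"
  by (simp add: bind_eq_Some_conv)

lemma run_append: "run (D @ D') e = Option.bind (run D e) (run D')"
  by (induction D arbitrary: e) (auto split: bind_splits)

lemma val_cong:
  assumes "run D e = Some e'" "x \<in> label_lists X (length e)"
    and "\<And>y. y \<in> label_lists X (length e') \<Longrightarrow> F y = G y"
  shows "val X W D e F x = val X W D e G x"
  using assms
proof (induction D arbitrary: e x)
  case (Cons a D)
  from Cons.prems(1) obtain e1 where e1: "step a e = Some e1" "run D e1 = Some e'"
    unfolding run_Cons_Some by blast
  show ?case
    unfolding val.simps e1(1) option.sel
    by (rule act_cong[OF e1(1) Cons.prems(2)], rule Cons.IH[OF e1(2)])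
      (use Cons.prems(3) in auto)
qed simp

lemma val_append:
  assumes "run D e = Some e'"
  shows "val X W (D @ D') e F x = val X W D e (val X W D' e' F) x"
  using assms
proof (induction D arbitrary: e x)
  case (Cons a D)
  from Cons.prems obtain e1 where e1: "step a e = Some e1" "run D e1 = Some e'"
    unfolding run_Cons_Some by blast
  have "val X W (D @ D') e1 F = val X W D e1 (val X W D' e' F)"
    using Cons.IH[OF e1(2)] by (rule ext)
  then show ?case
    using e1(1) by simp
qed simp

text \<open>\<open>rotate\<close> is invariance under a counterclockwise quarter turn of the
  crossing, which exchanges the two diagonals and hence negates \<open>b\<close>. It yields the
  slides across both kinds of extrema, and its square carries the kink below a cap in
  \<open>cross_R1\<close> to the kink above a cup.\<close>

locale state_model =
  fixes X :: "'l set" and W :: "'l cross_weight"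
  assumes finite_labels: "finite X"
    and rotate: "W d e b x y p r = W e (flip d) (\<not> b) y r x p"
    and cross_R1: "p \<in> X \<Longrightarrow> r \<in> X \<Longrightarrow> (\<Sum>x\<in>X. W d (flip d) b x x p r) = of_bool (p = r)"
    and cross_R2: "\<lbrakk>x \<in> X; y \<in> X; u \<in> X; v \<in> X\<rbrakk> \<Longrightarrow>
      (\<Sum>p\<in>X. \<Sum>r\<in>X. W d e b x y p r * W e d (\<not> b) p r u v) = of_bool (x = u \<and> y = v)"
    and cross_R3: "\<lbrakk>\<not> (a = c \<and> b \<noteq> a); x \<in> X; y \<in> X; z \<in> X; u \<in> X; v \<in> X; w \<in> X\<rbrakk> \<Longrightarrow>
      (\<Sum>p\<in>X. \<Sum>q\<in>X. \<Sum>r\<in>X. W d1 d2 a x y p q * W d1 d3 b q z r w * W d2 d3 c p r u v) =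
      (\<Sum>p\<in>X. \<Sum>q\<in>X. \<Sum>r\<in>X. W d2 d3 c y z p q * W d1 d3 b x p u r * W d1 d2 a r q v w)"
begin

lemma sum_delta_left: "a \<in> X \<Longrightarrow> (\<Sum>x\<in>X. of_bool (a = x) * f x) = (f a :: complex)"
  using finite_labels by (simp add: of_bool_def if_distrib[of "\<lambda>t. t * _"] cong: if_cong)

lemma sum_delta_right: "a \<in> X \<Longrightarrow> (\<Sum>x\<in>X. of_bool (x = a) * f x) = (f a :: complex)"
  using sum_delta_left[of a f] by (simp add: eq_commute)

lemma act_Cap: "act X W (i, Cap d) e F x = (\<Sum>a\<in>X. F (take i x @ [a, a] @ drop i x))"
  by (simp add: act.simps sum_label_lists_2 sum_delta_left)

lemma act_Cup: "Suc i < length x \<Longrightarrow> act X W (i, Cup) e F x =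
   of_bool (x ! i = x ! (i + 1)) * F (take i x @ drop (i + 2) x)"
  by (simp add: act.simps)

lemma act_Cross: "Suc i < length x \<Longrightarrow> Suc i < length e \<Longrightarrow> act X W (i, Cross b) e F x =
   (\<Sum>p\<in>X. \<Sum>r\<in>X. W (e ! i) (e ! (i + 1)) b (x ! i) (x ! (i + 1)) p r *
      F (take i x @ [p, r] @ drop (i + 2) x))"
  by (simp add: act.simps sum_label_lists_2)

end

section \<open>Invariance under isotopy\<close>

lemma flip_flip [simp]: "flip (flip d) = d"
  by (cases d) auto

lemma split_list_at:
  assumes "i + k \<le> length xs"
  obtains l m r where "xs = l @ m @ r" "length l = i" "length m = k"
proof
  show "xs = take i xs @ take k (drop i xs) @ drop (i + k) xs"
    by (metis append_take_drop_id drop_drop add.commute)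
qed (use assms in auto)

lemma split_label_lists:
  assumes "x \<in> label_lists X n" "i + k \<le> n"
  obtains l m r where "x = l @ m @ r" "length l = i" "m \<in> label_lists X k"
proof -
  from assms have "i + k \<le> length x"
    by (simp add: label_lists_def)
  then obtain l m r where "x = l @ m @ r" "length l = i" "length m = k"
    by (rule split_list_at)
  with assms(1) show ?thesis
    by (intro that) (auto simp: label_lists_def)
qed

lemma label_lists_2E:
  assumes "m \<in> label_lists X 2"
  obtains a b where "m = [a, b]" "a \<in> X" "b \<in> X"
  using assms by (auto simp: label_lists_def numeral_2_eq_2 length_Suc_conv)

lemma label_lists_3E:
  assumes "m \<in> label_lists X 3"
  obtains a b c where "m = [a, b, c]" "a \<in> X" "b \<in> X" "c \<in> X"
  using assms by (auto simp: label_lists_def numeral_3_eq_3 length_Suc_conv)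

lemma piece_weight_take:
  "piece_weight W p e x y = piece_weight W p (take (ins p) e) (take (ins p) x) y"
  by (cases p) auto

lemma step_take_drop:
  assumes "step (i, p) e = Some e'"
  shows "take i e' = take i e" "drop (i + outs p) e' = drop (i + ins p) e"
  using assms by (cases p; auto split: if_splits)+

fun out_dirs :: "piece \<Rightarrow> direction list \<Rightarrow> direction list" where
  "out_dirs (Cap d) e = [d, flip d]"
| "out_dirs Cup e = []"
| "out_dirs (Cross b) e = [e ! 1, e ! 0]"

lemma step_eq:
  assumes "step (i, p) e = Some e'"
  shows "e' = take i e @ out_dirs p (drop i e) @ drop (i + ins p) e"
  using assms by (cases p) (auto split: if_splits)

lemma out_dirs_take: "out_dirs p e = out_dirs p (take (ins p) e)"
  by (cases p) auto

lemma length_out_dirs [simp]: "length (out_dirs p e) = outs p"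
  by (cases p) auto

text \<open>Both sides of a move hand the same directions to the rest of the diagram, so that the
  two tails are evaluated at the same level. For the snakes this holds because a cup accepts only
  opposite directions.\<close>

lemma local_move_run:
  assumes "local_move D D'" and "run D e = Some e1" "run D' e = Some e2"
  shows "e1 = e2"
  using assms(1)
proof (cases rule: local_move.cases)
  case (interchange i p m q)
  obtain e1' e2' where *: "step (i, p) e = Some e1'" "step (i + outs p + m, q) e1' = Some e1"
    "step (i + ins p + m, q) e = Some e2'" "step (i, p) e2' = Some e2"
    using assms(2,3) unfolding interchange by (auto simp: bind_eq_Some_conv)
  define l u c v r where defs: "l = take i e" "u = take (ins p) (drop i e)"
    "c = take m (drop (i + ins p) e)" "v = take (ins q) (drop (i + ins p + m) e)"
    "r = drop (i + ins p + m + ins q) e"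
  have e: "e = l @ u @ c @ v @ r"
    unfolding defs by (metis append_take_drop_id drop_drop add.commute)
  have len: "length l = i" "length u = ins p" "length c = m" "length v = ins q"
    unfolding defs using step_length[OF *(3)] by auto
  have "e1' = l @ out_dirs p u @ c @ v @ r" "e2' = l @ u @ c @ out_dirs q v @ r"
    using step_eq[OF *(1)] step_eq[OF *(3)] out_dirs_take[of p "drop i e"]
      out_dirs_take[of q "drop (i + ins p + m) e"] len
    by (simp_all add: e)
  then show ?thesis
    using step_eq[OF *(2)] step_eq[OF *(4)] out_dirs_take[of p "drop i e2'"]
      out_dirs_take[of q "drop (i + outs p + m) e1'"] len
    by (simp add: add_ac)
next
  case (slide_cup i b)
  then have i: "i + 3 \<le> length e"
    using assms(2) by (auto split: if_splits)
  obtain el em er where *: "e = el @ em @ er" "length el = i" "length em = 3"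
    using i by (rule split_list_at)
  then obtain e1 e2 e3 where "em = [e1, e2, e3]"
    by (auto simp: numeral_3_eq_3 length_Suc_conv)
  then show ?thesis
    using slide_cup * assms(2,3) by (cases e1; cases e2; cases e3) (auto simp: nth_append split: if_splits)
next
  case (R3 a c b i)
  then have i: "i + 3 \<le> length e"
    using assms(2) by (auto split: if_splits)
  obtain el em er where *: "e = el @ em @ er" "length el = i" "length em = 3"
    using i by (rule split_list_at)
  then obtain e1 e2 e3 where "em = [e1, e2, e3]"
    by (auto simp: numeral_3_eq_3 length_Suc_conv)
  then show ?thesis
    using R3 * assms(2,3) by (auto simp: nth_append split: if_splits)
next
  case (snake_left i d)
  then have "i + 1 \<le> length e"
    using assms(2) by (auto split: if_splits)
  then obtain el em er where *: "e = el @ em @ er" "length el = i" "length em = 1"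
    by (rule split_list_at)
  then obtain e1 where "em = [e1]"
    by (auto simp: length_Suc_conv)
  then show ?thesis
    using snake_left * assms(2,3) by (cases e1; cases d) (auto simp: nth_append split: if_splits)
next
  case (snake_right i d)
  then have "i + 1 \<le> length e"
    using assms(2) by (auto split: if_splits)
  then obtain el em er where *: "e = el @ em @ er" "length el = i" "length em = 1"
    by (rule split_list_at)
  then obtain e1 where "em = [e1]"
    by (auto simp: length_Suc_conv)
  then show ?thesis
    using snake_right * assms(2,3) by (cases e1; cases d) (auto simp: nth_append split: if_splits)
next
  case (slide_cap i d b)
  then have "i + 1 \<le> length e"
    using assms(2) by (auto split: if_splits)
  then obtain el em er where *: "e = el @ em @ er" "length el = i" "length em = 1"
    by (rule split_list_at)
  then obtain e1 where "em = [e1]"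
    by (auto simp: length_Suc_conv)
  then show ?thesis
    using slide_cap * assms(2,3) by (auto simp: nth_append split: if_splits)
next
  case (R1_cap i d b)
  then show ?thesis
    using assms(2,3) by (cases d) (auto simp: nth_append min_def split: if_splits)
next
  case (R1_cup i b)
  then show ?thesis
    using assms(2,3) by (auto simp: nth_append min_def split: if_splits)
next
  case (R2 i b)
  then have "i + 2 \<le> length e"
    using assms(2) by (auto split: if_splits)
  then obtain el em er where *: "e = el @ em @ er" "length el = i" "length em = 2"
    by (rule split_list_at)
  then obtain e1 e2 where "em = [e1, e2]"
    by (auto simp: numeral_2_eq_2 length_Suc_conv)
  then show ?thesis
    using R2 * assms(2,3) by (auto simp: nth_append split: if_splits)
qed

section \<open>Local moves as identities between transfer operators\<close>

context state_model
begin

text \<open>The two pieces read and write disjoint stretches of the row, so the sums over their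
  outputs commute. The care goes into the offset of \<open>q\<close>, which counts
  \<open>outs p\<close> positions when \<open>p\<close> lies above it and \<open>ins p\<close>
  positions when \<open>p\<close> lies below.\<close>

lemma val_interchange:
  assumes p: "step (i, p) e = Some e1" and q: "step (i + ins p + m, q) e = Some e2"
    and x: "length x = length e"
  shows "val X W [(i, p), (i + outs p + m, q)] e F x = val X W [(i + ins p + m, q), (i, p)] e F x"
proof -
  define c where "c = take m (drop (i + ins p) x)"
  define l where "l = take i x"
  define r where "r = drop (i + ins p + m + ins q) x"
  have len: "length l = i" "length c = m"
    using step_length[OF q] x by (auto simp: l_def c_def)
  have q': "take (ins q) (drop (i + outs p + m) e1) = take (ins q) (drop (i + ins p + m) e)"
    using step_take_drop(2)[OF p] by (metis add.commute drop_drop)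
  have "take (i + ins p) (take (i + ins p + m) e2) = take (i + ins p) (take (i + ins p + m) e)"
    using step_take_drop(1)[OF q] by simp
  then have "drop i (take (i + ins p) e2) = drop i (take (i + ins p) e)"
    by (simp add: min_def)
  then have p': "take (ins p) (drop i e2) = take (ins p) (drop i e)"
    by (simp add: drop_take)
  define wp where "wp = (\<lambda>a. piece_weight W p (drop i e) (drop i x) a)"
  define wq where "wq = (\<lambda>b. piece_weight W q (drop (i + ins p + m) e) (drop (i + ins p + m) x) b)"
  have dx: "drop (i + ins p) x = c @ drop (i + ins p + m) x"
    unfolding c_def by (metis append_take_drop_id drop_drop add.commute)
  have tx: "take (i + ins p + m) x = l @ take (ins p) (drop i x) @ c"
    unfolding c_def l_def by (simp add: take_add)
  have "val X W [(i, p), (i + outs p + m, q)] e F x =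
      (\<Sum>a\<in>label_lists X (outs p). wp a * (\<Sum>b\<in>label_lists X (outs q). wq b * F (l @ a @ c @ b @ r)))"
  proof -
    have "piece_weight W q (drop (i + outs p + m) e1)
            (drop (i + outs p + m) (take i x @ a @ drop (i + ins p) x)) b = wq b"
      if "a \<in> label_lists X (outs p)" for a b
    proof -
      have "drop (i + outs p + m) (take i x @ a @ drop (i + ins p) x) = drop (i + ins p + m) x"
        using that len by (simp add: label_lists_def dx l_def)
      then show ?thesis
        unfolding wq_def by (metis piece_weight_take q')
    qed
    moreover have "take (i + outs p + m) (take i x @ a @ drop (i + ins p) x) @ b @
        drop (i + outs p + m + ins q) (take i x @ a @ drop (i + ins p) x) = l @ a @ c @ b @ r"
      if "a \<in> label_lists X (outs p)" for a b
      using that len unfolding dx r_def by (simp add: label_lists_def l_def add_ac)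
    ultimately show ?thesis
      by (simp add: p act.simps wp_def)
  qed
  moreover have "val X W [(i + ins p + m, q), (i, p)] e F x =
      (\<Sum>b\<in>label_lists X (outs q). wq b * (\<Sum>a\<in>label_lists X (outs p). wp a * F (l @ a @ c @ b @ r)))"
  proof -
    have up: "length (take (ins p) (drop i x)) = ins p"
      using step_length[OF q] x by auto
    have "piece_weight W p (drop i e2)
            (drop i (take (i + ins p + m) x @ b @ drop (i + ins p + m + ins q) x)) a = wp a"
      for a b
    proof -
      have "take (ins p) (drop i (take (i + ins p + m) x @ b @ drop (i + ins p + m + ins q) x)) =
          take (ins p) (drop i x)"
        using len up unfolding tx by simp
      then show ?thesis
        unfolding wp_def by (metis piece_weight_take p')
    qed
    moreover have "take i (take (i + ins p + m) x @ b @ drop (i + ins p + m + ins q) x) @ a @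
        drop (i + ins p) (take (i + ins p + m) x @ b @ drop (i + ins p + m + ins q) x) = l @ a @ c @ b @ r"
      for a b
      using len up unfolding tx r_def[symmetric] by simp
    ultimately show ?thesis
      by (simp add: q act.simps wq_def)
  qed
  ultimately show ?thesis
    by (simp add: sum_distrib_left mult.left_commute)
      (rule sum.swap)
qed

text \<open>Two quarter turns put the kink upside down.\<close>

lemma W_R1_cup:
  assumes "x \<in> X" "y \<in> X"
  shows "(\<Sum>p\<in>X. W d (flip d) b x y p p) = of_bool (x = y)"
proof -
  have "W d (flip d) b x y p p = W (flip d) (flip (flip d)) b p p y x" for p
    using rotate[of d "flip d" b x y p p] rotate[of "flip d" "flip d" "\<not> b" y p x p] by simp
  then show ?thesis
    using cross_R1[of y x "flip d" b] assms by (simp add: eq_commute)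
qed

lemma sum6_reorder:
  fixes f :: "'l \<Rightarrow> 'l \<Rightarrow> 'l \<Rightarrow> 'l \<Rightarrow> 'l \<Rightarrow> 'l \<Rightarrow> complex"
  shows "(\<Sum>p\<in>X. \<Sum>q\<in>X. \<Sum>r\<in>X. \<Sum>w\<in>X. \<Sum>u\<in>X. \<Sum>v\<in>X. f p q r u v w) =
         (\<Sum>u\<in>X. \<Sum>v\<in>X. \<Sum>w\<in>X. \<Sum>p\<in>X. \<Sum>q\<in>X. \<Sum>r\<in>X. f p q r u v w)" (is ?A)
    and "(\<Sum>p\<in>X. \<Sum>q\<in>X. \<Sum>u\<in>X. \<Sum>r\<in>X. \<Sum>v\<in>X. \<Sum>w\<in>X. f p q r u v w) =
         (\<Sum>u\<in>X. \<Sum>v\<in>X. \<Sum>w\<in>X. \<Sum>p\<in>X. \<Sum>q\<in>X. \<Sum>r\<in>X. f p q r u v w)" (is ?B)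
proof -
  show ?A
    unfolding sum.cartesian_product
    by (rule sum.reindex_bij_witness[where
          j = "\<lambda>(p, q, r, w, u, v). (u, v, w, p, q, r)" and
          i = "\<lambda>(u, v, w, p, q, r). (p, q, r, w, u, v)"]) auto
  show ?B
    unfolding sum.cartesian_product
    by (rule sum.reindex_bij_witness[where
          j = "\<lambda>(p, q, u, r, v, w). (u, v, w, p, q, r)" and
          i = "\<lambda>(u, v, w, p, q, r). (p, q, u, r, v, w)"]) auto
qed

lemmas act_simps = act_Cap act_Cup act_Cross

lemma split_row:
  assumes "x \<in> label_lists X (length e)" "i + k \<le> length e"
  obtains l m r el em er where "x = l @ m @ r" "length l = i" "m \<in> label_lists X k"
    "e = el @ em @ er" "length el = i" "length em = k"
  using split_label_lists[OF assms] split_list_at[OF assms(2)] by metis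

text \<open>Each case isolates the few labels that the move touches and becomes a single axiom of
  the model: \<open>rotate\<close> for the slides, \<open>cross_R1\<close> to
  \<open>cross_R3\<close> for the Reidemeister moves. The snakes are contractions of two delta
  functions.\<close>

lemma local_move_val:
  assumes "local_move D D'" and "run D e \<noteq> None" "run D' e \<noteq> None" and "x \<in> label_lists X (length e)"
  shows "val X W D e F x = val X W D' e F x"
proof -
  have lx: "length x = length e"
    using assms(4) by (simp add: label_lists_def)
  show ?thesis
    using assms(1)
  proof (cases rule: local_move.cases)
    case (interchange i p m q)
    then obtain e1 e2 where "step (i, p) e = Some e1" "step (i + ins p + m, q) e = Some e2"
      using assms(2,3) by (auto simp: bind_eq_Some_conv)
    then show ?thesis
      unfolding interchange by (rule val_interchange[OF _ _ lx])
  next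
    case (snake_left i d)
    then have "i + 1 \<le> length e"
      using assms(2) by (auto split: if_splits)
    then obtain l m r where "x = l @ m @ r" "length l = i" "m \<in> label_lists X 1"
      using split_label_lists[OF assms(4)] by blast
    moreover then obtain a where "m = [a]" "a \<in> X"
      by (auto simp: label_lists_def length_Suc_conv)
    ultimately show ?thesis
      using snake_left by (simp add: act_simps sum_delta_left nth_append)
  next
    case (snake_right i d)
    then have "i + 1 \<le> length e"
      using assms(2) by (auto split: if_splits)
    then obtain l m r where "x = l @ m @ r" "length l = i" "m \<in> label_lists X 1"
      using split_label_lists[OF assms(4)] by blast
    moreover then obtain a where "m = [a]" "a \<in> X"
      by (auto simp: label_lists_def length_Suc_conv)
    ultimately show ?thesis
      using snake_right by (simp add: act_simps sum_delta_right nth_append)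
  next
    case (slide_cap i d b)
    then have i: "i + 1 \<le> length e"
      using assms(2) by (auto split: if_splits)
    obtain l m r el em er where *: "x = l @ m @ r" "length l = i" "m \<in> label_lists X 1"
      "e = el @ em @ er" "length el = i" "length em = 1"
      using split_row[OF assms(4) i] .
    then obtain a e0 where m: "m = [a]" "a \<in> X" "em = [e0]"
      by (auto simp: label_lists_def length_Suc_conv)
    have "val X W D e F x = (\<Sum>c\<in>X. \<Sum>p\<in>X. \<Sum>s\<in>X. W e0 d b a c p s * F (l @ p # s # c # r))"
      using slide_cap * m by (simp add: act_simps nth_append)
    also have "\<dots> = (\<Sum>p\<in>X. \<Sum>s\<in>X. \<Sum>c\<in>X. W e0 d b a c p s * F (l @ p # s # c # r))"
      by (subst sum.swap) (intro sum.cong refl sum.swap)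
    also have "\<dots> = (\<Sum>p\<in>X. \<Sum>s\<in>X. \<Sum>c\<in>X. W (flip d) e0 (\<not> b) p a s c * F (l @ p # s # c # r))"
    proof -
      have "W e0 d b a c p s = W (flip d) e0 (\<not> b) p a s c" for c p s
        using rotate[of "flip d" e0 "\<not> b" p a s c] by simp
      then show ?thesis by simp
    qed
    also have "\<dots> = val X W D' e F x"
      using slide_cap * m by (simp add: act_simps nth_append)
    finally show ?thesis .
  next
    case (slide_cup i b)
    then have i: "i + 3 \<le> length e"
      using assms(2) by (auto split: if_splits)
    obtain l m r el em er where *: "x = l @ m @ r" "length l = i" "m \<in> label_lists X 3"
      "e = el @ em @ er" "length el = i" "length em = 3"
      using split_row[OF assms(4) i] .
    obtain a1 a2 a3 where m: "m = [a1, a2, a3]" "a1 \<in> X" "a2 \<in> X" "a3 \<in> X"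
      using *(3) by (rule label_lists_3E)
    obtain e1 e2 e3 where em: "em = [e1, e2, e3]"
      using *(6) by (auto simp: numeral_3_eq_3 length_Suc_conv)
    \<comment> \<open>The cup joins the first and third strand, so their directions are opposite;
      this supplies the \<open>flip\<close> on the right-hand side of \<open>rotate\<close>.\<close>
    have "e1 \<noteq> e3"
      using assms(2) slide_cup * em by (auto simp: nth_append split: if_splits)
    then have e3: "e3 = flip e1"
      by (cases e1; cases e3) auto
    have "val X W D e F x = (\<Sum>p\<in>X. W e1 e2 b a1 a2 p a3 * F (l @ p # r))"
      using slide_cup * m em by (simp add: act_simps nth_append sum_delta_right mult.left_commute)
    also have "\<dots> = (\<Sum>p\<in>X. W e2 e3 (\<not> b) a2 a3 a1 p * F (l @ p # r))"
      unfolding e3 rotate[of e1 e2 b a1 a2] ..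
    also have "\<dots> = val X W D' e F x"
      using slide_cup * m em
      by (simp add: act_simps nth_append sum_delta_left mult.left_commute sum_distrib_left[symmetric])
    finally show ?thesis .
  next
    case (R1_cap i d b)
    then have i: "i + 0 \<le> length e"
      using assms(2) by (auto split: if_splits)
    obtain l m r el em er where *: "x = l @ m @ r" "length l = i" "m \<in> label_lists X 0"
      "e = el @ em @ er" "length el = i" "length em = 0"
      using split_row[OF assms(4) i] .
    have "val X W D e F x = (\<Sum>c\<in>X. \<Sum>p\<in>X. \<Sum>s\<in>X. W d (flip d) b c c p s * F (l @ p # s # r))"
      using R1_cap * by (simp add: act_simps nth_append)
    also have "\<dots> = (\<Sum>p\<in>X. \<Sum>s\<in>X. \<Sum>c\<in>X. W d (flip d) b c c p s * F (l @ p # s # r))"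
      by (subst sum.swap) (intro sum.cong refl sum.swap)
    also have "\<dots> = (\<Sum>p\<in>X. F (l @ p # p # r))"
      by (simp add: cross_R1 sum_distrib_right[symmetric] sum_delta_left)
    also have "\<dots> = val X W D' e F x"
      using R1_cap * by (simp add: act_simps)
    finally show ?thesis .
  next
    case (R1_cup i b)
    then have i: "i + 2 \<le> length e"
      using assms(2) by (auto split: if_splits)
    obtain l m r el em er where *: "x = l @ m @ r" "length l = i" "m \<in> label_lists X 2"
      "e = el @ em @ er" "length el = i" "length em = 2"
      using split_row[OF assms(4) i] .
    obtain a1 a2 where m: "m = [a1, a2]" "a1 \<in> X" "a2 \<in> X"
      using *(3) by (rule label_lists_2E)
    obtain e1 e2 where em: "em = [e1, e2]"
      using *(6) by (auto simp: numeral_2_eq_2 length_Suc_conv)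
    have "e1 \<noteq> e2"
      using assms(3) R1_cup * em by (auto simp: nth_append split: if_splits)
    then have e2: "e2 = flip e1"
      by (cases e1; cases e2) auto
    have "val X W D e F x = (\<Sum>p\<in>X. W e1 e2 b a1 a2 p p) * F (l @ r)"
      using R1_cup * m em
      by (simp add: act_simps nth_append sum_delta_left mult.left_commute sum_distrib_right)
    also have "\<dots> = val X W D' e F x"
      using R1_cup * m em by (simp add: act_simps nth_append W_R1_cup e2)
    finally show ?thesis .
  next
    case (R2 i b)
    then have i: "i + 2 \<le> length e"
      using assms(2) by (auto split: if_splits)
    obtain l m r el em er where *: "x = l @ m @ r" "length l = i" "m \<in> label_lists X 2"
      "e = el @ em @ er" "length el = i" "length em = 2"
      using split_row[OF assms(4) i] .
    obtain a1 a2 where m: "m = [a1, a2]" "a1 \<in> X" "a2 \<in> X"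
      using *(3) by (rule label_lists_2E)
    obtain e1 e2 where em: "em = [e1, e2]"
      using *(6) by (auto simp: numeral_2_eq_2 length_Suc_conv)
    have "val X W D e F x = (\<Sum>p\<in>X. \<Sum>s\<in>X. \<Sum>u\<in>X. \<Sum>v\<in>X.
        W e1 e2 b a1 a2 p s * W e2 e1 (\<not> b) p s u v * F (l @ u # v # r))"
      using R2 * m em by (simp add: act_simps nth_append sum_distrib_left mult.assoc)
    also have "\<dots> = (\<Sum>u\<in>X. \<Sum>v\<in>X. \<Sum>p\<in>X. \<Sum>s\<in>X.
        W e1 e2 b a1 a2 p s * W e2 e1 (\<not> b) p s u v * F (l @ u # v # r))"
      unfolding sum.cartesian_product
      by (rule sum.reindex_bij_witness[where
            j = "\<lambda>(p, s, u, v). (u, v, p, s)" and i = "\<lambda>(u, v, p, s). (p, s, u, v)"]) auto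
    also have "\<dots> = (\<Sum>u\<in>X. \<Sum>v\<in>X. of_bool (a1 = u) * (of_bool (a2 = v) * F (l @ u # v # r)))"
      using cross_R2[OF m(2,3)]
      by (intro sum.cong refl) (simp add: sum_distrib_right[symmetric] of_bool_conj)
    also have "\<dots> = val X W D' e F x"
      using R2 * m by (simp add: sum_distrib_left[symmetric] sum_delta_left)
    finally show ?thesis .
  next
    case (R3 a c b i)
    then have i: "i + 3 \<le> length e"
      using assms(2) by (auto split: if_splits)
    obtain l m r el em er where *: "x = l @ m @ r" "length l = i" "m \<in> label_lists X 3"
      "e = el @ em @ er" "length el = i" "length em = 3"
      using split_row[OF assms(4) i] .
    obtain a1 a2 a3 where m: "m = [a1, a2, a3]" "a1 \<in> X" "a2 \<in> X" "a3 \<in> X"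
      using *(3) by (rule label_lists_3E)
    obtain e1 e2 e3 where em: "em = [e1, e2, e3]"
      using *(6) by (auto simp: numeral_3_eq_3 length_Suc_conv)
    have "val X W D e F x = (\<Sum>p\<in>X. \<Sum>q\<in>X. \<Sum>s\<in>X. \<Sum>w\<in>X. \<Sum>u\<in>X. \<Sum>v\<in>X.
        W e1 e2 a a1 a2 p q * W e1 e3 b q a3 s w * W e2 e3 c p s u v * F (l @ u # v # w # r))"
      using R3 * m em by (simp add: act_simps nth_append sum_distrib_left mult.assoc)
    also have "\<dots> = (\<Sum>u\<in>X. \<Sum>v\<in>X. \<Sum>w\<in>X. (\<Sum>p\<in>X. \<Sum>q\<in>X. \<Sum>s\<in>X.
        W e1 e2 a a1 a2 p q * W e1 e3 b q a3 s w * W e2 e3 c p s u v) * F (l @ u # v # w # r))"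
      unfolding sum_distrib_right by (rule sum6_reorder(1))
    also have "\<dots> = (\<Sum>u\<in>X. \<Sum>v\<in>X. \<Sum>w\<in>X. (\<Sum>p\<in>X. \<Sum>q\<in>X. \<Sum>s\<in>X.
        W e2 e3 c a2 a3 p q * W e1 e3 b a1 p u s * W e1 e2 a s q v w) * F (l @ u # v # w # r))"
      using m R3(3) by (intro sum.cong refl arg_cong2[where f = "(*)"] cross_R3) auto
    also have "\<dots> = (\<Sum>p\<in>X. \<Sum>q\<in>X. \<Sum>u\<in>X. \<Sum>s\<in>X. \<Sum>v\<in>X. \<Sum>w\<in>X.
        W e2 e3 c a2 a3 p q * W e1 e3 b a1 p u s * W e1 e2 a s q v w * F (l @ u # v # w # r))"
      unfolding sum_distrib_right by (rule sum6_reorder(2)[symmetric])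
    also have "\<dots> = val X W D' e F x"
      using R3 * m em by (simp add: act_simps nth_append sum_distrib_left mult.assoc)
    finally show ?thesis .
  qed
qed

text \<open>The part below the move produces the same vector on both sides, the segments that are
  exchanged act on it equally, and the common part above carries the result to the top.\<close>

theorem val_isotopic:
  assumes "(D, D') \<in> isotopic"
  shows "val X W D [] F [] = val X W D' [] F []"
proof -
  have move: "val X W D [] F [] = val X W D' [] F []" if move: "(D, D') \<in> move" for D D'
  proof -
    obtain u v l r where D: "D = u @ l @ v" "D' = u @ r @ v" "local_move l r" "diagram D" "diagram D'"
      using move unfolding move_def by blast
    then obtain e el er where e: "run u [] = Some e" "run l e = Some el" "run v el = Some []"
      "run r e = Some er" "run v er = Some []"
      by (auto simp: diagram_def run_append bind_eq_Some_conv)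
    then have "el = er"
      using local_move_run[OF D(3)] by blast
    then have "val X W (l @ v) e F x = val X W (r @ v) e F x" if "x \<in> label_lists X (length e)" for x
      using e local_move_val[OF D(3)] that by (simp add: val_append)
    then show ?thesis
      unfolding D val_append[OF e(1)] by (intro val_cong[OF e(1)]) auto
  qed
  have "(D, D') \<in> (move \<union> move\<inverse>)\<^sup>*"
    using assms by (simp add: isotopic_def)
  then show ?thesis
    by induction (auto dest: move)
qed

end

section \<open>Functions on classes\<close>

definition class_of :: "'a set \<Rightarrow> ('a \<times> 'a) set \<Rightarrow> 'a \<Rightarrow> 'a set" where
  "class_of X r x = (THE R. R \<in> classes X r \<and> x \<in> R)"

definition respecting :: "'a set \<Rightarrow> ('a \<times> 'a) set \<Rightarrow> 'b set \<Rightarrow> ('a \<Rightarrow> 'b) set" where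
  "respecting X r Y = {f \<in> X \<rightarrow>\<^sub>E Y. \<forall>(x, y)\<in>r. x \<in> X \<longrightarrow> y \<in> X \<longrightarrow> f x = f y}"

definition class_eq :: "'a set \<Rightarrow> ('a \<times> 'a) set \<Rightarrow> ('a \<times> 'a) set" where
  "class_eq X r = {(x, y). x \<in> X \<and> y \<in> X \<and> (x, y) \<in> (Restr r X \<union> (Restr r X)\<inverse>)\<^sup>*}"

lemma equiv_class_eq: "equiv X (class_eq X r)"
proof (rule equivI)
  show "class_eq X r \<subseteq> X \<times> X" "refl_on X (class_eq X r)"
    by (auto simp: class_eq_def refl_on_def)
  have "sym ((Restr r X \<union> (Restr r X)\<inverse>)\<^sup>*)"
    by (intro sym_rtrancl) (auto simp: sym_def)
  then show "sym (class_eq X r)"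
    by (auto simp: class_eq_def sym_def)
  show "trans (class_eq X r)"
    by (rule transI) (auto simp: class_eq_def)
qed

lemma classes_eq: "classes X r = X // class_eq X r"
  by (simp add: classes_def class_eq_def)

lemma class_of_eq: "x \<in> X \<Longrightarrow> class_of X r x = class_eq X r `` {x}"
  unfolding class_of_def classes_eq
  using equiv_class_eq[of X r] quotientI[of x X "class_eq X r"] equiv_class_self[of X "class_eq X r" x]
  by (intro the_equality) (auto dest: quotient_eqI quotient_eq_iff simp: quotient_def equiv_class_eq_iff)

lemma class_of_in: "x \<in> X \<Longrightarrow> class_of X r x \<in> classes X r"
  by (simp add: class_of_eq classes_eq quotientI)

lemma class_eqI: "(x, y) \<in> r \<Longrightarrow> x \<in> X \<Longrightarrow> y \<in> X \<Longrightarrow> class_of X r x = class_of X r y"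
proof -
  assume "(x, y) \<in> r" "x \<in> X" "y \<in> X"
  then have "(x, y) \<in> class_eq X r"
    by (auto simp: class_eq_def)
  then show ?thesis
    using \<open>x \<in> X\<close> \<open>y \<in> X\<close> by (simp add: class_of_eq equiv_class_eq[THEN equiv_class_eq_iff])
qed

lemma classes_class_of: "R \<in> classes X r \<Longrightarrow> \<exists>x\<in>X. R = class_of X r x"
  by (auto simp: classes_eq quotient_def class_of_eq)

lemma respecting_class:
  assumes "f \<in> respecting X r Y" "x \<in> X" "y \<in> X" "class_of X r x = class_of X r y"
  shows "f x = f y"
proof -
  have "(x, y) \<in> class_eq X r"
    using assms equiv_class_eq_iff[OF equiv_class_eq[of X r]] by (simp add: class_of_eq)
  then have "(x, y) \<in> (Restr r X \<union> (Restr r X)\<inverse>)\<^sup>*"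
    by (simp add: class_eq_def)
  then show ?thesis
    by induction (use assms(1) in \<open>auto simp: respecting_def\<close>)
qed

text \<open>Used for two gluings: for circles it turns a power of the number of labels into a count
  of labelings of points, for regions it turns colorings into labelings of gaps.\<close>

lemma bij_betw_classes:
  "bij_betw (\<lambda>C. restrict (\<lambda>x. C (class_of X r x)) X) (classes X r \<rightarrow>\<^sub>E Y) (respecting X r Y)"
proof (rule bij_betwI)
  let ?g = "\<lambda>f. restrict (\<lambda>R. f (SOME x. x \<in> X \<and> class_of X r x = R)) (classes X r)"
  have some: "(SOME x. x \<in> X \<and> class_of X r x = R) \<in> X \<and> class_of X r (SOME x. x \<in> X \<and> class_of X r x = R) = R"
    if "R \<in> classes X r" for R
    using classes_class_of[OF that] by (metis (mono_tags, lifting) someI)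
  show "(\<lambda>C. restrict (\<lambda>x. C (class_of X r x)) X) \<in> (classes X r \<rightarrow>\<^sub>E Y) \<rightarrow> respecting X r Y"
    by (auto simp: respecting_def class_of_in dest: class_eqI)
  show "?g \<in> respecting X r Y \<rightarrow> classes X r \<rightarrow>\<^sub>E Y"
    using some by (intro Pi_I restrict_PiE_iff[THEN iffD2] ballI) (auto simp: respecting_def)
  show "?g (restrict (\<lambda>x. C (class_of X r x)) X) = C" if C: "C \<in> classes X r \<rightarrow>\<^sub>E Y" for C
  proof
    fix R
    show "?g (restrict (\<lambda>x. C (class_of X r x)) X) R = C R"
    proof (cases "R \<in> classes X r")
      case True
      then show ?thesis
        using some[OF True] by simp
    next
      case False
      then show ?thesis
        using PiE_arb[OF C False] by simp
    qed
  qed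
  show "restrict (\<lambda>x. ?g f (class_of X r x)) X = f" if f: "f \<in> respecting X r Y" for f
  proof
    fix x
    show "restrict (\<lambda>x. ?g f (class_of X r x)) X x = f x"
    proof (cases "x \<in> X")
      case True
      have "f (SOME y. y \<in> X \<and> class_of X r y = class_of X r x) = f x"
        using some[OF class_of_in[OF True]] by (intro respecting_class[OF f _ True]) auto
      with True show ?thesis
        by (simp add: class_of_in)
    next
      case False
      then show ?thesis
        using f by (auto simp: respecting_def)
    qed
  qed
qed

lemma finite_classes: "finite X \<Longrightarrow> finite (classes X r)"
  unfolding classes_eq using equiv_class_eq[of X r] by (intro finite_quotient) (auto simp: equiv_def)

lemma card_respecting:
  assumes "finite X"
  shows "card (respecting X r Y) = card Y ^ card (classes X r)"
  using bij_betw_same_card[OF bij_betw_classes[of X r Y]] card_PiE[OF finite_classes[OF assms, of r], of "\<lambda>_. Y"]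
  by simp

section \<open>Evaluation of Laurent polynomials\<close>

text \<open>With \<open>g\<close> a character of the group of exponents, this is the ring
  homomorphism from the group algebra that extends \<open>g\<close>.\<close>

definition laurent_eval :: "('e \<Rightarrow> 'b) \<Rightarrow> ('e \<Rightarrow>\<^sub>0 int) \<Rightarrow> 'b::comm_ring_1" where
  "laurent_eval g p = (\<Sum>m\<in>Poly_Mapping.keys p. of_int (Poly_Mapping.lookup p m) * g m)"

lemma laurent_eval_superset:
  "finite K \<Longrightarrow> Poly_Mapping.keys p \<subseteq> K \<Longrightarrow> laurent_eval g p = (\<Sum>m\<in>K. of_int (Poly_Mapping.lookup p m) * g m)"
  unfolding laurent_eval_def by (intro sum.mono_neutral_left) (auto simp: in_keys_iff)

lemma laurent_eval_add: "laurent_eval g (p + q) = laurent_eval g p + laurent_eval g q"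
proof -
  let ?K = "Poly_Mapping.keys p \<union> Poly_Mapping.keys q"
  have "laurent_eval g (p + q) = (\<Sum>m\<in>?K. of_int (Poly_Mapping.lookup (p + q) m) * g m)"
    using keys_add[of p q] by (intro laurent_eval_superset) auto
  moreover have "laurent_eval g p = (\<Sum>m\<in>?K. of_int (Poly_Mapping.lookup p m) * g m)"
    "laurent_eval g q = (\<Sum>m\<in>?K. of_int (Poly_Mapping.lookup q m) * g m)"
    by (intro laurent_eval_superset; auto)+
  ultimately show ?thesis
    by (simp add: lookup_add distrib_right sum.distrib)
qed

lemma laurent_eval_single: "laurent_eval g (Poly_Mapping.single m c) = of_int c * g m"
  by (simp add: laurent_eval_def)

lemma laurent_eval_0 [simp]: "laurent_eval g 0 = 0"
  by (simp add: laurent_eval_def)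

locale ring_hom =
  fixes h :: "'a::comm_ring_1 \<Rightarrow> 'b::comm_ring_1"
  assumes hom_add: "h (x + y) = h x + h y"
    and hom_mult: "h (x * y) = h x * h y"
    and hom_one [simp]: "h 1 = 1"
begin

lemma hom_zero [simp]: "h 0 = 0"
  using hom_add[of 0 0] by simp

lemma hom_uminus: "h (- x) = - h x"
  using hom_add[of x "- x"] by (simp add: eq_neg_iff_add_eq_0 add.commute)

lemma hom_minus: "h (x - y) = h x - h y"
  using hom_add[of x "- y"] by (simp add: hom_uminus)

lemma hom_power: "h (x ^ n) = h x ^ n"
  by (induction n) (simp_all add: hom_mult)

lemma hom_sum: "h (sum f A) = (\<Sum>x\<in>A. h (f x))"
  by (induction A rule: infinite_finite_induct) (simp_all add: hom_add)

lemma hom_prod: "h (prod f A) = (\<Prod>x\<in>A. h (f x))"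
  by (induction A rule: infinite_finite_induct) (simp_all add: hom_mult)

end

lemma ring_hom_laurent_eval:
  fixes g :: "'e::comm_monoid_add \<Rightarrow> 'b::comm_ring_1"
  assumes "g 0 = 1" "\<And>m n. g (m + n) = g m * g n"
  shows "ring_hom (laurent_eval g)"
proof
  show "laurent_eval g (p + q) = laurent_eval g p + laurent_eval g q" for p q
    by (rule laurent_eval_add)
  show "laurent_eval g 1 = 1"
    using laurent_eval_single[of g 0 1] assms(1) by simp
  have single: "laurent_eval g (Poly_Mapping.single m c * q) = of_int c * g m * laurent_eval g q" for m c q
  proof (induction q rule: update_induct)
    case (update q n d)
    \<comment> \<open>The key \<open>n\<close> is new to \<open>q\<close>, so the update amounts to
      adding a monomial and the induction becomes additive.\<close>
    then have "Poly_Mapping.update n d q = q + Poly_Mapping.single n d"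
      by (intro poly_mapping_eqI) (auto simp: lookup_add lookup_update lookup_single in_keys_iff when_def)
    then show ?case
      using update.IH
      by (simp add: distrib_left laurent_eval_add mult_single laurent_eval_single assms(2) algebra_simps)
  qed simp
  show "laurent_eval g (p * q) = laurent_eval g p * laurent_eval g q" for p q
  proof (induction p rule: update_induct)
    case (update p n d)
    then have "Poly_Mapping.update n d p = p + Poly_Mapping.single n d"
      by (intro poly_mapping_eqI) (auto simp: lookup_add lookup_update lookup_single in_keys_iff when_def)
    then show ?case
      using update.IH
      by (simp add: distrib_right laurent_eval_add single laurent_eval_single)
  qed simp
qed

section \<open>Powers of units\<close>

lemma unit_inv_eqI: "a * b = 1 \<Longrightarrow> unit_inv a = b"
  unfolding unit_inv_def by (rule the_equality) (metis mult.assoc mult.commute mult.left_neutral)+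

lemma unit_inv_right:
  assumes "a dvd 1" shows "a * unit_inv a = 1"
  using assms unit_inv_eqI by (metis dvdE)

lemma unit_power_int_0 [simp]: "a ^^^ 0 = 1"
  by (simp add: unit_power_int_def)

lemma unit_power_int_1 [simp]: "a ^^^ 1 = a"
  by (simp add: unit_power_int_def)

lemma unit_power_int_m1 [simp]: "a ^^^ (-1) = unit_inv a"
  by (simp add: unit_power_int_def)

lemma unit_inv_field: "a \<noteq> 0 \<Longrightarrow> unit_inv a = inverse (a :: 'a::field)"
  by (rule unit_inv_eqI) simp

lemma unit_power_int_field: "a \<noteq> 0 \<Longrightarrow> a ^^^ m = (a :: 'a::field) powi m"
  by (simp add: unit_power_int_def power_int_def unit_inv_field)

lemma (in ring_hom) hom_unit: "a dvd 1 \<Longrightarrow> h a dvd 1"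
  by (metis dvd_def hom_mult hom_one)

lemma (in ring_hom) hom_unit_inv: "a dvd 1 \<Longrightarrow> h (unit_inv a) = unit_inv (h a)"
  using unit_inv_eqI[of "h a" "h (unit_inv a)"] unit_inv_right[of a] by (metis hom_mult hom_one)

lemma (in ring_hom) hom_unit_power_int: "a dvd 1 \<Longrightarrow> h (a ^^^ m) = h a ^^^ m"
  by (simp add: unit_power_int_def hom_power hom_unit_inv)

lemma unit_power_int_Suc:
  assumes "a dvd 1" shows "a ^^^ (m + 1) = a * a ^^^ m"
proof -
  have "unit_inv a ^ nat (- m) = a * unit_inv a ^ nat (- m) * unit_inv a"
    using unit_inv_right[OF assms] by (metis mult.assoc mult.commute mult.left_neutral)
  moreover have "nat (- m) = Suc (nat (- (m + 1)))" if "m < 0"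
    using that by simp
  ultimately show ?thesis
    using unit_inv_right[OF assms]
    by (auto simp: unit_power_int_def nat_add_distrib mult.assoc[symmetric])
qed

lemma unit_power_int_add:
  assumes "a dvd 1" shows "a ^^^ (m + n) = a ^^^ m * a ^^^ n"
proof (induction m rule: int_induct[of _ 0])
  case (step1 i)
  have "a ^^^ (i + 1 + n) = a * a ^^^ (i + n)"
    using unit_power_int_Suc[OF assms, of "i + n"] by (simp add: add_ac)
  then show ?case
    using step1 unit_power_int_Suc[OF assms, of i] by (simp add: mult.assoc)
next
  case (step2 i)
  have *: "x = y" if "a * x = a * y" for x y
    using that unit_inv_right[OF assms] by (metis mult.assoc mult.commute mult.left_neutral)
  have "a * a ^^^ (i - 1 + n) = a ^^^ (i + n)"
    using unit_power_int_Suc[OF assms, of "i - 1 + n"] by (simp add: algebra_simps)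
  moreover have "a * (a ^^^ (i - 1) * a ^^^ n) = a ^^^ i * a ^^^ n"
    using unit_power_int_Suc[OF assms, of "i - 1"] by (simp add: mult.assoc)
  ultimately show ?case
    using step2 * by metis
qed simp

lemma unit_power_int_sum:
  assumes "a dvd 1" "finite K"
  shows "a ^^^ (\<Sum>k\<in>K. m k) = (\<Prod>k\<in>K. a ^^^ m k)"
  using assms(2) by (induction K rule: finite_induct) (simp_all add: unit_power_int_add[OF assms(1)])

section \<open>Laurent polynomials in one variable\<close>

lemma laurent_eqI:
  fixes p q :: laurent_t
  assumes "infinite {z :: complex. z \<noteq> 0 \<and> laurent_eval (\<lambda>m. z powi m) p = laurent_eval (\<lambda>m. z powi m) q}"
  shows "p = q"
proof (rule ccontr)
  assume "p \<noteq> q"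
  define r where "r = p - q"
  have "r \<noteq> 0" using \<open>p \<noteq> q\<close> by (simp add: r_def)
  have r0: "laurent_eval (\<lambda>m. z powi m) r = 0" if "z \<noteq> 0"
    "laurent_eval (\<lambda>m. z powi m) p = laurent_eval (\<lambda>m. z powi m) q" for z :: complex
  proof -
    interpret ring_hom "laurent_eval (\<lambda>m. z powi m)"
      by (rule ring_hom_laurent_eval) (use that in \<open>simp_all add: power_int_add\<close>)
    show ?thesis
      unfolding r_def hom_minus using that by simp
  qed
  \<comment> \<open>Multiplying by the power -\<open>M\<close> of the variable clears the negative
    exponents and leaves a polynomial, which has finitely many roots unless it is zero.\<close>
  define M where "M = Min (Poly_Mapping.keys r)"
  have M: "M \<le> m" if "m \<in> Poly_Mapping.keys r" for m
    unfolding M_def using that by simp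
  define P where "P = (\<Sum>m\<in>Poly_Mapping.keys r. Polynomial.monom (of_int (Poly_Mapping.lookup r m) :: complex) (nat (m - M)))"
  have eval: "poly P z = laurent_eval (\<lambda>m. z powi m) r * z powi (- M)" if "z \<noteq> 0" for z
    unfolding P_def laurent_eval_def poly_sum poly_monom sum_distrib_right
  proof (rule sum.cong)
    fix m assume "m \<in> Poly_Mapping.keys r"
    then have "z ^ nat (m - M) = z powi (m + - M)"
      using M[of m] by (simp add: power_int_def)
    then have "z ^ nat (m - M) = z powi m * z powi (- M)"
      using power_int_add[of z m "- M"] that by simp
    then show "of_int (Poly_Mapping.lookup r m) * z ^ nat (m - M) = of_int (Poly_Mapping.lookup r m) * z powi m * z powi (- M)"
      by simp
  qed simp
  have "{z. z \<noteq> 0 \<and> laurent_eval (\<lambda>m. z powi m) p = laurent_eval (\<lambda>m. z powi m) q} \<subseteq> {z. poly P z = 0}"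
    using eval r0 by auto
  then have "infinite {z. poly P z = 0}"
    using assms finite_subset by blast
  then have "P = 0"
    using poly_roots_finite by blast
  obtain m where m: "m \<in> Poly_Mapping.keys r"
    using \<open>r \<noteq> 0\<close> by fastforce
  have "coeff P (nat (m - M)) = (\<Sum>k\<in>Poly_Mapping.keys r. if k = m then of_int (Poly_Mapping.lookup r k) else 0)"
    unfolding P_def coeff_sum using M m by (intro sum.cong) (auto simp: nat_eq_iff)
  also have "\<dots> = of_int (Poly_Mapping.lookup r m)"
    using m by simp
  finally show False
    using \<open>P = 0\<close> m by (simp add: in_keys_iff)
qed

section \<open>The Jones and linking models\<close>

text \<open>The first factor is the writhe normalization, -A^3 to the power of minus the sign. In
  the second, smoothings are delta functions: \<open>x = p \<and> y = r\<close> stands for two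
  vertical arcs and \<open>x = y \<and> p = r\<close> for a cup above a cap. The A-smoothing is the
  vertical one when \<open>b\<close> is false.\<close>

definition jones_weight :: "complex \<Rightarrow> nat cross_weight" where
  "jones_weight a d e b x y p r =
     (if (d = e) \<noteq> b then - inverse (a ^ 3) else - (a ^ 3)) *
     ((if b then inverse a else a) * of_bool (x = p \<and> y = r) +
      (if b then a else inverse a) * of_bool (x = y \<and> p = r))"

lemma kernel_sum:
  fixes f :: "nat \<Rightarrow> nat \<Rightarrow> complex"
  assumes "x < N" "y < N"
  shows "(\<Sum>p<N. \<Sum>r<N. (al * of_bool (x = p \<and> y = r) + be * of_bool (x = y \<and> p = r)) * f p r) =
    al * f x y + be * of_bool (x = y) * (\<Sum>p<N. f p p)"
proof -
  have "(al * of_bool (x = p \<and> y = r) + be * of_bool (x = y \<and> p = r)) * f p r =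
     al * ((if p = x then (if r = y then f p r else 0) else 0)) +
     be * of_bool (x = y) * (if r = p then f p r else 0)" for p r
    by (auto simp: distrib_right)
  moreover have "(\<Sum>r<N. if p = x then if r = y then f p r else 0 else 0) = (if p = x then f p y else 0)" for p
    using assms by simp
  moreover have "(\<Sum>p<N. \<Sum>r<N. if r = p then f p r else 0) = (\<Sum>p<N. f p p)"
    by simp
  ultimately show ?thesis
    using assms by (simp only: sum.distrib sum_distrib_left[symmetric]) simp
qed

lemma sum_delta_lessThan: "(x::nat) < N \<Longrightarrow> (\<Sum>p<N. of_bool (x = p) * f p) = (f x :: complex)"
  by (simp add: of_bool_def if_distrib[of "\<lambda>t. t * _"] cong: if_cong)

text \<open>The third Reidemeister move for crossings al + be K, where K is the cup above the cap.\<close>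

lemma kernel_R3:
  fixes N :: nat and al1 al2 al3 be1 be2 be3 :: complex
  defines "R \<equiv> \<lambda>al be x y p r. al * of_bool (x = p \<and> y = r) + be * of_bool (x = y \<and> p = (r :: nat))"
  assumes coeff: "al2 * (al1 * be3 + be1 * al3 + of_nat N * be1 * be3) + be1 * be2 * be3 = al1 * be2 * al3"
    and less: "x < N" "y < N" "z < N" "u < N" "v < N" "w < N"
  shows "(\<Sum>p<N. \<Sum>q<N. \<Sum>r<N. R al1 be1 x y p q * R al2 be2 q z r w * R al3 be3 p r u v) =
         (\<Sum>p<N. \<Sum>q<N. \<Sum>r<N. R al3 be3 y z p q * R al2 be2 x p u r * R al1 be1 r q v w)"
proof -
  have R_eq: "R al be = (\<lambda>x y p r. al * of_bool (x = p \<and> y = r) + be * of_bool (x = y \<and> p = r))" for al be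
    by (simp add: R_def)
  \<comment> \<open>These are the Temperley-Lieb diagrams on three strands: the identity
    \<open>K0\<close>, the two hooks \<open>K1\<close> and \<open>K2\<close>, and their products
    \<open>K12\<close> and \<open>K21\<close>. In this expansion the two sides of the move differ by
    an exchange of the coefficients of \<open>K1\<close> and \<open>K2\<close>, which
    \<open>coeff\<close> declares equal.\<close>
  define K1 K2 K21 K12 K0 :: complex where
    "K1 = of_bool (x = y \<and> u = v \<and> z = w)" "K2 = of_bool (x = u \<and> y = z \<and> v = w)"
    "K21 = of_bool (y = z \<and> x = w \<and> u = v)" "K12 = of_bool (x = y \<and> z = u \<and> v = w)"
    "K0 = of_bool (x = u \<and> y = v \<and> z = w)"
  have inner1: "(\<Sum>r<N. R al2 be2 q z r w * g r) = al2 * of_bool (z = w) * g q + be2 * of_bool (q = z) * g w"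
    if "q < N" for q and g :: "nat \<Rightarrow> complex"
  proof -
    have "R al2 be2 q z r w * g r =
        al2 * of_bool (z = w) * (of_bool (q = r) * g r) + be2 * of_bool (q = z) * (of_bool (w = r) * g r)" for r
      by (auto simp: R_def distrib_right)
    then show ?thesis
      using that less by (simp only: sum.distrib sum_distrib_left[symmetric] sum_delta_lessThan)
  qed
  have inner2: "(\<Sum>r<N. R al2 be2 x p u r * g r) = al2 * of_bool (x = u) * g p + be2 * of_bool (x = p) * g u"
    if "p < N" for p and g :: "nat \<Rightarrow> complex"
  proof -
    have "R al2 be2 x p u r * g r =
        al2 * of_bool (x = u) * (of_bool (p = r) * g r) + be2 * of_bool (x = p) * (of_bool (u = r) * g r)" for r
      by (auto simp: R_def distrib_right)
    then show ?thesis
      using that less by (simp only: sum.distrib sum_distrib_left[symmetric] sum_delta_lessThan)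
  qed
  have "(\<Sum>p<N. \<Sum>q<N. \<Sum>r<N. R al1 be1 x y p q * R al2 be2 q z r w * R al3 be3 p r u v) =
      (\<Sum>p<N. \<Sum>q<N. R al1 be1 x y p q *
         (al2 * of_bool (z = w) * R al3 be3 p q u v + be2 * of_bool (q = z) * R al3 be3 p w u v))"
    by (simp add: mult.assoc sum_distrib_left[symmetric] inner1)
  also have "\<dots> = al1 * (al2 * of_bool (z = w) * R al3 be3 x y u v + be2 * of_bool (y = z) * R al3 be3 x w u v) +
      be1 * of_bool (x = y) *
        (\<Sum>p<N. al2 * of_bool (z = w) * R al3 be3 p p u v + be2 * of_bool (p = z) * R al3 be3 p w u v)"
    unfolding R_eq[of al1 be1] by (rule kernel_sum) (use less in auto)
  also have "(\<Sum>p<N. al2 * of_bool (z = w) * R al3 be3 p p u v + be2 * of_bool (p = z) * R al3 be3 p w u v) =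
     al2 * of_bool (z = w) * (al3 + of_nat N * be3) * of_bool (u = v) + be2 * R al3 be3 z w u v"
  proof -
    have "al2 * of_bool (z = w) * R al3 be3 p p u v + be2 * of_bool (p = z) * R al3 be3 p w u v =
      al2 * of_bool (z = w) * al3 * (of_bool (u = p) * of_bool (p = v)) + al2 * of_bool (z = w) * be3 * of_bool (u = v)
      + be2 * (of_bool (z = p) * R al3 be3 p w u v)" for p
      by (auto simp: R_def algebra_simps)
    then show ?thesis
      using less by (simp only: sum.distrib sum_distrib_left[symmetric] sum_delta_lessThan) (simp add: algebra_simps)
  qed
  finally have L: "(\<Sum>p<N. \<Sum>q<N. \<Sum>r<N. R al1 be1 x y p q * R al2 be2 q z r w * R al3 be3 p r u v) =
      al1 * al2 * al3 * K0 + al1 * be2 * be3 * K21 + be1 * be2 * al3 * K12 + al1 * be2 * al3 * K2 +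
      (al2 * (al1 * be3 + be1 * al3 + of_nat N * be1 * be3) + be1 * be2 * be3) * K1"
    unfolding R_def K1_K2_K21_K12_K0_def of_bool_conj eq_commute[of w v] eq_commute[of u z] eq_commute[of u x]
    by (simp add: algebra_simps)
  have "(\<Sum>p<N. \<Sum>q<N. \<Sum>r<N. R al3 be3 y z p q * R al2 be2 x p u r * R al1 be1 r q v w) =
      (\<Sum>p<N. \<Sum>q<N. R al3 be3 y z p q *
         (al2 * of_bool (x = u) * R al1 be1 p q v w + be2 * of_bool (x = p) * R al1 be1 u q v w))"
    by (simp add: mult.assoc sum_distrib_left[symmetric] inner2)
  also have "\<dots> = al3 * (al2 * of_bool (x = u) * R al1 be1 y z v w + be2 * of_bool (x = y) * R al1 be1 u z v w) +
      be3 * of_bool (y = z) *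
        (\<Sum>p<N. al2 * of_bool (x = u) * R al1 be1 p p v w + be2 * of_bool (x = p) * R al1 be1 u p v w)"
    unfolding R_eq[of al3 be3] by (rule kernel_sum) (use less in auto)
  also have "(\<Sum>p<N. al2 * of_bool (x = u) * R al1 be1 p p v w + be2 * of_bool (x = p) * R al1 be1 u p v w) =
     al2 * of_bool (x = u) * (al1 + of_nat N * be1) * of_bool (v = w) + be2 * R al1 be1 u x v w"
  proof -
    have "al2 * of_bool (x = u) * R al1 be1 p p v w + be2 * of_bool (x = p) * R al1 be1 u p v w =
      al2 * of_bool (x = u) * al1 * (of_bool (v = p) * of_bool (p = w)) + al2 * of_bool (x = u) * be1 * of_bool (v = w)
      + be2 * (of_bool (x = p) * R al1 be1 u p v w)" for p
      by (auto simp: R_def algebra_simps)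
    then show ?thesis
      using less by (simp only: sum.distrib sum_distrib_left[symmetric] sum_delta_lessThan) (simp add: algebra_simps)
  qed
  finally have "(\<Sum>p<N. \<Sum>q<N. \<Sum>r<N. R al3 be3 y z p q * R al2 be2 x p u r * R al1 be1 r q v w) =
      al1 * al2 * al3 * K0 + al1 * be2 * be3 * K21 + be1 * be2 * al3 * K12 + al1 * be2 * al3 * K1 +
      (al2 * (al1 * be3 + be1 * al3 + of_nat N * be1 * be3) + be1 * be2 * be3) * K2"
    unfolding R_def K1_K2_K21_K12_K0_def of_bool_conj eq_commute[of w v] eq_commute[of u z] eq_commute[of u x]
    by (simp add: algebra_simps)
  with L show ?thesis
    unfolding coeff by (simp only: add_ac)
qed

lemma state_model_jones:
  assumes "a \<noteq> 0" and N: "of_nat N = - (a\<^sup>2) - inverse a ^ 2"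
  shows "state_model {..<N} (jones_weight a)"
proof
  show "finite {..<N}" by simp
  show "jones_weight a d e b x y p r = jones_weight a e (flip d) (\<not> b) y r x p" for d e b x y p r
    by (cases d; cases e; cases b) (auto simp: jones_weight_def)
  \<comment> \<open>The value of a kink before normalization: A^(-1) + N A = -A^3 and A + N A^(-1) =
    -A^(-3). The writhe factor in the weight is chosen to cancel it.\<close>
  have NK: "of_nat N * a = - (a ^ 3) - inverse a" "of_nat N * inverse a = - inverse (a ^ 3) - a"
    unfolding N using assms(1) by (simp_all add: field_simps power2_eq_square power3_eq_cube)
  show "(\<Sum>x<N. jones_weight a d (flip d) b x x p r) = of_bool (p = r)"
    if "p \<in> {..<N}" "r \<in> {..<N}" for p r d b
  proof -
    have "d \<noteq> flip d"
      by (cases d) auto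
    then have "(\<Sum>x<N. jones_weight a d (flip d) b x x p r) =
       (if b then - inverse (a ^ 3) else - (a ^ 3)) * (\<Sum>x<N. (if b then inverse a else a) * (of_bool (p = x) * of_bool (r = x)) +
         (if b then a else inverse a) * of_bool (p = r))"
      by (auto simp: jones_weight_def sum_distrib_left intro!: sum.cong)
    also have "\<dots> = (if b then - inverse (a ^ 3) else - (a ^ 3)) *
       ((if b then inverse a else a) + of_nat N * (if b then a else inverse a)) * of_bool (p = r)"
      using that by (simp only: sum.distrib sum_distrib_left[symmetric] sum_delta_lessThan lessThan_iff)
        (simp add: algebra_simps)
    also have "\<dots> = of_bool (p = r)"
      using assms(1) by (cases b) (simp_all add: NK)
    finally show ?thesis .
  qed
  show "(\<Sum>p<N. \<Sum>r<N. jones_weight a d e b x y p r * jones_weight a e d (\<not> b) p r u v) = of_bool (x = u \<and> y = v)"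
    if "x \<in> {..<N}" "y \<in> {..<N}" "u \<in> {..<N}" "v \<in> {..<N}" for x y u v d e b
  proof -
    let ?al = "if b then inverse a else a" and ?be = "if b then a else inverse a"
    let ?R' = "\<lambda>p r. ?be * of_bool (p = u \<and> r = v) + ?al * of_bool (p = r \<and> u = v)"
    have "jones_weight a d e b x y p r * jones_weight a e d (\<not> b) p r u v =
        (?al * of_bool (x = p \<and> y = r) + ?be * of_bool (x = y \<and> p = r)) * ?R' p r" for p r
      using assms(1) by (cases b; cases "d = e") (auto simp: jones_weight_def)
    then have "(\<Sum>p<N. \<Sum>r<N. jones_weight a d e b x y p r * jones_weight a e d (\<not> b) p r u v) =
       ?al * ?R' x y + ?be * of_bool (x = y) * (\<Sum>p<N. ?R' p p)"
      using kernel_sum[of x N y ?al ?be ?R'] that by simp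
    also have "(\<Sum>p<N. ?R' p p) = (\<Sum>p<N. ?be * (of_bool (u = p) * of_bool (p = v)) + ?al * of_bool (u = v))"
      by (intro sum.cong) auto
    also have "\<dots> = (?be + of_nat N * ?al) * of_bool (u = v)"
      using that by (simp only: sum.distrib sum_distrib_left[symmetric] sum_delta_lessThan lessThan_iff)
        (simp add: algebra_simps)
    also have "?al * ?R' x y + ?be * of_bool (x = y) * ((?be + of_nat N * ?al) * of_bool (u = v)) =
      of_bool (x = u \<and> y = v) + (?al\<^sup>2 + ?be\<^sup>2 + of_nat N) * of_bool (x = y \<and> u = v)"
      using assms(1) by (cases b) (auto simp: algebra_simps power2_eq_square)
    \<comment> \<open>The coefficient of the hook vanishes because a circle is worth -A^2 -
      A^(-2).\<close>
    also have "?al\<^sup>2 + ?be\<^sup>2 + of_nat N = 0"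
      unfolding N by auto
    finally show ?thesis by simp
  qed
  show "(\<Sum>p<N. \<Sum>q<N. \<Sum>r<N. jones_weight a d1 d2 b1 x y p q * jones_weight a d1 d3 b2 q z r w * jones_weight a d2 d3 b3 p r u v) =
      (\<Sum>p<N. \<Sum>q<N. \<Sum>r<N. jones_weight a d2 d3 b3 y z p q * jones_weight a d1 d3 b2 x p u r * jones_weight a d1 d2 b1 r q v w)"
    if b: "\<not> (b1 = b3 \<and> b2 \<noteq> b1)" and X: "x \<in> {..<N}" "y \<in> {..<N}" "z \<in> {..<N}" "u \<in> {..<N}" "v \<in> {..<N}" "w \<in> {..<N}"
    for b1 b2 b3 x y z u v w d1 d2 d3
  proof -
    let ?s = "\<lambda>d e b. if (d = e) \<noteq> b then - inverse (a ^ 3) else - (a ^ 3)"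
    let ?al = "\<lambda>b. if b then inverse a else a" and ?be = "\<lambda>b. if b then a else inverse a"
    let ?R = "\<lambda>b x y p r. ?al b * of_bool (x = p \<and> y = r) + ?be b * of_bool (x = y \<and> p = r)"
    have coeff: "?al b2 * (?al b1 * ?be b3 + ?be b1 * ?al b3 + of_nat N * ?be b1 * ?be b3) + ?be b1 * ?be b2 * ?be b3 =
      ?al b1 * ?be b2 * ?al b3"
      unfolding N using b assms(1)
      by (cases b1; cases b2; cases b3) (auto simp: field_simps power2_eq_square)
    have J: "jones_weight a d e b x y p r = ?s d e b * ?R b x y p r" for d e b x y p r
      by (simp add: jones_weight_def)
    define S where "S = ?s d1 d2 b1 * ?s d1 d3 b2 * ?s d2 d3 b3"
    have "(\<Sum>p<N. \<Sum>q<N. \<Sum>r<N. jones_weight a d1 d2 b1 x y p q * jones_weight a d1 d3 b2 q z r w * jones_weight a d2 d3 b3 p r u v) =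
      S * (\<Sum>p<N. \<Sum>q<N. \<Sum>r<N. ?R b1 x y p q * ?R b2 q z r w * ?R b3 p r u v)"
      unfolding J S_def sum_distrib_left by (intro sum.cong refl) (simp only: mult_ac)
    also have "(\<Sum>p<N. \<Sum>q<N. \<Sum>r<N. ?R b1 x y p q * ?R b2 q z r w * ?R b3 p r u v) =
       (\<Sum>p<N. \<Sum>q<N. \<Sum>r<N. ?R b3 y z p q * ?R b2 x p u r * ?R b1 r q v w)"
      by (rule kernel_R3[OF coeff]) (use X in auto)
    also have "S * \<dots> = (\<Sum>p<N. \<Sum>q<N. \<Sum>r<N. jones_weight a d2 d3 b3 y z p q * jones_weight a d1 d3 b2 x p u r * jones_weight a d1 d2 b1 r q v w)"
      unfolding J S_def sum_distrib_left by (intro sum.cong refl) (simp only: mult_ac)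
    finally show ?thesis .
  qed
qed

text \<open>Labels follow the strands through the crossing and are therefore constant on components.
  The factor is 2 to the sign of the crossing when the overstrand carries True and the understrand
  False. The signs of the crossings of one component over another add up to their linking number, so
  a labeling is worth 2 to the linking number of its True part with its False part.\<close>

definition link_weight :: "bool cross_weight" where
  "link_weight d e b x y p r =
     of_bool (x = r \<and> y = p) *
     (if (if b then x \<and> \<not> y else y \<and> \<not> x) then if (d = e) \<noteq> b then 2 else 1 / 2 else 1)"

text \<open>At most one term of each sum survives. A kink is a crossing of a strand with itself,
  with equal labels and factor 1; the two crossings of R2 have opposite signs and the same
  overstrand; both sides of R3 have the same three crossings.\<close>

lemma state_model_link: "state_model UNIV link_weight"
proof
  show "link_weight d e b x y p r = link_weight e (flip d) (\<not> b) y r x p" for d e b x y p r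
    by (cases d; cases e; cases b) (auto simp: link_weight_def)
  show "(\<Sum>x\<in>UNIV. link_weight d (flip d) b x x p r) = of_bool (p = r)" for d b p r
    by (auto simp: link_weight_def UNIV_bool)
  show "(\<Sum>p\<in>UNIV. \<Sum>r\<in>UNIV. link_weight d e b x y p r * link_weight e d (\<not> b) p r u v) =
      of_bool (x = u \<and> y = v)" for d e b x y u v
    by (cases b; cases x; cases y) (auto simp: link_weight_def UNIV_bool)
  show "(\<Sum>p\<in>UNIV. \<Sum>q\<in>UNIV. \<Sum>r\<in>UNIV. link_weight d1 d2 a x y p q * link_weight d1 d3 b q z r w * link_weight d2 d3 c p r u v) =
    (\<Sum>p\<in>UNIV. \<Sum>q\<in>UNIV. \<Sum>r\<in>UNIV. link_weight d2 d3 c y z p q * link_weight d1 d3 b x p u r * link_weight d1 d2 a r q v w)"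
    for a b c x y z u v w d1 d2 d3
    by (cases x; cases y; cases z) (auto simp: link_weight_def UNIV_bool)
qed simp

section \<open>The ringed twist\<close>

text \<open>All eight crossings are between downward strands; the four of the twist have one sign
  and the four of the ring the other, so the writhe is zero. The right leg of the ring crosses both
  strands and returns, over them in one direction and under them in the other. Negating
  \<open>t\<close> changes every crossing.\<close>

definition ringed_twist :: "bool \<Rightarrow> slice list" where
  "ringed_twist t =
     [(0, Cap Up), (1, Cap Up), (2, Cross t), (2, Cross t), (2, Cross t), (2, Cross t),
      (2, Cap Up), (3, Cross (\<not> t)), (4, Cross (\<not> t)), (4, Cross (\<not> t)), (3, Cross (\<not> t)),
      (2, Cup), (1, Cup), (0, Cup)]"

lemma diagram_ringed_twist: "diagram (ringed_twist t)"
  by (simp add: diagram_def ringed_twist_def)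

lemma act_Cross_link:
  assumes "Suc i < length x" "Suc i < length e"
  shows "act UNIV link_weight (i, Cross b) e F x =
    (if (if b then x ! i \<and> \<not> x ! Suc i else x ! Suc i \<and> \<not> x ! i)
     then if (e ! i = e ! Suc i) \<noteq> b then 2 else 1 / 2 else 1) *
    F (take i x @ [x ! Suc i, x ! i] @ drop (i + 2) x)"
proof -
  have "(\<Sum>p\<in>UNIV. \<Sum>r\<in>UNIV. link_weight d d' b y z p r * f p r) =
    (if (if b then y \<and> \<not> z else z \<and> \<not> y) then if (d = d') \<noteq> b then 2 else 1 / 2 else 1) * f z y"
    for d d' y z and f :: "bool \<Rightarrow> bool \<Rightarrow> complex"
    by (cases y; cases z) (auto simp: link_weight_def UNIV_bool)
  then show ?thesis
    using assms by (simp only: state_model.act_Cross[OF state_model_link] Suc_eq_plus1)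
qed

lemma act_Cap_link:
  "act UNIV link_weight (i, Cap d) e F x =
     F (take i x @ [False, False] @ drop i x) + F (take i x @ [True, True] @ drop i x)"
  unfolding state_model.act_Cap[OF state_model_link] by (simp add: UNIV_bool)

lemma val_link_ringed_twist:
  "val UNIV link_weight (ringed_twist t) [] (\<lambda>_. 1) [] = (if t then 12 else 21 / 2)"
  unfolding ringed_twist_def
  by (cases t)
   (simp_all add: act_Cap_link state_model.act_Cup[OF state_model_link] act_Cross_link)

section \<open>Temperley-Lieb evaluation of the bracket of the example\<close>

lemma act_Cross_jones:
  assumes "Suc i < length x" "Suc i < length e" "set x \<subseteq> {..<N}"
  shows "act {..<N} (jones_weight a) (i, Cross b) e F x =
    (if (e ! i = e ! Suc i) \<noteq> b then - inverse (a ^ 3) else - (a ^ 3)) *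
    ((if b then inverse a else a) * F x +
     (if b then a else inverse a) * (of_bool (x ! i = x ! Suc i) *
       (\<Sum>p<N. F (take i x @ [p, p] @ drop (i + 2) x))))"
proof -
  have x: "x ! i < N" "x ! Suc i < N"
    using assms(1,3) by (meson Suc_lessD lessThan_iff nth_mem subsetD)+
  have "take i x @ [x ! i, x ! Suc i] @ drop (i + 2) x = x"
    using assms(1) by (simp add: Cons_nth_drop_Suc)
  then show ?thesis
    using kernel_sum[OF x, of "if b then inverse a else a" "if b then a else inverse a"
        "\<lambda>p r. F (take i x @ [p, r] @ drop (i + 2) x)"] assms(1,2)
    by (simp add: act.simps sum_label_lists_2 jones_weight_def mult.assoc sum_distrib_left[symmetric])
qed

text \<open>
  The five planar matchings of six points and the two of four points; these span the
  Temperley--Lieb modules in which the bracket of the example is computed.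
\<close>

fun tl6 :: "complex \<Rightarrow> complex \<Rightarrow> complex \<Rightarrow> complex \<Rightarrow> complex \<Rightarrow> nat list \<Rightarrow> complex" where
  "tl6 c1 c2 c3 c4 c5 [x0, x1, x2, x3, x4, x5] =
     c1 * (of_bool (x0 = x5) * of_bool (x1 = x4) * of_bool (x2 = x3)) +
     c2 * (of_bool (x0 = x5) * of_bool (x1 = x2) * of_bool (x3 = x4)) +
     c3 * (of_bool (x0 = x1) * of_bool (x2 = x3) * of_bool (x4 = x5)) +
     c4 * (of_bool (x0 = x3) * of_bool (x1 = x2) * of_bool (x4 = x5)) +
     c5 * (of_bool (x0 = x1) * of_bool (x2 = x5) * of_bool (x3 = x4))"
| "tl6 c1 c2 c3 c4 c5 _ = 0"

fun tl4 :: "complex \<Rightarrow> complex \<Rightarrow> nat list \<Rightarrow> complex" where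
  "tl4 c1 c2 [x0, x1, x2, x3] =
     c1 * (of_bool (x0 = x3) * of_bool (x1 = x2)) + c2 * (of_bool (x0 = x1) * of_bool (x2 = x3))"
| "tl4 c1 c2 _ = 0"

lemma label_lists_6E:
  assumes "y \<in> label_lists X 6"
  obtains x0 x1 x2 x3 x4 x5 where "y = [x0, x1, x2, x3, x4, x5]"
    "x0 \<in> X" "x1 \<in> X" "x2 \<in> X" "x3 \<in> X" "x4 \<in> X" "x5 \<in> X"
  using assms by (auto simp: label_lists_def eval_nat_numeral length_Suc_conv)

lemma label_lists_4E:
  assumes "y \<in> label_lists X 4"
  obtains x0 x1 x2 x3 where "y = [x0, x1, x2, x3]" "x0 \<in> X" "x1 \<in> X" "x2 \<in> X" "x3 \<in> X"
  using assms by (auto simp: label_lists_def eval_nat_numeral length_Suc_conv)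

lemma sum_delta2:
  "(x::nat) < N \<Longrightarrow> (\<Sum>p<N. of_bool (x = p) * of_bool (p = y)) = (of_bool (x = y) :: complex)"
  "(x::nat) < N \<Longrightarrow> (\<Sum>p<N. of_bool (p = y) * of_bool (x = p)) = (of_bool (x = y) :: complex)"
  "(x::nat) < N \<Longrightarrow> (\<Sum>p<N. of_bool (x = p) * of_bool (y = p)) = (of_bool (x = y) :: complex)"
  "(x::nat) < N \<Longrightarrow> (\<Sum>p<N. of_bool (p = x) * of_bool (p = y)) = (of_bool (x = y) :: complex)"
proof -
  assume "x < N"
  then show *: "(\<Sum>p<N. of_bool (x = p) * of_bool (p = y)) = (of_bool (x = y) :: complex)"
    by (rule sum_delta_lessThan)
  show "(\<Sum>p<N. of_bool (p = y) * of_bool (x = p)) = (of_bool (x = y) :: complex)"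
    "(\<Sum>p<N. of_bool (x = p) * of_bool (y = p)) = (of_bool (x = y) :: complex)"
    "(\<Sum>p<N. of_bool (p = x) * of_bool (p = y)) = (of_bool (x = y) :: complex)"
    unfolding *[symmetric] by (intro sum.cong refl; auto)+
qed

text \<open>Stacking the hook at the fourth and fifth point closes a circle, worth \<open>N\<close>,
  on the two matchings that already join these points, and sends each of the other three to one of
  those two.\<close>

lemma tl6_cup3:
  assumes "x0 < N" "x1 < N" "x2 < N" "x5 < N"
  shows "of_bool (x3 = x4) * (\<Sum>p<N. tl6 c1 c2 c3 c4 c5 [x0, x1, x2, p, p, x5]) =
    tl6 0 (c1 + of_nat N * c2 + c4) 0 0 (c3 + of_nat N * c5) [x0, x1, x2, x3, x4, x5]"
proof -
  have "(\<Sum>p<N. tl6 c1 c2 c3 c4 c5 [x0, x1, x2, p, p, x5]) =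
    (\<Sum>p<N. c1 * of_bool (x0 = x5) * (of_bool (x1 = p) * of_bool (p = x2)) +
      c2 * (of_bool (x0 = x5) * of_bool (x1 = x2)) +
      c3 * of_bool (x0 = x1) * (of_bool (x2 = p) * of_bool (p = x5)) +
      c4 * of_bool (x1 = x2) * (of_bool (x0 = p) * of_bool (p = x5)) +
      c5 * (of_bool (x0 = x1) * of_bool (x2 = x5)))"
    by (intro sum.cong refl) (auto simp: algebra_simps)
  also have "\<dots> = (c1 + of_nat N * c2 + c4) * (of_bool (x0 = x5) * of_bool (x1 = x2)) +
      (c3 + of_nat N * c5) * (of_bool (x0 = x1) * of_bool (x2 = x5))"
    using assms by (simp only: sum.distrib sum_distrib_left[symmetric] sum_delta2) (simp add: algebra_simps)
  finally show ?thesis by (simp add: algebra_simps)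
qed

lemma tl6_cup4:
  assumes "x0 < N" "x1 < N" "x2 < N" "x3 < N"
  shows "of_bool (x4 = x5) * (\<Sum>p<N. tl6 c1 c2 c3 c4 c5 [x0, x1, x2, x3, p, p]) =
    tl6 0 0 (c1 + of_nat N * c3 + c5) (c2 + of_nat N * c4) 0 [x0, x1, x2, x3, x4, x5]"
proof -
  have "(\<Sum>p<N. tl6 c1 c2 c3 c4 c5 [x0, x1, x2, x3, p, p]) =
    (\<Sum>p<N. c1 * of_bool (x2 = x3) * (of_bool (x0 = p) * of_bool (p = x1)) +
      c2 * of_bool (x1 = x2) * (of_bool (x0 = p) * of_bool (p = x3)) +
      c3 * (of_bool (x0 = x1) * of_bool (x2 = x3)) +
      c4 * (of_bool (x0 = x3) * of_bool (x1 = x2)) +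
      c5 * of_bool (x0 = x1) * (of_bool (x2 = p) * of_bool (p = x3)))"
    by (intro sum.cong refl) (auto simp: algebra_simps)
  also have "\<dots> = (c1 + of_nat N * c3 + c5) * (of_bool (x0 = x1) * of_bool (x2 = x3)) +
      (c2 + of_nat N * c4) * (of_bool (x0 = x3) * of_bool (x1 = x2))"
    using assms by (simp only: sum.distrib sum_distrib_left[symmetric] sum_delta2) (simp add: algebra_simps)
  finally show ?thesis by (simp add: algebra_simps)
qed

lemma tl6_cap2:
  assumes "x0 < N" "x1 < N" "x2 < N"
  shows "(\<Sum>p<N. tl6 c1 c2 c3 c4 c5 [x0, x1, p, p, x2, x3]) =
    tl4 (of_nat N * c1 + c2) (of_nat N * c3 + c4 + c5) [x0, x1, x2, x3]"
proof -
  have "(\<Sum>p<N. tl6 c1 c2 c3 c4 c5 [x0, x1, p, p, x2, x3]) =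
    (\<Sum>p<N. c1 * (of_bool (x0 = x3) * of_bool (x1 = x2)) +
      c2 * of_bool (x0 = x3) * (of_bool (x1 = p) * of_bool (p = x2)) +
      c3 * (of_bool (x0 = x1) * of_bool (x2 = x3)) +
      c4 * of_bool (x2 = x3) * (of_bool (x0 = p) * of_bool (x1 = p)) +
      c5 * of_bool (x0 = x1) * (of_bool (p = x2) * of_bool (p = x3)))"
    by (intro sum.cong refl) (auto simp: algebra_simps)
  also have "\<dots> = (of_nat N * c1 + c2) * (of_bool (x0 = x3) * of_bool (x1 = x2)) +
      (of_nat N * c3 + c4 + c5) * (of_bool (x0 = x1) * of_bool (x2 = x3))"
    using assms by (simp only: sum.distrib sum_distrib_left[symmetric] sum_delta2) (simp add: algebra_simps)
  finally show ?thesis by (simp add: algebra_simps)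
qed

lemma tl4_cup2:
  assumes "x0 < N" "x1 < N"
  shows "of_bool (x2 = x3) * (\<Sum>p<N. tl4 c1 c2 [x0, x1, p, p]) =
    tl4 0 (c1 + of_nat N * c2) [x0, x1, x2, x3]"
proof -
  have "(\<Sum>p<N. tl4 c1 c2 [x0, x1, p, p]) =
    (\<Sum>p<N. c1 * (of_bool (x0 = p) * of_bool (x1 = p)) + c2 * of_bool (x0 = x1))"
    by (intro sum.cong refl) (auto simp: algebra_simps)
  also have "\<dots> = (c1 + of_nat N * c2) * of_bool (x0 = x1)"
    using assms by (simp only: sum.distrib sum_distrib_left[symmetric] sum_delta2) (simp add: algebra_simps)
  finally show ?thesis by (simp add: algebra_simps)
qed

lemma act_jones_tl6_3:
  assumes "\<And>y. y \<in> label_lists {..<N} 6 \<Longrightarrow> F y = s * tl6 c1 c2 c3 c4 c5 y" "y \<in> label_lists {..<N} 6"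
    and "u = (if b then inverse a else a)" "v = (if b then a else inverse a)"
    and "g = (if (e0 = e1) \<noteq> b then - inverse (a ^ 3) else - (a ^ 3))"
  shows "act {..<N} (jones_weight a) (3, Cross b) [d0, d1, d2, e0, e1, d3] F y =
    g * s * tl6 (u * c1) (u * c2 + v * (c1 + of_nat N * c2 + c4)) (u * c3) (u * c4)
      (u * c5 + v * (c3 + of_nat N * c5)) y"
  using assms(2)
proof (rule label_lists_6E)
  fix x0 x1 x2 x3 x4 x5
  assume y: "y = [x0, x1, x2, x3, x4, x5]" and
    less: "x0 \<in> {..<N}" "x1 \<in> {..<N}" "x2 \<in> {..<N}" "x3 \<in> {..<N}" "x4 \<in> {..<N}" "x5 \<in> {..<N}"
  have "act {..<N} (jones_weight a) (3, Cross b) [d0, d1, d2, e0, e1, d3] F y =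
    g * (u * F y + v * (of_bool (x3 = x4) * (\<Sum>p<N. F [x0, x1, x2, p, p, x5])))"
    using less assms(3-5) unfolding y by (subst act_Cross_jones) auto
  also have "F y = s * tl6 c1 c2 c3 c4 c5 y"
    by (rule assms(1)[OF assms(2)])
  also have "(\<Sum>p<N. F [x0, x1, x2, p, p, x5]) = s * (\<Sum>p<N. tl6 c1 c2 c3 c4 c5 [x0, x1, x2, p, p, x5])"
    unfolding sum_distrib_left using less
    by (intro sum.cong refl assms(1)) (auto simp: label_lists_def)
  also have "of_bool (x3 = x4) * (s * (\<Sum>p<N. tl6 c1 c2 c3 c4 c5 [x0, x1, x2, p, p, x5])) =
     s * tl6 0 (c1 + of_nat N * c2 + c4) 0 0 (c3 + of_nat N * c5) y"
    unfolding y using tl6_cup3[of x0 N x1 x2 x5 x3 x4] less by (simp add: mult.left_commute)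
  finally show ?thesis
    unfolding y by (simp add: algebra_simps)
qed

lemma act_jones_tl6_4:
  assumes "\<And>y. y \<in> label_lists {..<N} 6 \<Longrightarrow> F y = s * tl6 c1 c2 c3 c4 c5 y" "y \<in> label_lists {..<N} 6"
    and "u = (if b then inverse a else a)" "v = (if b then a else inverse a)"
    and "g = (if (e0 = e1) \<noteq> b then - inverse (a ^ 3) else - (a ^ 3))"
  shows "act {..<N} (jones_weight a) (4, Cross b) [d0, d1, d2, d3, e0, e1] F y =
    g * s * tl6 (u * c1) (u * c2) (u * c3 + v * (c1 + of_nat N * c3 + c5))
      (u * c4 + v * (c2 + of_nat N * c4)) (u * c5) y"
  using assms(2)
proof (rule label_lists_6E)
  fix x0 x1 x2 x3 x4 x5
  assume y: "y = [x0, x1, x2, x3, x4, x5]" and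
    less: "x0 \<in> {..<N}" "x1 \<in> {..<N}" "x2 \<in> {..<N}" "x3 \<in> {..<N}" "x4 \<in> {..<N}" "x5 \<in> {..<N}"
  have "act {..<N} (jones_weight a) (4, Cross b) [d0, d1, d2, d3, e0, e1] F y =
    g * (u * F y + v * (of_bool (x4 = x5) * (\<Sum>p<N. F [x0, x1, x2, x3, p, p])))"
    using less assms(3-5) unfolding y by (subst act_Cross_jones) auto
  also have "F y = s * tl6 c1 c2 c3 c4 c5 y"
    by (rule assms(1)[OF assms(2)])
  also have "(\<Sum>p<N. F [x0, x1, x2, x3, p, p]) = s * (\<Sum>p<N. tl6 c1 c2 c3 c4 c5 [x0, x1, x2, x3, p, p])"
    unfolding sum_distrib_left using less
    by (intro sum.cong refl assms(1)) (auto simp: label_lists_def)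
  also have "of_bool (x4 = x5) * (s * (\<Sum>p<N. tl6 c1 c2 c3 c4 c5 [x0, x1, x2, x3, p, p])) =
     s * tl6 0 0 (c1 + of_nat N * c3 + c5) (c2 + of_nat N * c4) 0 y"
    unfolding y using tl6_cup4[of x0 N x1 x2 x3 x4 x5] less by (simp add: mult.left_commute)
  finally show ?thesis
    unfolding y by (simp add: algebra_simps)
qed

lemma act_jones_tl4:
  assumes "\<And>y. y \<in> label_lists {..<N} 4 \<Longrightarrow> F y = s * tl4 c1 c2 y" "y \<in> label_lists {..<N} 4"
    and "u = (if b then inverse a else a)" "v = (if b then a else inverse a)"
    and "g = (if (e0 = e1) \<noteq> b then - inverse (a ^ 3) else - (a ^ 3))"
  shows "act {..<N} (jones_weight a) (2, Cross b) [d0, d1, e0, e1] F y =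
    g * s * tl4 (u * c1) (u * c2 + v * (c1 + of_nat N * c2)) y"
  using assms(2)
proof (rule label_lists_4E)
  fix x0 x1 x2 x3
  assume y: "y = [x0, x1, x2, x3]" and
    less: "x0 \<in> {..<N}" "x1 \<in> {..<N}" "x2 \<in> {..<N}" "x3 \<in> {..<N}"
  have "act {..<N} (jones_weight a) (2, Cross b) [d0, d1, e0, e1] F y =
    g * (u * F y + v * (of_bool (x2 = x3) * (\<Sum>p<N. F [x0, x1, p, p])))"
    using less assms(3-5) unfolding y by (subst act_Cross_jones) auto
  also have "F y = s * tl4 c1 c2 y"
    by (rule assms(1)[OF assms(2)])
  also have "(\<Sum>p<N. F [x0, x1, p, p]) = s * (\<Sum>p<N. tl4 c1 c2 [x0, x1, p, p])"
    unfolding sum_distrib_left using less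
    by (intro sum.cong refl assms(1)) (auto simp: label_lists_def)
  also have "of_bool (x2 = x3) * (s * (\<Sum>p<N. tl4 c1 c2 [x0, x1, p, p])) =
     s * tl4 0 (c1 + of_nat N * c2) y"
    unfolding y using tl4_cup2[of x0 N x1 x2 x3] less by (simp add: mult.left_commute)
  finally show ?thesis
    unfolding y by (simp add: algebra_simps)
qed

text \<open>The right-hand side is the Chebyshev polynomial U_7(N / 2): with s = -u^2 and N = s +
  1/s it is the sum s^7 + s^5 + ... + s^(-7). As a polynomial in \<open>N\<close> it is symmetric in
  \<open>u\<close> and \<open>v\<close>, which is why the link and its mirror image get the same
  value.\<close>

lemma bracket_identity:
  fixes u v :: complex
  assumes "u * v = 1" and N: "N = - u\<^sup>2 - v\<^sup>2"
  shows "N\<^sup>2 * (v ^ 4 * (- (u ^ 6) - v ^ 6)) +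
      N * (u ^ 12 * (2 - u ^ 4 - v ^ 4) + (- (u ^ 6) - v ^ 6) * (v\<^sup>2 - u\<^sup>2 + u ^ 6 - u ^ 10)) =
    N ^ 7 - 6 * N ^ 5 + 10 * N ^ 3 - 4 * N"
proof -
  have "u \<noteq> 0"
    using assms(1) by auto
  moreover from this have v: "v = 1 / u"
    using assms(1) by (simp add: field_simps)
  ultimately show ?thesis
    unfolding N v by (simp add: field_simps) algebra
qed

text \<open>The vector climbs from the cups at the bottom to the caps at the top and stays in the
  span of the planar matchings, so that only their coefficients have to be tracked.\<close>

lemma val_jones_ringed_twist:
  assumes "a \<noteq> 0" and N: "of_nat N = - (a\<^sup>2) - inverse a ^ 2"
  shows "val {..<N} (jones_weight a) (ringed_twist t) [] (\<lambda>_. 1) [] =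
    of_nat N ^ 7 - 6 * of_nat N ^ 5 + 10 * of_nat N ^ 3 - 4 * of_nat N"
proof -
  define n :: complex where "n = of_nat N"
  \<comment> \<open>The coefficients of the vertical smoothing at the crossings of the ring and of
    the twist, respectively. In these terms the link and its mirror image are computed
    together.\<close>
  define u v where "u = (if t then a else inverse a)" and "v = (if t then inverse a else a)"
  have uv: "u * v = 1"
    using assms(1) by (simp add: u_def v_def)
  have n: "n = - u\<^sup>2 - v\<^sup>2"
    unfolding n_def N by (auto simp: u_def v_def)
  define g where "g = (if t then - inverse (a ^ 3) else - (a ^ 3))"
  define h where "h = (if t then - (a ^ 3) else - inverse (a ^ 3))"
  \<comment> \<open>The normalization factors of the ring and the twist cancel, as the writhe is
    zero.\<close>
  have hg: "h ^ 4 * g ^ 4 = 1"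
    using assms(1) by (simp add: g_def h_def flip: power_mult_distrib)
  let ?V = "\<lambda>D e. val {..<N} (jones_weight a) D e (\<lambda>_. 1)"
  let ?e6 = "[Up, Up, Up, Down, Down, Down]" and ?e4 = "[Up, Up, Down, Down]"
  let ?c3 = "(3, Cross (\<not> t)) :: slice" and ?c4 = "(4, Cross (\<not> t)) :: slice" and ?c2 = "(2, Cross t) :: slice"
  let ?T0 = "[(2, Cup), (1, Cup), (0, Cup)] :: slice list"
  have act3: "\<forall>y\<in>label_lists {..<N} 6. ?V (?c3 # D) ?e6 y = g * s * tl6 (u * k1)
      (u * k2 + v * (k1 + n * k2 + k4)) (u * k3) (u * k4) (u * k5 + v * (k3 + n * k5)) y"
    if "\<forall>y\<in>label_lists {..<N} 6. ?V D ?e6 y = s * tl6 k1 k2 k3 k4 k5 y" for D s k1 k2 k3 k4 k5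
    using act_jones_tl6_3[OF that[rule_format], where u = u and v = v and b = "\<not> t" and a = a and g = g
        and ?e0.0 = Down and ?e1.0 = Down and ?d0.0 = Up and ?d1.0 = Up and ?d2.0 = Up and ?d3.0 = Down]
    by (simp add: u_def v_def g_def n_def)
  have act4: "\<forall>y\<in>label_lists {..<N} 6. ?V (?c4 # D) ?e6 y = g * s * tl6 (u * k1) (u * k2)
      (u * k3 + v * (k1 + n * k3 + k5)) (u * k4 + v * (k2 + n * k4)) (u * k5) y"
    if "\<forall>y\<in>label_lists {..<N} 6. ?V D ?e6 y = s * tl6 k1 k2 k3 k4 k5 y" for D s k1 k2 k3 k4 k5
    using act_jones_tl6_4[OF that[rule_format], where u = u and v = v and b = "\<not> t" and a = a and g = g
        and ?e0.0 = Down and ?e1.0 = Down and ?d0.0 = Up and ?d1.0 = Up and ?d2.0 = Up and ?d3.0 = Down]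
    by (simp add: u_def v_def g_def n_def)
  have act2: "\<forall>y\<in>label_lists {..<N} 4. ?V (?c2 # D) ?e4 y = h * s * tl4 (v * k1) (u * k1 - u ^ 3 * k2) y"
    if "\<forall>y\<in>label_lists {..<N} 4. ?V D ?e4 y = s * tl4 k1 k2 y" for D s k1 k2
  proof -
    \<comment> \<open>A crossing stacked on a hook is a kink, worth \<open>- (u ^ 3)\<close>; hence
      the hook coefficient is multiplied by it at each crossing of the twist.\<close>
    have "v * k2 + u * (k1 + n * k2) = u * k1 - u ^ 3 * k2"
      using uv unfolding n by algebra
    then show ?thesis
      using act_jones_tl4[OF that[rule_format], where u = v and v = u and b = t and a = a and g = h
        and ?e0.0 = Down and ?e1.0 = Down and ?d0.0 = Up and ?d1.0 = Up]
      by (simp add: u_def v_def h_def n_def)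
  qed
  have t0: "\<forall>y\<in>label_lists {..<N} 6. ?V ?T0 ?e6 y = 1 * tl6 1 0 0 0 0 y"
    by (auto elim!: label_lists_6E simp: state_model.act_Cup[OF state_model_jones[OF assms]])
  define k3 where "k3 = u * (u * v) + v * (u\<^sup>2 + n * (u * v))"
  define k4 where "k4 = u * v\<^sup>2 + v * (u * v + n * v\<^sup>2)"
  note t1 = act3[OF t0]
  note t2 = act4[OF t1]
  note t3 = act4[OF t2]
  note t4 = act3[OF t3]
  \<comment> \<open>Up to \<open>g ^ 4\<close>, a ring around two parallel strands is
    \<open>- (u ^ 6) - v ^ 6\<close> times the identity plus a multiple of the hook. Around a hook
    the ring slips off and becomes a free circle, so the multiple \<open>m\<close> is forced by -
    u^6 - v^6 + N m = N.\<close>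
  have t5: "\<forall>y\<in>label_lists {..<N} 4. ?V ((2, Cap Up) # ?c3 # ?c4 # ?c4 # ?c3 # ?T0) ?e4 y =
      g ^ 4 * tl4 (- (u ^ 6) - v ^ 6) (2 - u ^ 4 - v ^ 4) y"
  proof
    fix y assume "y \<in> label_lists {..<N} 4"
    then show "?V ((2, Cap Up) # ?c3 # ?c4 # ?c4 # ?c3 # ?T0) ?e4 y =
      g ^ 4 * tl4 (- (u ^ 6) - v ^ 6) (2 - u ^ 4 - v ^ 4) y"
  proof (rule label_lists_4E)
    fix x0 x1 x2 x3
    assume y: "y = [x0, x1, x2, x3]" and
      less: "x0 \<in> {..<N}" "x1 \<in> {..<N}" "x2 \<in> {..<N}" "x3 \<in> {..<N}"
    define c1 where "c1 = u ^ 4"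
    define c2 where "c2 = u * (u\<^sup>2 * v) + v * (u ^ 3 + n * (u\<^sup>2 * v) + k4)"
    have t4': "?V (?c3 # ?c4 # ?c4 # ?c3 # ?T0) ?e6 z = g ^ 4 * tl6 c1 c2 (u * k3) (u * k4) (v * k3) z"
      if "z \<in> label_lists {..<N} 6" for z
      using t4[rule_format, OF that] by (simp add: c1_def c2_def k3_def k4_def eval_nat_numeral mult_ac)
    have "?V ((2, Cap Up) # ?c3 # ?c4 # ?c4 # ?c3 # ?T0) ?e4 y =
       (\<Sum>p<N. ?V (?c3 # ?c4 # ?c4 # ?c3 # ?T0) ?e6 [x0, x1, p, p, x2, x3])"
      unfolding y val.simps(2)[of _ _ "(2, Cap Up)"] state_model.act_Cap[OF state_model_jones[OF assms]]
      by simp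
    also have "\<dots> = (\<Sum>p<N. g ^ 4 * tl6 c1 c2 (u * k3) (u * k4) (v * k3) [x0, x1, p, p, x2, x3])"
      using less by (intro sum.cong refl t4') (auto simp: label_lists_def)
    also have "\<dots> = g ^ 4 * tl4 (n * c1 + c2) (n * (u * k3) + u * k4 + v * k3) y"
      using less tl6_cap2[of x0 N x1 x2] by (simp only: sum_distrib_left[symmetric] n_def y lessThan_iff)
    also have "n * c1 + c2 = - (u ^ 6) - v ^ 6"
      using uv unfolding c1_def c2_def k4_def n by algebra
    also have "n * (u * k3) + u * k4 + v * k3 = 2 - u ^ 4 - v ^ 4"
      using uv unfolding k3_def k4_def n by algebra
    finally show ?thesis .
  qed
  qed
  note t9 = act2[OF act2[OF act2[OF act2[OF t5]]]]
  define D where "D = ?c2 # ?c2 # ?c2 # ?c2 # (2, Cap Up) # ?c3 # ?c4 # ?c4 # ?c3 # ?T0"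
  have t9': "?V D ?e4 y = tl4 (v ^ 4 * (- (u ^ 6) - v ^ 6))
      (u ^ 12 * (2 - u ^ 4 - v ^ 4) + (- (u ^ 6) - v ^ 6) * (v\<^sup>2 - u\<^sup>2 + u ^ 6 - u ^ 10)) y"
    if "y \<in> label_lists {..<N} 4" for y
  proof -
    define al be where "al = - (u ^ 6) - v ^ 6" and "be = 2 - u ^ 4 - v ^ 4"
    have "?V D ?e4 y = (h ^ 4 * g ^ 4) * tl4 (v * (v * (v * (v * al))))
       (u * (v * (v * (v * al))) - u ^ 3 * (u * (v * (v * al)) - u ^ 3 * (u * (v * al) - u ^ 3 * (u * al - u ^ 3 * be)))) y"
      using t9[rule_format, OF that] unfolding D_def al_def be_def by (simp add: eval_nat_numeral mult_ac)
    also have "v * (v * (v * (v * al))) = v ^ 4 * al"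
      by (simp add: eval_nat_numeral)
    also have "u * (v * (v * (v * al))) - u ^ 3 * (u * (v * (v * al)) - u ^ 3 * (u * (v * al) - u ^ 3 * (u * al - u ^ 3 * be))) =
       u ^ 12 * be + al * (v\<^sup>2 - u\<^sup>2 + u ^ 6 - u ^ 10)"
      using uv by algebra
    finally show ?thesis
      by (simp add: hg al_def be_def)
  qed
  have "?V (ringed_twist t) [] [] = (\<Sum>x<N. \<Sum>y<N. ?V D ?e4 [x, y, y, x])"
  proof -
    have "ringed_twist t = (0, Cap Up) # (1, Cap Up) # D"
      by (simp add: ringed_twist_def D_def)
    then show ?thesis
      by (simp add: state_model.act_Cap[OF state_model_jones[OF assms]])
  qed
  also have "\<dots> = (\<Sum>x<N. \<Sum>y<N. tl4 (v ^ 4 * (- (u ^ 6) - v ^ 6))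
      (u ^ 12 * (2 - u ^ 4 - v ^ 4) + (- (u ^ 6) - v ^ 6) * (v\<^sup>2 - u\<^sup>2 + u ^ 6 - u ^ 10)) [x, y, y, x])"
    by (intro sum.cong refl t9') (auto simp: label_lists_def)
  also have "\<dots> = n\<^sup>2 * (v ^ 4 * (- (u ^ 6) - v ^ 6)) +
      n * (u ^ 12 * (2 - u ^ 4 - v ^ 4) + (- (u ^ 6) - v ^ 6) * (v\<^sup>2 - u\<^sup>2 + u ^ 6 - u ^ 10))"
  proof -
    have "(\<Sum>x<N. \<Sum>y<N. tl4 c1 c2 [x, y, y, x]) = n\<^sup>2 * c1 + n * c2" for c1 c2
    proof -
      have "(\<Sum>x<N. \<Sum>y<N. tl4 c1 c2 [x, y, y, x]) = (\<Sum>x<N. \<Sum>y<N. c1 + c2 * (of_bool (x = y) * of_bool (y = x)))"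
        by simp
      also have "\<dots> = (\<Sum>x<N. n * c1 + c2)"
        by (intro sum.cong refl)
          (simp only: sum.distrib sum_distrib_left[symmetric] sum_delta2 lessThan_iff, simp add: n_def)
      also have "\<dots> = n\<^sup>2 * c1 + n * c2"
        by (simp add: n_def power2_eq_square distrib_left mult.assoc)
      finally show ?thesis .
    qed
    then show ?thesis .
  qed
  also have "\<dots> = n ^ 7 - 6 * n ^ 5 + 10 * n ^ 3 - 4 * n"
    by (rule bracket_identity[OF uv n])
  finally show ?thesis
    unfolding n_def .
qed

section \<open>Labelings of the points of a diagram\<close>

text \<open>The full matrix entry between two rows, whereas \<open>act\<close> sums over the outputs
  of the piece only. In this form a product of transfer matrices can be read as a sum over labelings
  of all points.\<close>

definition slice_weight ::
  "'l cross_weight \<Rightarrow> slice \<Rightarrow> direction list \<Rightarrow> 'l list \<Rightarrow> 'l list \<Rightarrow> complex"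
where
  "slice_weight W a e x y = (case a of (i, p) \<Rightarrow>
     of_bool (take i x = take i y \<and> drop (i + ins p) x = drop (i + outs p) y) *
     piece_weight W p (drop i e) (drop i x) (drop i y))"

lemma piece_weight_append [simp]:
  "length m = outs p \<Longrightarrow> piece_weight W p e x (m @ r) = piece_weight W p e x m"
  by (cases p) (auto simp: nth_append)

lemma act_eq_sum:
  assumes "finite X" "step (i, p) e = Some e'" "x \<in> label_lists X (length e)"
  shows "act X W (i, p) e F x = (\<Sum>y\<in>label_lists X (length e'). slice_weight W (i, p) e x y * F y)"
proof -
  note len = step_length[OF assms(2)]
  have lx: "length x = length e"
    using assms(3) by (simp add: label_lists_def)
  let ?ins = "\<lambda>m. take i x @ m @ drop (i + ins p) x"
  let ?S = "?ins ` label_lists X (outs p)"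
  have sub: "?S \<subseteq> label_lists X (length e')"
    using assms(3) len
    by (intro image_subsetI) (auto simp: label_lists_def dest: in_set_takeD in_set_dropD)
  \<comment> \<open>A row that alters a strand beside the piece has weight zero; the others are
    parametrized by the outputs of the piece.\<close>
  have "slice_weight W (i, p) e x y = 0" if "y \<in> label_lists X (length e') - ?S" for y
  proof (rule ccontr)
    assume "slice_weight W (i, p) e x y \<noteq> 0"
    then have *: "take i x = take i y" "drop (i + ins p) x = drop (i + outs p) y"
      by (auto simp: slice_weight_def)
    have "y = take i y @ take (outs p) (drop i y) @ drop (i + outs p) y"
      by (metis append_take_drop_id drop_drop add.commute)
    moreover have "take (outs p) (drop i y) \<in> label_lists X (outs p)"
      using that len by (auto simp: label_lists_def subset_iff dest: in_set_takeD in_set_dropD)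
    ultimately show False
      using that * by auto
  qed
  then have "(\<Sum>y\<in>label_lists X (length e'). slice_weight W (i, p) e x y * F y) =
      (\<Sum>y\<in>?S. slice_weight W (i, p) e x y * F y)"
    using sub by (intro sum.mono_neutral_right finite_label_lists assms(1)) auto
  also have "\<dots> = (\<Sum>m\<in>label_lists X (outs p). slice_weight W (i, p) e x (?ins m) * F (?ins m))"
    by (subst sum.reindex) (auto simp: inj_on_def)
  also have "\<dots> = act X W (i, p) e F x"
    unfolding act.simps using len lx
    by (intro sum.cong refl) (simp add: slice_weight_def label_lists_def)
  finally show ?thesis by simp
qed

definition level_from :: "direction list \<Rightarrow> slice list \<Rightarrow> nat \<Rightarrow> direction list" where
  "level_from e D k = the (run (take k D) e)"

definition row_lists :: "'l set \<Rightarrow> direction list \<Rightarrow> slice list \<Rightarrow> 'l list list set" where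
  "row_lists X e D = {rs. length rs = Suc (length D) \<and>
     (\<forall>k\<le>length D. rs ! k \<in> label_lists X (length (level_from e D k)))}"

lemma level_from_0 [simp]: "level_from e D 0 = e"
  by (simp add: level_from_def)

lemma level_from_Suc: "step a e = Some e' \<Longrightarrow> level_from e (a # D) (Suc k) = level_from e' D k"
  by (simp add: level_from_def)

lemma row_lists_Cons:
  assumes "step a e = Some e'"
  shows "row_lists X e (a # D) = {x # rs | x rs. x \<in> label_lists X (length e) \<and> rs \<in> row_lists X e' D}"
    (is "_ = ?R")
proof (intro equalityI subsetI)
  fix ls assume ls: "ls \<in> row_lists X e (a # D)"
  then obtain x rs where eq: "ls = x # rs"
    by (auto simp: row_lists_def length_Suc_conv)
  have "x \<in> label_lists X (length e)"
    using ls eq by (auto simp: row_lists_def dest: spec[of _ 0])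
  moreover have "rs ! k \<in> label_lists X (length (level_from e' D k))" if "k \<le> length D" for k
    using ls eq that by (auto simp: row_lists_def level_from_Suc[OF assms] dest: spec[of _ "Suc k"])
  ultimately show "ls \<in> ?R"
    using ls eq by (auto simp: row_lists_def)
next
  fix ls assume "ls \<in> ?R"
  then obtain x rs where *: "ls = x # rs" "x \<in> label_lists X (length e)" "rs \<in> row_lists X e' D"
    by blast
  have "ls ! k \<in> label_lists X (length (level_from e (a # D) k))" if "k \<le> Suc (length D)" for k
    using * that by (cases k) (auto simp: row_lists_def level_from_Suc[OF assms])
  then show "ls \<in> row_lists X e (a # D)"
    using * by (auto simp: row_lists_def)
qed

lemma finite_row_lists:
  assumes "finite X"
  shows "run D e = Some e'' \<Longrightarrow> finite (row_lists X e D)"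
proof (induction D arbitrary: e)
  case Nil
  have "row_lists X e [] \<subseteq> (\<lambda>x. [x]) ` label_lists X (length e)"
    by (auto simp: row_lists_def length_Suc_conv)
  then show ?case
    using finite_label_lists[OF assms] finite_surj by blast
next
  case (Cons a D)
  then obtain e' where e': "step a e = Some e'" "run D e' = Some e''"
    unfolding run_Cons_Some by blast
  have "row_lists X e (a # D) = (\<lambda>(x, rs). x # rs) ` (label_lists X (length e) \<times> row_lists X e' D)"
    unfolding row_lists_Cons[OF e'(1)] by auto
  then show ?case
    using finite_label_lists[OF assms] Cons.IH[OF e'(2)] by simp
qed

text \<open>The expansion of a matrix product into a sum over paths, here lists of rows. The
  starting row stays fixed so that the induction can peel off the top slice.\<close>

lemma val_eq_sum_row_lists:
  assumes "finite X"
  shows "run D e = Some e'' \<Longrightarrow> x \<in> label_lists X (length e) \<Longrightarrow>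
    val X W D e (\<lambda>_. 1) x = (\<Sum>rs | rs \<in> row_lists X e D \<and> rs ! 0 = x.
      \<Prod>k<length D. slice_weight W (D ! k) (level_from e D k) (rs ! k) (rs ! Suc k))"
proof (induction D arbitrary: e x)
  case Nil
  have "{rs \<in> row_lists X e []. rs ! 0 = x} = {[x]}"
    using Nil.prems(2) by (auto simp: row_lists_def length_Suc_conv)
  then show ?case by simp
next
  case (Cons a D)
  obtain i p where a: "a = (i, p)"
    by fastforce
  obtain e' where e': "step a e = Some e'" "run D e' = Some e''"
    using Cons.prems(1) unfolding run_Cons_Some by blast
  let ?P = "\<lambda>rs. \<Prod>k<length D. slice_weight W (D ! k) (level_from e' D k) (rs ! k) (rs ! Suc k)"
  have "val X W (a # D) e (\<lambda>_. 1) x =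
    (\<Sum>y\<in>label_lists X (length e'). slice_weight W a e x y *
       (\<Sum>rs | rs \<in> row_lists X e' D \<and> rs ! 0 = y. ?P rs))"
    unfolding val.simps a e'(1)[unfolded a] option.sel
    by (subst act_eq_sum[OF assms e'(1)[unfolded a] Cons.prems(2)])
      (intro sum.cong refl arg_cong2[where f = "(*)"] Cons.IH[OF e'(2)])
  also have "\<dots> = (\<Sum>y\<in>label_lists X (length e').
       (\<Sum>rs | rs \<in> row_lists X e' D \<and> rs ! 0 = y. slice_weight W a e x (rs ! 0) * ?P rs))"
    unfolding sum_distrib_left by (intro sum.cong refl) auto
  also have "\<dots> = (\<Sum>rs\<in>row_lists X e' D. slice_weight W a e x (rs ! 0) * ?P rs)"
    by (intro sum.group finite_row_lists[OF assms e'(2)] finite_label_lists assms)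
      (auto simp: row_lists_def dest: spec[of _ 0])
  also have "\<dots> = (\<Sum>rs | rs \<in> row_lists X e (a # D) \<and> rs ! 0 = x.
      \<Prod>k<length (a # D). slice_weight W ((a # D) ! k) (level_from e (a # D) k) (rs ! k) (rs ! Suc k))"
    by (rule sum.reindex_bij_witness[where i = tl and j = "\<lambda>rs. x # rs"])
      (use Cons.prems(2) in \<open>auto simp: row_lists_Cons[OF e'(1)] prod.lessThan_Suc_shift level_from_Suc[OF e'(1)]
        simp del: prod.lessThan_Suc\<close>)
  finally show ?case .
qed

definition row :: "slice list \<Rightarrow> (nat \<times> nat \<Rightarrow> 'l) \<Rightarrow> nat \<Rightarrow> 'l list" where
  "row D f k = map (\<lambda>j. f (k, j)) [0..<length (level D k)]"

lemma length_row [simp]: "length (row D f k) = length (level D k)"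
  by (simp add: row_def)

lemma nth_row [simp]: "j < length (level D k) \<Longrightarrow> row D f k ! j = f (k, j)"
  by (simp add: row_def)

lemma val_eq_state_sum:
  assumes "finite X" "diagram D"
  shows "val X W D [] (\<lambda>_. 1) [] = (\<Sum>f\<in>points D \<rightarrow>\<^sub>E X.
    \<Prod>k<length D. slice_weight W (D ! k) (level D k) (row D f k) (row D f (Suc k)))"
proof -
  have lev: "level_from [] D = level D"
    by (rule ext) (simp add: level_from_def level_def)
  have D: "run D [] = Some []"
    using assms(2) by (simp add: diagram_def)
  have "val X W D [] (\<lambda>_. 1) [] = (\<Sum>rs | rs \<in> row_lists X [] D \<and> rs ! 0 = [].
      \<Prod>k<length D. slice_weight W (D ! k) (level D k) (rs ! k) (rs ! Suc k))"
    unfolding lev[symmetric] by (rule val_eq_sum_row_lists[OF assms(1) D]) simp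
  also have "{rs. rs \<in> row_lists X [] D \<and> rs ! 0 = []} = row_lists X [] D"
    by (auto simp: row_lists_def dest: spec[of _ 0])
  also have "(\<Sum>rs\<in>row_lists X [] D. \<Prod>k<length D. slice_weight W (D ! k) (level D k) (rs ! k) (rs ! Suc k)) =
    (\<Sum>f\<in>points D \<rightarrow>\<^sub>E X. \<Prod>k<length D. slice_weight W (D ! k) (level D k) (row D f k) (row D f (Suc k)))"
  proof (rule sum.reindex_bij_witness[where
        j = "\<lambda>rs. restrict (\<lambda>(k, j). rs ! k ! j) (points D)" and
        i = "\<lambda>f. map (row D f) [0..<Suc (length D)]"])
    fix rs assume rs: "rs \<in> row_lists X [] D"
    have len: "length (rs ! k) = length (level D k)" if "k \<le> length D" for k
      using rs that by (simp add: row_lists_def lev label_lists_def)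
    have row: "row D (restrict (\<lambda>(k, j). rs ! k ! j) (points D)) k = rs ! k" if "k \<le> length D" for k
      using that len[OF that] by (intro nth_equalityI) (auto simp: points_def)
    show "map (row D (restrict (\<lambda>(k, j). rs ! k ! j) (points D))) [0..<Suc (length D)] = rs"
      using rs by (intro nth_equalityI) (auto simp: row row_lists_def simp del: upt_Suc)
    show "restrict (\<lambda>(k, j). rs ! k ! j) (points D) \<in> points D \<rightarrow>\<^sub>E X"
      using rs len by (auto simp: points_def row_lists_def lev label_lists_def subset_eq)
    show "(\<Prod>k<length D. slice_weight W (D ! k) (level D k) (row D (restrict (\<lambda>(k, j). rs ! k ! j) (points D)) k)
         (row D (restrict (\<lambda>(k, j). rs ! k ! j) (points D)) (Suc k))) =
      (\<Prod>k<length D. slice_weight W (D ! k) (level D k) (rs ! k) (rs ! Suc k))"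
      by (intro prod.cong refl) (auto simp: row)
  next
    fix f assume f: "f \<in> points D \<rightarrow>\<^sub>E X"
    show "restrict (\<lambda>(k, j). map (row D f) [0..<Suc (length D)] ! k ! j) (points D) = f"
    proof
      fix z show "restrict (\<lambda>(k, j). map (row D f) [0..<Suc (length D)] ! k ! j) (points D) z = f z"
        using PiE_arb[OF f, of z] by (cases z) (auto simp: points_def restrict_def simp del: upt_Suc)
    qed
    show "map (row D f) [0..<Suc (length D)] \<in> row_lists X [] D"
      using f by (auto simp: row_lists_def lev label_lists_def row_def points_def PiE_iff simp del: upt_Suc)
  qed
  finally show ?thesis .
qed

lemma diagram_level:
  assumes "diagram D" "k < length D"
  shows "step (D ! k) (level D k) = Some (level D (Suc k))"
proof -
  have "run (take k D @ D ! k # drop (Suc k) D) [] = Some []"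
    using assms by (simp add: diagram_def id_take_nth_drop[symmetric])
  then obtain e e' where "run (take k D) [] = Some e" "step (D ! k) e = Some e'"
    by (auto simp: run_append bind_eq_Some_conv)
  then show ?thesis
    using assms(2) by (simp add: level_def take_Suc_conv_app_nth run_append)
qed

lemma level_0 [simp]: "level D 0 = []"
  by (simp add: level_def)

lemma agree_iff:
  assumes "i + n \<le> length x" "length y + n = length x + n'"
  shows "take i x = take i y \<and> drop (i + n) x = drop (i + n') y \<longleftrightarrow>
    (\<forall>j<i. x ! j = y ! j) \<and> (\<forall>j\<ge>i. j + n < length x \<longrightarrow> x ! (j + n) = y ! (j + n'))"
proof -
  have "take i x = take i y \<longleftrightarrow> (\<forall>j<i. x ! j = y ! j)"
    using assms by (auto simp: list_eq_iff_nth_eq)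
  moreover have "drop (i + n) x = drop (i + n') y \<longleftrightarrow>
      (\<forall>j\<ge>i. j + n < length x \<longrightarrow> x ! (j + n) = y ! (j + n'))"
  proof -
    have "drop (i + n) x = drop (i + n') y \<longleftrightarrow>
      (\<forall>j. j < length x - (i + n) \<longrightarrow> x ! (i + n + j) = y ! (i + n' + j))"
      using assms by (auto simp: list_eq_iff_nth_eq)
    also have "\<dots> \<longleftrightarrow> (\<forall>j\<ge>i. j + n < length x \<longrightarrow> x ! (j + n) = y ! (j + n'))"
    proof (intro iffI allI impI)
      fix j assume *: "\<forall>j. j < length x - (i + n) \<longrightarrow> x ! (i + n + j) = y ! (i + n' + j)" "i \<le> j" "j + n < length x"
      then show "x ! (j + n) = y ! (j + n')"
        using *(1)[rule_format, of "j - i"] by (simp add: add_ac)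
    next
      fix j assume *: "\<forall>j\<ge>i. j + n < length x \<longrightarrow> x ! (j + n) = y ! (j + n')" "j < length x - (i + n)"
      then show "x ! (i + n + j) = y ! (i + n' + j)"
        using *(1)[rule_format, of "i + j"] by (simp add: add_ac)
    qed
    finally show ?thesis .
  qed
  ultimately show ?thesis by simp
qed

text \<open>The gluing relation of \<open>circles\<close>, split by slices, so that constancy along
  circles becomes a conjunction of conditions on single slices and its indicator a product.\<close>

definition slice_rel :: "nat \<Rightarrow> bool \<Rightarrow> slice \<Rightarrow> ((nat \<times> nat) \<times> (nat \<times> nat)) set" where
  "slice_rel k vert a = {((k, j), (k + 1, j')) | j j'. (j, j') \<in> through vert a} \<union>
     {((k, j), (k, j')) | j j'. (j, j') \<in> arc_above vert a} \<union>
     {((k + 1, j), (k + 1, j')) | j j'. (j, j') \<in> arc_below vert a}"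

definition constant_along :: "'a set \<Rightarrow> ('a \<times> 'a) set \<Rightarrow> ('a \<Rightarrow> 'b) \<Rightarrow> bool" where
  "constant_along X r f \<longleftrightarrow> (\<forall>(x, y)\<in>r. x \<in> X \<longrightarrow> y \<in> X \<longrightarrow> f x = f y)"

lemma circles_eq: "circles D V = classes (points D) (\<Union>k<length D. slice_rel k (k \<in> V) (D ! k))"
  unfolding circles_def by (rule arg_cong[where f = "classes (points D)"]) (fastforce simp: slice_rel_def)

text \<open>The right-hand side is the support of the weights: the first conjunct is the delta
  function of the strands beside the piece, the second that of the piece itself, with
  \<open>vert\<close> selecting the smoothing.\<close>

lemma constant_along_slice_rel:
  fixes f :: "nat \<times> nat \<Rightarrow> 'l"
  assumes "diagram D" "k < length D" and a: "D ! k = (i, p)"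
  defines "x \<equiv> row D f k" and "y \<equiv> row D f (Suc k)"
  shows "constant_along (points D) (slice_rel k vert (i, p)) f \<longleftrightarrow>
    (take i x = take i y \<and> drop (i + ins p) x = drop (i + outs p) y) \<and>
    (case p of Cap d \<Rightarrow> y ! i = y ! Suc i | Cup \<Rightarrow> x ! i = x ! Suc i
      | Cross b \<Rightarrow> if vert then x ! i = y ! i \<and> x ! Suc i = y ! Suc i else x ! i = x ! Suc i \<and> y ! i = y ! Suc i)"
proof -
  have step: "step (i, p) (level D k) = Some (level D (Suc k))"
    using diagram_level[OF assms(1,2)] a by simp
  note len = step_length[OF step]
  have agree: "take i x = take i y \<and> drop (i + ins p) x = drop (i + outs p) y \<longleftrightarrow>
      (\<forall>j<i. x ! j = y ! j) \<and> (\<forall>j\<ge>i. j + ins p < length x \<longrightarrow> x ! (j + ins p) = y ! (j + outs p))"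
    using len by (intro agree_iff) (auto simp: x_def y_def)
  have x: "x ! j = f (k, j)" if "j < length (level D k)" for j
    using that by (simp add: x_def)
  have y: "y ! j = f (Suc k, j)" if "j < length (level D (Suc k))" for j
    using that by (simp add: y_def)
  have pts: "(k, j) \<in> points D \<longleftrightarrow> j < length (level D k)"
    "(Suc k, j) \<in> points D \<longleftrightarrow> j < length (level D (Suc k))" for j
    using assms(2) by (auto simp: points_def)
  have lx: "length x = length (level D k)"
    by (simp add: x_def)
  show ?thesis
  proof (cases p)
    case (Cap d)
    show ?thesis
      using len unfolding agree unfolding Cap constant_along_def slice_rel_def
      by (auto simp: pts x y lx)
  next
    case Cup
    show ?thesis
      using len unfolding agree unfolding Cup constant_along_def slice_rel_def
      by (auto simp: pts x y lx)
  next
    case (Cross b)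
    let ?L = "length (level D k)"
    have L: "length (level D (Suc k)) = ?L" "Suc i < ?L"
      using len Cross by auto
    have split: "(\<forall>j<?L. Q j) \<longleftrightarrow> (\<forall>j<i. Q j) \<and> (\<forall>j\<ge>i. j + 2 < ?L \<longrightarrow> Q (j + 2)) \<and> Q i \<and> Q (Suc i)" for Q
    proof (intro iffI allI impI)
      fix j assume *: "(\<forall>j<i. Q j) \<and> (\<forall>j\<ge>i. j + 2 < ?L \<longrightarrow> Q (j + 2)) \<and> Q i \<and> Q (Suc i)" "j < ?L"
      consider "j < i" | "j = i" | "j = Suc i" | "i + 2 \<le> j"
        by linarith
      then show "Q j"
      proof cases
        case 4
        then obtain l where "j = l + 2" "i \<le> l"
          by (metis add.commute add_le_cancel_left le_Suc_ex le_trans le_add2)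
        then show ?thesis
          using * by blast
      qed (use * in auto)
    qed (use L in auto)
    have "constant_along (points D) (slice_rel k vert (i, p)) f \<longleftrightarrow>
      (\<forall>j<?L. vert \<or> j \<noteq> i \<and> j \<noteq> Suc i \<longrightarrow> x ! j = y ! j) \<and> (\<not> vert \<longrightarrow> x ! i = x ! Suc i \<and> y ! i = y ! Suc i)"
      using L unfolding Cross constant_along_def slice_rel_def
      by (cases vert) (auto simp: pts x y)
    also have "\<dots> \<longleftrightarrow> (\<forall>j<i. x ! j = y ! j) \<and> (\<forall>j\<ge>i. j + 2 < ?L \<longrightarrow> x ! (j + 2) = y ! (j + 2)) \<and>
        (if vert then x ! i = y ! i \<and> x ! Suc i = y ! Suc i else x ! i = x ! Suc i \<and> y ! i = y ! Suc i)"
      unfolding split by auto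
    finally show ?thesis
      unfolding agree unfolding Cross lx by simp
  qed
qed

section \<open>State sums of links\<close>

lemma finite_crossings [simp]: "finite (crossings D)"
  by (rule finite_subset[of _ "{..<length D}"]) (auto simp: crossings_def)

lemma finite_points [simp]: "finite (points D)"
  by (rule finite_subset[of _ "Sigma {..length D} (\<lambda>k. {..<length (level D k)})"])
    (auto simp: points_def)

lemma finite_gaps [simp]: "finite (gaps D)"
  by (rule finite_subset[of _ "Sigma {..length D} (\<lambda>k. {..length (level D k)})"])
    (auto simp: gaps_def)

lemma respecting_eq: "respecting X r Y = {f \<in> X \<rightarrow>\<^sub>E Y. constant_along X r f}"
  by (simp add: respecting_def constant_along_def)

lemma constant_along_UN:
  "constant_along X (\<Union>k\<in>K. r k) f \<longleftrightarrow> (\<forall>k\<in>K. constant_along X (r k) f)"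
  by (auto simp: constant_along_def)

lemma crossingE:
  assumes "diagram D" "k \<in> crossings D"
  obtains i b where "k < length D" "D ! k = (i, Cross b)" "pos D k = i" "over D k \<longleftrightarrow> b"
    "Suc i < length (level D k)" "length (level D (Suc k)) = length (level D k)"
    "dir_tl D k = level D k ! i" "dir_tr D k = level D k ! Suc i"
proof -
  obtain i b where *: "k < length D" "D ! k = (i, Cross b)"
    using assms(2) by (auto simp: crossings_def)
  then have "step (i, Cross b) (level D k) = Some (level D (Suc k))"
    using diagram_level[OF assms(1), of k] by simp
  from step_length[OF this] * show ?thesis
    by (intro that) (auto simp: pos_def over_def dir_tl_def dir_tr_def)
qed

text \<open>The state sum with an arbitrary unit in place of A. Ring homomorphisms then only change
  \<open>a\<close>, which relates both Laurent rings and the complex numbers.\<close>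

definition jones_at :: "'a::comm_ring_1 \<Rightarrow> slice list \<Rightarrow> 'a" where
  "jones_at a D = (- (a ^ 3)) ^^^ (- (int (num_pos D) - int (num_neg D))) *
     (\<Sum>S\<in>Pow (crossings D). a ^^^ (int (card S) - int (card (crossings D - S))) *
        (- (a ^^^ 2) - a ^^^ (-2)) ^ card (circles D {k \<in> crossings D. k \<in> S \<longleftrightarrow> \<not> over D k}))"

lemma jones_diagram_eq: "jones_diagram D = jones_at kauffman_var D"
  by (simp add: jones_diagram_def jones_at_def kauffman_bracket_def)

lemma sign_cases: "sign D k = 1 \<or> sign D k = -1"
  by (simp add: sign_def)

lemma sum_sign: "(\<Sum>k\<in>crossings D. sign D k) = int (num_pos D) - int (num_neg D)"
proof -
  have "(\<Sum>k\<in>crossings D. sign D k) = (\<Sum>k\<in>crossings D. (if sign D k = 1 then 1 else 0) - (if sign D k = -1 then 1 else 0))"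
    by (intro sum.cong refl) (simp add: sign_def)
  also have "\<dots> = int (num_pos D) - int (num_neg D)"
    by (simp add: sum_subtractf num_pos_def num_neg_def sum.If_cases Int_def)
  finally show ?thesis .
qed

lemma slice_weight_jones:
  assumes "diagram D" "k \<in> crossings D" "a \<noteq> 0"
  shows "slice_weight (jones_weight a) (D ! k) (level D k) (row D f k) (row D f (Suc k)) =
    (- (a ^ 3)) powi (- sign D k) *
    (a * of_bool (constant_along (points D) (slice_rel k (\<not> over D k) (D ! k)) f) +
     inverse a * of_bool (constant_along (points D) (slice_rel k (over D k) (D ! k)) f))"
proof -
  obtain i b where k: "k < length D" "D ! k = (i, Cross b)" "pos D k = i" "over D k \<longleftrightarrow> b"
    "Suc i < length (level D k)" "length (level D (Suc k)) = length (level D k)"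
    "dir_tl D k = level D k ! i" "dir_tr D k = level D k ! Suc i"
    using assms(1,2) by (rule crossingE)
  have *: "(- (a ^ 3)) powi (- sign D k) =
      (if (level D k ! i = level D k ! Suc i) \<noteq> b then - inverse (a ^ 3) else - (a ^ 3))"
    using k assms(3) by (simp add: sign_def power_int_minus)
  show ?thesis
    unfolding k(2) constant_along_slice_rel[OF assms(1) k(1,2)] * slice_weight_def jones_weight_def k(4)
    using k(5,6) by (cases b) (auto simp: jones_weight_def)
qed

text \<open>An extremum looks the same in every smoothing, so the product over crossings can be
  completed to all slices with either value of \<open>vert\<close>.\<close>

lemma slice_weight_not_crossing:
  assumes "diagram D" "k < length D" "k \<notin> crossings D"
  shows "slice_weight W (D ! k) (level D k) (row D f k) (row D f (Suc k)) =
    of_bool (constant_along (points D) (slice_rel k vert (D ! k)) f)"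
proof -
  obtain i p where ip: "D ! k = (i, p)"
    by fastforce
  have len: "i + ins p \<le> length (level D k)" "length (level D (Suc k)) = length (level D k) - ins p + outs p"
    using step_length[of i p "level D k" "level D (Suc k)"] diagram_level[OF assms(1,2)] ip by auto
  have "\<nexists>b. p = Cross b"
    using assms(2,3) ip by (auto simp: crossings_def)
  then show ?thesis
    unfolding ip constant_along_slice_rel[OF assms(1,2) ip] slice_weight_def
    using len by (cases p) (auto simp: nth_append)
qed

text \<open>A double sum over labelings and Kauffman states: summing over the states first gives the
  product of the crossing weights, summing over the labelings first gives a power of
  \<open>N\<close> for each state.\<close>

theorem jones_at_eq_val:
  fixes a :: complex
  assumes "diagram D" "a \<noteq> 0" and N: "of_nat N = - (a\<^sup>2) - inverse a ^ 2"
  shows "jones_at a D = val {..<N} (jones_weight a) D [] (\<lambda>_. 1) []"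
proof -
  let ?cr = "crossings D" and ?P = "points D \<rightarrow>\<^sub>E {..<N}"
  let ?V = "\<lambda>S. {k \<in> ?cr. k \<in> S \<longleftrightarrow> \<not> over D k}"
  define w where "w = (\<lambda>f k. slice_weight (jones_weight a) (D ! k) (level D k) (row D f k) (row D f (Suc k)))"
  define ag :: "(nat \<times> nat \<Rightarrow> nat) \<Rightarrow> nat \<Rightarrow> bool \<Rightarrow> complex" where
    "ag = (\<lambda>f k vert. of_bool (constant_along (points D) (slice_rel k vert (D ! k)) f))"
  define c where "c = (- (a ^ 3)) powi (- (int (num_pos D) - int (num_neg D)))"
  have cr: "?cr \<subseteq> {..<length D}"
    by (auto simp: crossings_def)
  have prod: "(\<Prod>k<length D. w f k) =
      c * (\<Sum>S\<in>Pow ?cr. a powi (int (card S) - int (card (?cr - S))) * (\<Prod>k<length D. ag f k (k \<in> ?V S)))" for f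
  proof -
    have "(\<Prod>k<length D. w f k) = (\<Prod>k\<in>?cr. w f k) * (\<Prod>k\<in>{..<length D} - ?cr. w f k)"
      using prod.subset_diff[OF cr, of "w f"] by (simp add: mult.commute)
    also have "(\<Prod>k\<in>?cr. w f k) = (\<Prod>k\<in>?cr. (- (a ^ 3)) powi (- sign D k)) *
        (\<Prod>k\<in>?cr. a * ag f k (\<not> over D k) + inverse a * ag f k (over D k))"
      unfolding prod.distrib[symmetric] w_def ag_def
      by (intro prod.cong refl slice_weight_jones assms)
    also have "(\<Prod>k\<in>?cr. (- (a ^ 3)) powi (- sign D k)) = c"
      using unit_power_int_sum[of "- (a ^ 3)" ?cr "\<lambda>k. - sign D k"] assms(2)
      by (simp add: c_def unit_power_int_field sum_negf sum_sign dvd_field_iff)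
    \<comment> \<open>Picking one summand at each crossing is picking a Kauffman state.\<close>
    also have "(\<Prod>k\<in>?cr. a * ag f k (\<not> over D k) + inverse a * ag f k (over D k)) =
       (\<Sum>S\<in>Pow ?cr. (\<Prod>k\<in>S. a * ag f k (\<not> over D k)) * (\<Prod>k\<in>?cr - S. inverse a * ag f k (over D k)))"
      by (rule prod_add) simp
    also have "(\<Prod>k\<in>{..<length D} - ?cr. w f k) = (\<Prod>k\<in>{..<length D} - ?cr. ag f k False)"
      unfolding w_def ag_def by (intro prod.cong refl slice_weight_not_crossing assms) auto
    also have "c * (\<Sum>S\<in>Pow ?cr. (\<Prod>k\<in>S. a * ag f k (\<not> over D k)) * (\<Prod>k\<in>?cr - S. inverse a * ag f k (over D k))) *
        (\<Prod>k\<in>{..<length D} - ?cr. ag f k False) =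
      c * (\<Sum>S\<in>Pow ?cr. a powi (int (card S) - int (card (?cr - S))) * (\<Prod>k<length D. ag f k (k \<in> ?V S)))"
      unfolding mult.assoc sum_distrib_right
    proof (intro arg_cong[where f = "(*) c"] sum.cong refl)
      fix S assume S: "S \<in> Pow ?cr"
      have "(\<Prod>k<length D. ag f k (k \<in> ?V S)) =
         (\<Prod>k\<in>?cr. ag f k (k \<in> ?V S)) * (\<Prod>k\<in>{..<length D} - ?cr. ag f k (k \<in> ?V S))"
        using prod.subset_diff[OF cr, of "\<lambda>k. ag f k (k \<in> ?V S)"] by (simp add: mult.commute)
      also have "(\<Prod>k\<in>?cr. ag f k (k \<in> ?V S)) = (\<Prod>k\<in>S. ag f k (k \<in> ?V S)) * (\<Prod>k\<in>?cr - S. ag f k (k \<in> ?V S))"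
        using S prod.subset_diff[of S ?cr "\<lambda>k. ag f k (k \<in> ?V S)"] by (simp add: mult.commute)
      also have "(\<Prod>k\<in>S. ag f k (k \<in> ?V S)) = (\<Prod>k\<in>S. ag f k (\<not> over D k))"
        using S by (intro prod.cong refl arg_cong[where f = "ag f _"]) auto
      also have "(\<Prod>k\<in>?cr - S. ag f k (k \<in> ?V S)) = (\<Prod>k\<in>?cr - S. ag f k (over D k))"
        by (intro prod.cong refl arg_cong[where f = "ag f _"]) auto
      also have "(\<Prod>k\<in>{..<length D} - ?cr. ag f k (k \<in> ?V S)) = (\<Prod>k\<in>{..<length D} - ?cr. ag f k False)"
        by (intro prod.cong refl arg_cong[where f = "ag f _"]) auto
      finally show "(\<Prod>k\<in>S. a * ag f k (\<not> over D k)) * ((\<Prod>k\<in>?cr - S. inverse a * ag f k (over D k)) *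
          (\<Prod>k\<in>{..<length D} - ?cr. ag f k False)) =
        a powi (int (card S) - int (card (?cr - S))) * (\<Prod>k<length D. ag f k (k \<in> ?V S))"
        using assms(2) by (simp add: prod.distrib power_int_diff power_inverse divide_inverse)
    qed
    finally show ?thesis .
  qed
  have circ: "(\<Sum>f\<in>?P. \<Prod>k<length D. ag f k (k \<in> V)) = of_nat N ^ card (circles D V)" for V
  proof -
    let ?r = "\<Union>k<length D. slice_rel k (k \<in> V) (D ! k)"
    have "(\<Prod>k<length D. ag f k (k \<in> V)) = of_bool (constant_along (points D) ?r f)" for f
      unfolding ag_def constant_along_UN by (induction "length D") (auto simp: lessThan_Suc)
    then have "(\<Sum>f\<in>?P. \<Prod>k<length D. ag f k (k \<in> V)) = of_nat (card (respecting (points D) ?r {..<N}))"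
      by (simp add: respecting_eq finite_PiE Int_def)
    then show ?thesis
      by (simp add: card_respecting circles_eq)
  qed
  have "val {..<N} (jones_weight a) D [] (\<lambda>_. 1) [] = (\<Sum>f\<in>?P. \<Prod>k<length D. w f k)"
    unfolding w_def by (rule val_eq_state_sum[OF finite_lessThan assms(1)])
  also have "\<dots> = c * (\<Sum>S\<in>Pow ?cr. a powi (int (card S) - int (card (?cr - S))) *
      (\<Sum>f\<in>?P. \<Prod>k<length D. ag f k (k \<in> ?V S)))"
    unfolding prod sum_distrib_left by (rule sum.swap)
  also have "\<dots> = jones_at a D"
    using assms(2) N unfolding circ
    by (simp add: jones_at_def c_def unit_power_int_field power_int_minus power_inverse)
  finally show ?thesis ..
qed

section \<open>Colorings of regions as labelings of gaps and strands\<close>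

lemma UNIV_bit: "(UNIV :: bit set) = {0, 1}"
  by (auto intro: bit.exhaust)

text \<open>At a crossing of either sign, the first two entries of \<open>cl\<close> lie on the two
  sides of the understrand, the first and third on those of the overstrand. So \<open>q\<close>
  marks difference 0 below and 1 above.\<close>

definition kappa :: "'a::comm_ring_1 \<Rightarrow> bit \<times> bit \<times> bit \<Rightarrow> 'a" where
  "kappa q t = (case t of (x, y, z) \<Rightarrow> if x = y \<and> x \<noteq> z then q else 1)"

definition gap_rel :: "slice list \<Rightarrow> ((nat \<times> nat) \<times> (nat \<times> nat)) set" where
  "gap_rel D = {((k, j), (k + 1, j')) | k j j'. k < length D \<and> (j, j') \<in> gap_adj (D ! k)}"

lemma regions_eq: "regions D = classes (gaps D) (gap_rel D)"
  by (simp add: regions_def gap_rel_def)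

lemma region_of_eq: "region_of D = class_of (gaps D) (gap_rel D)"
  by (rule ext) (simp add: region_of_def class_of_def regions_eq)

text \<open>In characteristic 2 the coloring condition is symmetric in the four corners, so neither
  the sign of the crossing nor its rotation enters.\<close>

definition gap_corners_ok :: "slice list \<Rightarrow> (nat \<times> nat \<Rightarrow> bit) \<Rightarrow> nat \<Rightarrow> bool" where
  "gap_corners_ok D c k \<longleftrightarrow>
     c (k, pos D k) + c (k, pos D k + 1) + c (k + 1, pos D k + 1) + c (k, pos D k + 2) = 0"

text \<open>This is \<open>kappa 2\<close> to the power of the sign, read off the upper ends of the
  two strands. The corner condition makes the difference across a strand the same at both of its
  ends.\<close>

definition gap_weight :: "slice list \<Rightarrow> (nat \<times> nat \<Rightarrow> bit) \<Rightarrow> nat \<Rightarrow> complex" where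
  "gap_weight D c k =
     (let l = c (k, pos D k); t = c (k, pos D k + 1); r = c (k, pos D k + 2) in
      if (if over D k then l \<noteq> t \<and> t = r else l = t \<and> t \<noteq> r) then if sign D k = 1 then 2 else 1 / 2 else 1)"

definition gap_colorings :: "slice list \<Rightarrow> (nat \<times> nat \<Rightarrow> bit) set" where
  "gap_colorings D = {c \<in> respecting (gaps D) (gap_rel D) UNIV. \<forall>k\<in>crossings D. gap_corners_ok D c k}"

lemma crossing_gaps:
  assumes "diagram D" "k \<in> crossings D"
  shows "(k, pos D k) \<in> gaps D" "(k, pos D k + 1) \<in> gaps D"
    "(k + 1, pos D k + 1) \<in> gaps D" "(k, pos D k + 2) \<in> gaps D"
  using assms by (auto elim!: crossingE simp: gaps_def)

lemma Col_condition:
  assumes "diagram D" "k \<in> crossings D" "c = restrict (\<lambda>x. C (region_of D x)) (gaps D)"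
  shows "(case corners D k of (W, N, S, E) \<Rightarrow> case cl D C k of (a, b, c) \<Rightarrow> C E = tern a b c) \<longleftrightarrow>
      gap_corners_ok D c k" (is ?A)
    and "gap_corners_ok D c k \<Longrightarrow> kappa 2 (cl D C k) ^^^ sign D k = gap_weight D c k" (is "_ \<Longrightarrow> ?B")
proof -
  note g = crossing_gaps[OF assms(1,2)]
  let ?l = "C (region_of D (k, pos D k))" and ?t = "C (region_of D (k, pos D k + 1))"
  let ?b = "C (region_of D (k + 1, pos D k + 1))" and ?r = "C (region_of D (k, pos D k + 2))"
  have c: "c (k, pos D k) = ?l" "c (k, pos D k + 1) = ?t" "c (k + 1, pos D k + 1) = ?b" "c (k, pos D k + 2) = ?r"
    unfolding assms(3) using g by simp_all
  show ?A
    unfolding gap_corners_ok_def c cl_def corners_def Let_def tern_def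
    by (cases "dir_tl D k"; cases "dir_tr D k"; cases "sign D k = 1"; cases ?l; cases ?t; cases ?b; cases ?r) simp_all
  assume ok: "gap_corners_ok D c k"
  show ?B
    using ok
    unfolding gap_corners_ok_def gap_weight_def c cl_def corners_def Let_def kappa_def sign_def
    by (cases "dir_tl D k"; cases "dir_tr D k"; cases "over D k"; cases ?l; cases ?t; cases ?b; cases ?r)
      (simp_all add: unit_inv_field)
qed

lemma sum_Col_eq:
  assumes "diagram D"
  shows "(\<Sum>C\<in>Col D. \<Prod>k\<in>crossings D. kappa 2 (cl D C k) ^^^ sign D k) =
    (\<Sum>c\<in>gap_colorings D. \<Prod>k\<in>crossings D. gap_weight D c k)"
proof -
  define F where "F = (\<lambda>C. restrict (\<lambda>x. C (region_of D x)) (gaps D) :: nat \<times> nat \<Rightarrow> bit)"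
  have bij: "bij_betw F (regions D \<rightarrow>\<^sub>E UNIV) (respecting (gaps D) (gap_rel D) UNIV)"
    unfolding F_def regions_eq region_of_eq by (rule bij_betw_classes)
  have "(\<forall>k\<in>crossings D. case corners D k of (W, N, S, E) \<Rightarrow> case cl D C k of (a, b, c) \<Rightarrow> C E = tern a b c)
      \<longleftrightarrow> (\<forall>k\<in>crossings D. gap_corners_ok D (F C) k)" for C
    unfolding F_def by (intro ball_cong refl Col_condition(1)[OF assms _ refl])
  then have Col: "C \<in> Col D \<longleftrightarrow> C \<in> regions D \<rightarrow>\<^sub>E UNIV \<and> F C \<in> gap_colorings D" for C
    using bij_betwE[OF bij] by (auto simp: Col_def gap_colorings_def)
  have "bij_betw F (Col D) (gap_colorings D)"
    unfolding bij_betw_def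
  proof
    show "inj_on F (Col D)"
      using bij_betw_imp_inj_on[OF bij] Col by (auto intro: inj_on_subset)
    show "F ` Col D = gap_colorings D"
    proof
      show "gap_colorings D \<subseteq> F ` Col D"
      proof
        fix c assume c: "c \<in> gap_colorings D"
        then have "c \<in> F ` (regions D \<rightarrow>\<^sub>E UNIV)"
          unfolding bij_betw_imp_surj_on[OF bij] by (simp add: gap_colorings_def)
        then show "c \<in> F ` Col D"
          using c Col by auto
      qed
    qed (use Col in auto)
  qed
  moreover have "kappa 2 (cl D C k) ^^^ sign D k = gap_weight D (F C) k" if "C \<in> Col D" "k \<in> crossings D" for C k
    unfolding F_def
    by (rule Col_condition(2)[OF assms that(2) refl])
      (use that Col in \<open>auto simp: F_def gap_colorings_def\<close>)
  ultimately show ?thesis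
    by (simp add: sum.reindex_bij_betw[symmetric])
qed

text \<open>A description uniform in the three pieces: only a gap between two ends of the piece, at
  position \<open>i + 1\<close> above or below it, is left free.\<close>

definition gap_agree :: "slice list \<Rightarrow> (nat \<times> nat \<Rightarrow> bit) \<Rightarrow> nat \<Rightarrow> bool" where
  "gap_agree D c k \<longleftrightarrow> (case D ! k of (i, p) \<Rightarrow>
     (\<forall>j\<le>i. c (k, j) = c (Suc k, j)) \<and>
     (\<forall>j\<ge>i. j + ins p \<le> length (level D k) \<longrightarrow> c (k, j + ins p) = c (Suc k, j + outs p)))"

lemma constant_along_gap_rel:
  assumes "diagram D"
  shows "constant_along (gaps D) (gap_rel D) c \<longleftrightarrow> (\<forall>k<length D. gap_agree D c k)"
proof -
  have "constant_along (gaps D) (gap_rel D) c \<longleftrightarrow>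
    (\<forall>k<length D. \<forall>(j, j')\<in>gap_adj (D ! k). j \<le> length (level D k) \<longrightarrow> j' \<le> length (level D (Suc k)) \<longrightarrow>
       c (k, j) = c (Suc k, j'))"
    by (fastforce simp: constant_along_def gap_rel_def gaps_def)
  also have "\<dots> \<longleftrightarrow> (\<forall>k<length D. gap_agree D c k)"
  proof (intro all_cong)
    fix k assume k: "k < length D"
    obtain i p where ip: "D ! k = (i, p)"
      by fastforce
    have len: "i + ins p \<le> length (level D k)" "length (level D (Suc k)) = length (level D k) - ins p + outs p"
      using step_length[of i p "level D k" "level D (Suc k)"] diagram_level[OF assms k] ip by auto
    show "(\<forall>(j, j')\<in>gap_adj (D ! k). j \<le> length (level D k) \<longrightarrow> j' \<le> length (level D (Suc k)) \<longrightarrow>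
       c (k, j) = c (Suc k, j')) \<longleftrightarrow> gap_agree D c k"
    proof (cases p)
      case (Cap d)
      then show ?thesis
        using len by (auto simp: gap_agree_def ip Ball_def)
    next
      case Cup
      then show ?thesis
        using len by (auto simp: gap_agree_def ip Ball_def)
    next
      case (Cross b)
      have "(\<forall>j. j \<noteq> Suc i \<longrightarrow> j \<le> length (level D k) \<longrightarrow> c (k, j) = c (Suc k, j)) \<longleftrightarrow> gap_agree D c k"
      proof
        assume "gap_agree D c k"
        then have *: "\<And>j. j \<le> i \<Longrightarrow> c (k, j) = c (Suc k, j)"
          "\<And>j. i \<le> j \<Longrightarrow> j + 2 \<le> length (level D k) \<Longrightarrow> c (k, j + 2) = c (Suc k, j + 2)"
          by (auto simp: gap_agree_def ip Cross)
        show "\<forall>j. j \<noteq> Suc i \<longrightarrow> j \<le> length (level D k) \<longrightarrow> c (k, j) = c (Suc k, j)"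
        proof (intro allI impI)
          fix j assume j: "j \<noteq> Suc i" "j \<le> length (level D k)"
          show "c (k, j) = c (Suc k, j)"
          proof (cases "j \<le> i")
            case False
            then have "i \<le> j - 2" "j - 2 + 2 = j"
              using j(1) by arith+
            then show ?thesis
              using *(2)[of "j - 2"] j(2) by metis
          qed (rule *(1))
        qed
      qed (use len Cross in \<open>auto simp: gap_agree_def ip\<close>)
      then show ?thesis
        using len Cross by (auto simp: ip Ball_def)
    qed
  qed
  finally show ?thesis .
qed

definition strand_labels :: "slice list \<Rightarrow> (nat \<times> nat \<Rightarrow> bit) \<Rightarrow> nat \<times> nat \<Rightarrow> bool" where
  "strand_labels D c = restrict (\<lambda>(k, j). c (k, j) \<noteq> c (k, Suc j)) (points D)"

text \<open>The corner condition says that both strands keep their differences through the crossing,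
  and the two legs of an extremum separate the same two regions; so the labels lie in the support of
  the linking model.\<close>

lemma slice_weight_strand_labels:
  assumes "diagram D" "c \<in> gap_colorings D" "k < length D"
  shows "slice_weight link_weight (D ! k) (level D k) (row D (strand_labels D c) k) (row D (strand_labels D c) (Suc k)) =
    (if k \<in> crossings D then gap_weight D c k else 1)"
proof -
  obtain i p where ip: "D ! k = (i, p)"
    by fastforce
  have len: "i + ins p \<le> length (level D k)" "length (level D (Suc k)) = length (level D k) - ins p + outs p"
    using step_length[of i p "level D k" "level D (Suc k)"] diagram_level[OF assms(1,3)] ip by auto
  let ?x = "row D (strand_labels D c) k" and ?y = "row D (strand_labels D c) (Suc k)"
  have x: "?x ! j \<longleftrightarrow> c (k, j) \<noteq> c (k, Suc j)" if "j < length (level D k)" for j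
    using that assms(3) by (simp add: strand_labels_def points_def)
  have y: "?y ! j \<longleftrightarrow> c (Suc k, j) \<noteq> c (Suc k, Suc j)" if "j < length (level D (Suc k))" for j
    using that assms(3) by (simp add: strand_labels_def points_def)
  have "gap_agree D c k"
    using assms constant_along_gap_rel[OF assms(1), of c] by (simp add: gap_colorings_def respecting_eq)
  then have g: "\<And>j. j \<le> i \<Longrightarrow> c (k, j) = c (Suc k, j)"
    "\<And>j. i \<le> j \<Longrightarrow> j + ins p \<le> length (level D k) \<Longrightarrow> c (k, j + ins p) = c (Suc k, j + outs p)"
    by (auto simp: gap_agree_def ip)
  have agree: "take i ?x = take i ?y \<and> drop (i + ins p) ?x = drop (i + outs p) ?y"
  proof (subst agree_iff, use len in simp, use len in simp, intro conjI allI impI)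
    fix j assume "j < i"
    then show "?x ! j = ?y ! j"
      using len g(1)[of j] g(1)[of "Suc j"] by (simp add: x y del: nth_row)
  next
    fix j assume "i \<le> j" "j + ins p < length ?x"
    then show "?x ! (j + ins p) = ?y ! (j + outs p)"
      using len g(2)[of j] g(2)[of "Suc j"] by (simp add: x y del: nth_row)
  qed
  show ?thesis
  proof (cases p)
    case (Cap d)
    then show ?thesis
      using agree len g(1)[of i] g(2)[of i] assms(3)
      by (auto simp: slice_weight_def ip crossings_def y simp del: nth_row)
  next
    case Cup
    then show ?thesis
      using agree len g(1)[of i] g(2)[of i] assms(3)
      by (auto simp: slice_weight_def ip crossings_def x simp del: nth_row)
  next
    case (Cross b)
    have cr: "k \<in> crossings D"
      using assms(3) ip Cross by (auto simp: crossings_def)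
    then obtain k': "pos D k = i" "over D k \<longleftrightarrow> b" "dir_tl D k = level D k ! i" "dir_tr D k = level D k ! Suc i"
      using assms(1) ip Cross by (auto elim!: crossingE)
    have "gap_corners_ok D c k"
      using assms(2) cr by (auto simp: gap_colorings_def)
    then have ok: "c (k, i) + c (k, Suc i) + c (Suc k, Suc i) + c (k, Suc (Suc i)) = 0"
      by (simp add: gap_corners_ok_def k')
    have eqs: "c (Suc k, i) = c (k, i)" "c (Suc k, Suc (Suc i)) = c (k, Suc (Suc i))"
      using g(1)[of i] g(2)[of i] len Cross by auto
    have "slice_weight link_weight (D ! k) (level D k) ?x ?y =
      link_weight (level D k ! i) (level D k ! Suc i) b (?x ! i) (?x ! Suc i) (?y ! i) (?y ! Suc i)"
      using agree len Cross by (simp add: slice_weight_def ip)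
    also have "\<dots> = gap_weight D c k"
      using ok len Cross unfolding gap_weight_def link_weight_def k' sign_def
      by (cases "c (k, i)"; cases "c (k, Suc i)"; cases "c (Suc k, Suc i)"; cases "c (k, Suc (Suc i))")
        (simp_all add: x y eqs Let_def del: nth_row)
    finally show ?thesis
      using cr by simp
  qed
qed

definition color_sum :: "bool list \<Rightarrow> nat \<Rightarrow> bit" where
  "color_sum x j = sum_list (map of_bool (take j x))"

lemma color_sum_0 [simp]: "color_sum x 0 = 0"
  by (simp add: color_sum_def)

lemma color_sum_Suc: "j < length x \<Longrightarrow> color_sum x (Suc j) = color_sum x j + of_bool (x ! j)"
  by (simp add: color_sum_def take_Suc_conv_app_nth)

text \<open>Integration of the differences: from the color \<open>b\<close> of the unbounded region
  at the far left, the color changes at every strand labeled True. This inverts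
  \<open>strand_labels\<close> up to the choice of \<open>b\<close>.\<close>

definition gap_colors :: "slice list \<Rightarrow> bit \<Rightarrow> (nat \<times> nat \<Rightarrow> bool) \<Rightarrow> nat \<times> nat \<Rightarrow> bit" where
  "gap_colors D b f = restrict (\<lambda>(k, j). b + color_sum (row D f k) j) (gaps D)"

lemma link_weight_nonzero: "link_weight d e b x y p r \<noteq> 0 \<longleftrightarrow> x = r \<and> y = p"
  by (simp add: link_weight_def)

lemma gap_colors_in:
  assumes "diagram D"
    and nonzero: "\<And>k. k < length D \<Longrightarrow>
      slice_weight link_weight (D ! k) (level D k) (row D f k) (row D f (Suc k)) \<noteq> 0"
  shows "gap_colors D b f \<in> gap_colorings D"
proof -
  let ?c = "gap_colors D b f"
  have c: "?c (k, j) = b + color_sum (row D f k) j" if "k \<le> length D" "j \<le> length (level D k)" for k j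
    using that by (simp add: gap_colors_def gaps_def)
  have slice: "gap_agree D ?c k" "k \<in> crossings D \<Longrightarrow> gap_corners_ok D ?c k" if k: "k < length D" for k
  proof -
    obtain i p where ip: "D ! k = (i, p)"
      by fastforce
    have len: "i + ins p \<le> length (level D k)" "length (level D (Suc k)) = length (level D k) - ins p + outs p"
      using step_length[of i p "level D k" "level D (Suc k)"] diagram_level[OF assms(1) k] ip by auto
    let ?x = "row D f k" and ?y = "row D f (Suc k)"
    have nz: "take i ?x = take i ?y" "drop (i + ins p) ?x = drop (i + outs p) ?y"
      "piece_weight link_weight p (drop i (level D k)) (drop i ?x) (drop i ?y) \<noteq> 0"
      using nonzero[OF k] by (auto simp: slice_weight_def ip split: if_splits)
    have low: "color_sum ?x j = color_sum ?y j" if "j \<le> i" for j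
      using nz(1) that unfolding color_sum_def by (metis min.absorb2 take_take min.commute)
    \<comment> \<open>Equal labels on the legs of an extremum cancel modulo 2, and a crossing
      permutes its labels; so the total change of color across the piece is the same above and
      below.\<close>
    have mid: "color_sum ?x (i + ins p) = color_sum ?y (i + outs p)"
      using nz(3) low[of i] len
      by (cases p) (auto simp: color_sum_Suc link_weight_nonzero)
    have split: "color_sum z (j + n) = color_sum z (i + n) + sum_list (map of_bool (take (j - i) (drop (i + n) z)))"
      if "i \<le> j" for j z n
    proof -
      have "j + n = (i + n) + (j - i)"
        using that by simp
      then show ?thesis
        unfolding color_sum_def by (simp only: take_add map_append sum_list_append)
    qed
    have high: "color_sum ?x (j + ins p) = color_sum ?y (j + outs p)" if "i \<le> j" for j
      unfolding split[OF that, of _ "ins p"] split[OF that, of _ "outs p"] nz(2) mid ..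
    show "gap_agree D ?c k"
      using low high len k by (auto simp: gap_agree_def ip c)
    assume cr: "k \<in> crossings D"
    then obtain b' where p: "p = Cross b'"
      using ip by (auto simp: crossings_def)
    have "pos D k = i"
      by (simp add: pos_def ip)
    moreover have "?c (k, i) = b + color_sum ?x i"
      "?c (k, Suc i) = b + (color_sum ?x i + of_bool (?x ! i))"
      "?c (Suc k, Suc i) = b + (color_sum ?x i + of_bool (?y ! i))"
      "?c (k, Suc (Suc i)) = b + (color_sum ?x i + of_bool (?x ! i) + of_bool (?x ! Suc i))"
      using len k low[of i] unfolding p by (simp_all add: c color_sum_Suc del: nth_row)
    moreover have "?y ! i = ?x ! Suc i"
      using nz(3) len unfolding p by (simp add: link_weight_nonzero del: nth_row)
    ultimately show "gap_corners_ok D ?c k"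
      unfolding gap_corners_ok_def
      by (cases b; cases "color_sum ?x i"; cases "?x ! i"; cases "?x ! Suc i") (simp_all del: nth_row)
  qed
  then show ?thesis
    using constant_along_gap_rel[OF assms(1), of ?c]
    by (auto simp: gap_colorings_def respecting_eq gap_colors_def crossings_def)
qed

text \<open>The factor 2 counts the colors of the unbounded region; the differences across strands
  determine the rest.\<close>

theorem sum_gap_colorings:
  assumes "diagram D"
  shows "(\<Sum>c\<in>gap_colorings D. \<Prod>k\<in>crossings D. gap_weight D c k) =
    2 * val UNIV link_weight D [] (\<lambda>_. 1) []"
proof -
  define w where "w = (\<lambda>f k. slice_weight link_weight (D ! k) (level D k) (row D f k) (row D f (Suc k)))"
  define G where "G = {f \<in> points D \<rightarrow>\<^sub>E UNIV. \<forall>k<length D. w f k \<noteq> 0}"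
  have "(\<Sum>c\<in>gap_colorings D. \<Prod>k\<in>crossings D. gap_weight D c k) =
      (\<Sum>(b, f)\<in>(UNIV :: bit set) \<times> G. \<Prod>k<length D. w f k)"
  proof (rule sum.reindex_bij_witness[where j = "\<lambda>c. (c (0, 0), strand_labels D c)" and
        i = "\<lambda>(b, f). gap_colors D b f"])
    fix c assume c: "c \<in> gap_colorings D"
    have w: "w (strand_labels D c) k = (if k \<in> crossings D then gap_weight D c k else 1)" if "k < length D" for k
      unfolding w_def by (rule slice_weight_strand_labels[OF assms c that])
    have agree: "gap_agree D c k" if "k < length D" for k
      using that c constant_along_gap_rel[OF assms, of c] by (simp add: gap_colorings_def respecting_eq)
    \<comment> \<open>The leftmost gaps of all levels belong to the unbounded region.\<close>
    have c0: "c (k, 0) = c (0, 0)" if "k \<le> length D" for k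
      using that
    proof (induction k)
      case (Suc k)
      then show ?case
        using agree[of k] by (auto simp: gap_agree_def split: prod.splits)
    qed simp
    have cj: "c (0, 0) + color_sum (row D (strand_labels D c) k) j = c (k, j)"
      if "k \<le> length D" "j \<le> length (level D k)" for k j
      using that(2)
    proof (induction j)
      case 0
      then show ?case
        using c0[OF that(1)] by simp
    next
      case (Suc j)
      then show ?case
        using that(1)
        by (cases "c (k, j)"; cases "c (k, Suc j)")
          (auto simp: color_sum_Suc strand_labels_def points_def add.assoc[symmetric])
    qed
    have "c \<in> gaps D \<rightarrow>\<^sub>E UNIV"
      using c by (simp add: gap_colorings_def respecting_eq)
    from PiE_arb[OF this] show "(case (c (0, 0), strand_labels D c) of (b, f) \<Rightarrow> gap_colors D b f) = c"
      using cj by (intro ext) (auto simp: gap_colors_def restrict_def gaps_def)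
    have "gap_weight D c k \<noteq> 0" for k
      by (simp add: gap_weight_def Let_def)
    moreover have "strand_labels D c \<in> points D \<rightarrow>\<^sub>E UNIV"
      by (simp add: strand_labels_def)
    ultimately show "(c (0, 0), strand_labels D c) \<in> UNIV \<times> G"
      by (simp add: G_def w)
    have "crossings D \<subseteq> {..<length D}"
      by (auto simp: crossings_def)
    then show "(case (c (0, 0), strand_labels D c) of (b, f) \<Rightarrow> \<Prod>k<length D. w f k) =
        (\<Prod>k\<in>crossings D. gap_weight D c k)"
      by (simp add: w prod.If_cases Int_absorb1)
  next
    fix z assume "z \<in> (UNIV :: bit set) \<times> G"
    then obtain b f where z: "z = (b, f)" and f: "f \<in> points D \<rightarrow>\<^sub>E UNIV" "\<And>k. k < length D \<Longrightarrow> w f k \<noteq> 0"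
      by (auto simp: G_def)
    show "(case z of (b, f) \<Rightarrow> gap_colors D b f) \<in> gap_colorings D"
      using gap_colors_in[OF assms, of f b] f(2) by (simp add: z w_def)
    have "strand_labels D (gap_colors D b f) = f"
    proof
      fix q show "strand_labels D (gap_colors D b f) q = f q"
        using PiE_arb[OF f(1), of q]
        by (cases q) (auto simp: strand_labels_def gap_colors_def points_def gaps_def color_sum_Suc)
    qed
    moreover have "gap_colors D b f (0, 0) = b"
      by (simp add: gap_colors_def gaps_def)
    ultimately show "((case z of (b, f) \<Rightarrow> gap_colors D b f) (0, 0), strand_labels D (case z of (b, f) \<Rightarrow> gap_colors D b f)) = z"
      by (simp add: z)
  qed
  also have "\<dots> = (\<Sum>b\<in>(UNIV :: bit set). \<Sum>f\<in>G. \<Prod>k<length D. w f k)"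
    by (rule sum.cartesian_product[symmetric])
  also have "\<dots> = 2 * (\<Sum>f\<in>G. \<Prod>k<length D. w f k)"
  proof -
    show ?thesis
      unfolding UNIV_bit by simp
  qed
  also have "(\<Sum>f\<in>G. \<Prod>k<length D. w f k) = (\<Sum>f\<in>points D \<rightarrow>\<^sub>E UNIV. \<Prod>k<length D. w f k)"
    by (rule sum.mono_neutral_left) (auto simp: G_def finite_PiE)
  also have "\<dots> = val UNIV link_weight D [] (\<lambda>_. 1) []"
    unfolding w_def by (rule val_eq_state_sum[symmetric, OF _ assms]) simp
  finally show ?thesis .
qed

section \<open>Specializing the invariant\<close>

lemma unit_power_int_mult_sign:
  assumes "a dvd 1" "b dvd 1" "s = 1 \<or> s = -1"
  shows "(a * b) ^^^ s = a ^^^ s * b ^^^ s"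
proof -
  have "a * b * (unit_inv a * unit_inv b) = (a * unit_inv a) * (b * unit_inv b)"
    by (simp add: mult_ac)
  then have "unit_inv (a * b) = unit_inv a * unit_inv b"
    using assms(1,2) by (intro unit_inv_eqI) (simp add: unit_inv_right)
  then show ?thesis
    using assms(3) by auto
qed

lemma unit_mult: "a dvd 1 \<Longrightarrow> b dvd 1 \<Longrightarrow> a * b dvd (1 :: 'a :: comm_ring_1)"
  using mult_dvd_mono[of a 1 b 1] by simp

lemma unit_power: "a dvd 1 \<Longrightarrow> a ^ n dvd (1 :: 'a :: comm_ring_1)"
  using dvd_power_same[of a 1 n] by simp

lemma unit_inv_dvd: "a dvd 1 \<Longrightarrow> unit_inv a dvd 1"
  by (metis dvd_triv_right unit_inv_right)

lemma unit_inv_unit_inv: "a dvd 1 \<Longrightarrow> unit_inv (unit_inv a) = a"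
  by (rule unit_inv_eqI) (simp add: unit_inv_right mult.commute)

lemma xvar_dvd: "xvar i dvd 1"
proof
  show "1 = xvar i * Poly_Mapping.single (Poly_Mapping.single i (-1)) 1"
    by (simp add: xvar_def mult_single single_add[symmetric])
qed

lemma A5_dvd: "A5 t dvd 1"
  by (cases t) (auto simp: intro!: xvar_dvd unit_inv_dvd unit_mult)

lemma B5_dvd: "B5 t dvd 1"
  unfolding B5_def by (intro unit_mult unit_inv_dvd xvar_dvd A5_dvd)

lemma unit_inv_cancel:
  assumes "a dvd 1" shows "unit_inv a * (a * x) = x"
proof -
  have "unit_inv a * (a * x) = a * unit_inv a * x"
    by (simp only: mult_ac)
  then show ?thesis
    using unit_inv_right[OF assms] by simp
qed

lemma single_one_inj:
  assumes "Poly_Mapping.single x (1 :: int) = Poly_Mapping.single y 1"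
  shows "x = y"
proof (rule ccontr)
  assume "x \<noteq> y"
  then show False
    using arg_cong[OF assms, of "\<lambda>p. Poly_Mapping.lookup p x"] by (simp add: lookup_single)
qed

text \<open>States take the two maps themselves as values, and the smoothing is read off by
  comparison with \<open>A5\<close>. The count of states is right only if the maps differ.\<close>

lemma B5_neq_A5: "B5 \<noteq> A5"
proof
  assume "B5 = A5"
  then have "B5 (0, 0, 0) = A5 (0, 0, 0)"
    by (rule fun_cong)
  then have "unit_inv (xvar 1) * (xvar 1 * xvar 5) = xvar 1"
    by (simp add: B5_def mult_ac)
  then have "xvar 5 = xvar 1"
    by (simp only: unit_inv_cancel[OF xvar_dvd])
  then have "Poly_Mapping.single (5 :: 5) (1 :: int) = Poly_Mapping.single 1 1"
    unfolding xvar_def by (rule single_one_inj)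
  then have "(5 :: 5) = 1"
    by (rule single_one_inj)
  then show False
    by simp
qed

lemma jones_at_hom:
  assumes "ring_hom h" "a dvd 1"
  shows "h (jones_at a D) = jones_at (h a) D"
proof -
  interpret ring_hom h by fact
  have "- (a ^ 3) dvd 1"
    using assms(2) by (simp add: unit_power)
  then show ?thesis
    using assms(2)
    by (simp add: jones_at_def hom_mult hom_sum hom_power hom_minus hom_uminus hom_unit_power_int)
qed

text \<open>Equal images of the third and fourth variable make the entries at (0, 0, 1) and (1, 1,
  0) agree. Hence \<open>A5\<close> becomes \<open>a\<close> times \<open>kappa q\<close> and
  \<open>B5\<close> the inverse of \<open>a\<close> times \<open>kappa q\<close>, so the factors
  \<open>kappa q\<close> depend on the coloring but not on the state and leave the state
  sum.\<close>

theorem hom_beta: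
  assumes "ring_hom h" "q dvd 1" "h (xvar 1) = a" "h (xvar 5) = unit_inv a"
    and x234: "h (xvar 2) = q * a" "h (xvar 3) = a" "h (xvar 4) = a"
  shows "h (beta D C) = jones_at a D * (\<Prod>k\<in>crossings D. kappa q (cl D C k) ^^^ sign D k)"
proof -
  interpret ring_hom h by fact
  let ?cr = "crossings D"
  have a: "a dvd 1"
    using hom_unit[OF xvar_dvd[of 1]] assms(3) by simp
  note inv = unit_inv_right[OF a] unit_inv_unit_inv[OF a] unit_inv_dvd[OF a]
  note inv' = unit_inv_cancel[OF a]
  have kappa: "kappa q t dvd 1" for t
    using assms(2) by (simp add: kappa_def split: prod.splits)
  have A: "h (A5 t) = a * kappa q t" for t
  proof -
    obtain x y z where t: "t = (x, y, z)"
      by (cases t)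
    show ?thesis
      unfolding t
      by (cases x; cases y; cases z)
        (simp_all add: kappa_def assms hom_mult hom_unit_inv xvar_dvd inv(1) mult_ac)
  qed
  have B: "h (B5 t) = unit_inv a * kappa q t" for t
    unfolding B5_def hom_mult hom_unit_inv[OF xvar_dvd] assms(3,4) A
    by (simp only: mult.assoc inv')
  have w: "h w5 = - (a ^ 3)"
    by (simp add: w5_def hom_uminus hom_mult hom_power hom_unit_inv xvar_dvd assms inv
        power2_eq_square power3_eq_cube)
  have "w5 dvd 1"
    unfolding w5_def using xvar_dvd by (simp add: unit_mult unit_power unit_inv_dvd)
  then have w': "h (w5 ^^^ m) = (- (a ^ 3)) ^^^ m" for m
    by (simp add: hom_unit_power_int w)
  have d: "h delta5 = - (a ^^^ 2) - a ^^^ (-2)"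
    by (simp add: delta5_def hom_uminus hom_minus hom_mult hom_unit_inv xvar_dvd assms inv
        unit_power_int_def power2_eq_square)
  let ?e = "\<lambda>S k. (if k \<in> S then a else unit_inv a)"
  let ?g = "\<lambda>S. (- (a ^^^ 2) - a ^^^ (-2)) ^ card (circles D {k \<in> ?cr. k \<in> S \<longleftrightarrow> \<not> over D k}) * (\<Prod>k\<in>?cr. ?e S k * kappa q (cl D C k) ^^^ sign D k)"
  \<comment> \<open>Entries are raised to the sign, so \<open>A5\<close> at a positive crossing and
    \<open>B5\<close> at a negative one contribute \<open>a\<close>; these are the crossings with
    the Kauffman A-smoothing.\<close>
  let ?S = "\<lambda>s. {k \<in> ?cr. s k = A5 \<longleftrightarrow> sign D k = 1}"
  have "h (\<Sum>s\<in>?cr \<rightarrow>\<^sub>E {A5, B5}. delta5 ^ num_circles D s * (\<Prod>k\<in>?cr. s k (cl D C k) ^^^ sign D k)) =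
    (\<Sum>s\<in>?cr \<rightarrow>\<^sub>E {A5, B5}. ?g (?S s))"
    unfolding hom_sum
  proof (rule sum.cong)
    fix s assume s: "s \<in> ?cr \<rightarrow>\<^sub>E {A5, B5}"
    \<comment> \<open>The smoothing for \<open>A5\<close> follows the orientation, the A-smoothing
      follows the overstrand; the sign of the crossing translates between the two.\<close>
    have "{k \<in> ?cr. s k = A5 \<longleftrightarrow> dir_tl D k = dir_tr D k} = {k \<in> ?cr. k \<in> ?S s \<longleftrightarrow> \<not> over D k}"
      by (auto simp: sign_def split: if_splits)
    moreover have "h (s k (cl D C k) ^^^ sign D k) = ?e (?S s) k * kappa q (cl D C k) ^^^ sign D k" if k: "k \<in> ?cr" for k
    proof -
      have "s k = A5 \<or> s k = B5"
        using PiE_mem[OF s k] by blast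
      then have "s k (cl D C k) dvd 1" and hs: "h (s k (cl D C k)) = (if s k = A5 then a else unit_inv a) * kappa q (cl D C k)"
        using A5_dvd[of "cl D C k"] B5_dvd[of "cl D C k"] B5_neq_A5 A[of "cl D C k"] B[of "cl D C k"]
        by auto
      then have "h (s k (cl D C k) ^^^ sign D k) =
          (if s k = A5 then a else unit_inv a) ^^^ sign D k * kappa q (cl D C k) ^^^ sign D k"
        using a inv(3) kappa by (subst hom_unit_power_int) (auto simp: unit_power_int_mult_sign sign_cases)
      also have "(if s k = A5 then a else unit_inv a) ^^^ sign D k = ?e (?S s) k"
        using k sign_cases[of D k] inv(2) by auto
      finally show ?thesis .
    qed
    ultimately show "h (delta5 ^ num_circles D s * (\<Prod>k\<in>?cr. s k (cl D C k) ^^^ sign D k)) = ?g (?S s)"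
      unfolding num_circles_def hom_mult hom_power hom_prod d by simp
  qed simp
  also have "\<dots> = (\<Sum>S\<in>Pow ?cr. ?g S)"
  proof (rule sum.reindex_bij_witness[where j = ?S and
        i = "\<lambda>S. restrict (\<lambda>k. if k \<in> S \<longleftrightarrow> sign D k = 1 then A5 else B5) ?cr"])
    fix s assume s: "s \<in> ?cr \<rightarrow>\<^sub>E {A5, B5}"
    show "restrict (\<lambda>k. if k \<in> ?S s \<longleftrightarrow> sign D k = 1 then A5 else B5) ?cr = s"
    proof
      fix k show "restrict (\<lambda>k. if k \<in> ?S s \<longleftrightarrow> sign D k = 1 then A5 else B5) ?cr k = s k"
        using PiE_mem[OF s, of k] PiE_arb[OF s, of k] by (auto simp: restrict_def)
    qed
  next
    fix S assume "S \<in> Pow ?cr"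
    then show "?S (restrict (\<lambda>k. if k \<in> S \<longleftrightarrow> sign D k = 1 then A5 else B5) ?cr) = S"
      using B5_neq_A5 by (auto split: if_splits)
  qed auto
  also have "\<dots> = (\<Sum>S\<in>Pow ?cr. a ^^^ (int (card S) - int (card (?cr - S))) *
      (- (a ^^^ 2) - a ^^^ (-2)) ^ card (circles D {k \<in> ?cr. k \<in> S \<longleftrightarrow> \<not> over D k})) *
      (\<Prod>k\<in>?cr. kappa q (cl D C k) ^^^ sign D k)"
    unfolding sum_distrib_right
  proof (rule sum.cong)
    fix S assume S: "S \<in> Pow ?cr"
    have "(\<Prod>k\<in>?cr. ?e S k) = (\<Prod>k\<in>?cr. a ^^^ (if k \<in> S then 1 else -1))"
      by (intro prod.cong) auto
    also have "\<dots> = a ^^^ (\<Sum>k\<in>?cr. if k \<in> S then 1 else -1)"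
      by (rule unit_power_int_sum[symmetric, OF a]) simp
    also have "(\<Sum>k\<in>?cr. if k \<in> S then 1 else -1) = int (card S) - int (card (?cr - S))"
      using S by (simp add: sum.If_cases Int_absorb1 Diff_eq)
    finally show "?g S = a ^^^ (int (card S) - int (card (?cr - S))) *
      (- (a ^^^ 2) - a ^^^ (-2)) ^ card (circles D {k \<in> ?cr. k \<in> S \<longleftrightarrow> \<not> over D k}) *
      (\<Prod>k\<in>?cr. kappa q (cl D C k) ^^^ sign D k)"
      by (simp add: prod.distrib mult_ac)
  qed simp
  finally show ?thesis
    unfolding beta_def hom_mult w' jones_at_def by (simp add: mult.assoc)
qed

lemma finite_Col [simp]: "finite (Col D)"
proof (rule finite_subset)
  show "Col D \<subseteq> regions D \<rightarrow>\<^sub>E UNIV"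
    by (auto simp: Col_def)
  have "finite (UNIV :: bit set)"
    unfolding UNIV_bit by simp
  then show "finite (regions D \<rightarrow>\<^sub>E (UNIV :: bit set))"
    unfolding regions_eq by (intro finite_PiE finite_classes) auto
qed

section \<open>The Jones polynomial as a specialization\<close>

definition exponent_sum :: "(5 \<Rightarrow> int) \<Rightarrow> (5 \<Rightarrow>\<^sub>0 int) \<Rightarrow> int" where
  "exponent_sum c e = (\<Sum>i\<in>UNIV. c i * Poly_Mapping.lookup e i)"

lemma exponent_sum_hom:
  "exponent_sum c 0 = 0" "exponent_sum c (e + e') = exponent_sum c e + exponent_sum c e'"
  "exponent_sum c (Poly_Mapping.single i 1) = c i"
  by (simp_all add: exponent_sum_def lookup_add distrib_left sum.distrib lookup_single when_def
      if_distrib[of "(*) _"] cong: if_cong)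

text \<open>The Kauffman variable A is the power -1/4 of t, hence the signs.\<close>

definition to_jones :: "laurent5 \<Rightarrow> laurent_t" where
  "to_jones = laurent_eval (\<lambda>e. t_quarter (exponent_sum (\<lambda>i. if i = 5 then 1 else -1) e))"

lemma t_quarter_add: "t_quarter (m + n) = t_quarter m * t_quarter n"
  by (simp add: t_quarter_def mult_single)

lemma ring_hom_to_jones: "ring_hom to_jones"
  unfolding to_jones_def
  by (rule ring_hom_laurent_eval) (simp add: exponent_sum_hom t_quarter_def, simp only: exponent_sum_hom t_quarter_add)

text \<open>For \<open>q\<close> = 1 in \<open>hom_beta\<close> the dependence on the coloring
  disappears.\<close>

lemma to_jones_beta: "to_jones (beta D C) = jones_diagram D"
proof -
  have "(1::5) \<noteq> 5" "(2::5) \<noteq> 5" "(3::5) \<noteq> 5" "(4::5) \<noteq> 5"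
    by simp_all
  then have x: "to_jones (xvar i) = t_quarter (if i = 5 then 1 else -1)" for i
    by (simp add: to_jones_def xvar_def laurent_eval_single exponent_sum_hom)
  have "unit_inv kauffman_var = t_quarter 1"
    unfolding kauffman_var_def
    by (rule unit_inv_eqI) (simp add: t_quarter_add[symmetric], simp add: t_quarter_def)
  then have "to_jones (beta D C) = jones_at kauffman_var D * (\<Prod>k\<in>crossings D. kappa 1 (cl D C k) ^^^ sign D k)"
    by (intro hom_beta ring_hom_to_jones) (simp_all add: x kauffman_var_def)
  also have "kappa 1 t = (1 :: laurent_t)" for t
    by (simp add: kappa_def split: prod.splits)
  moreover have "(1 :: laurent_t) ^^^ m = 1" for m
    using unit_inv_eqI[of "1::laurent_t" 1] by (simp add: unit_power_int_def)
  ultimately show ?thesis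
    by (simp add: jones_diagram_eq)
qed

text \<open>The zero coloring always exists; it ensures that the multiset has an element from which
  to read the Jones polynomial.\<close>

lemma Col_nonempty: "diagram D \<Longrightarrow> Col D \<noteq> {}"
proof -
  have "restrict (\<lambda>_. 0) (regions D) \<in> Col D" if "diagram D"
  proof -
    have in_regions: "region_of D g \<in> regions D" if "g \<in> gaps D" for g
      unfolding region_of_eq regions_eq by (rule class_of_in[OF that])
    show ?thesis
      using crossing_gaps[OF that, THEN in_regions]
      by (auto simp: Col_def corners_def cl_def Let_def tern_def split: direction.split)
  qed
  then show "diagram D \<Longrightarrow> Col D \<noteq> {}"
    by blast
qed

section \<open>The diagram chosen in an isotopy class\<close>

lemma isotopic_props:
  shows isotopic_refl: "diagram D \<Longrightarrow> (D, D) \<in> isotopic"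
    and isotopic_sym: "(D, D') \<in> isotopic \<Longrightarrow> (D', D) \<in> isotopic"
    and isotopic_trans: "(D, D') \<in> isotopic \<Longrightarrow> (D', D'') \<in> isotopic \<Longrightarrow> (D, D'') \<in> isotopic"
proof -
  have "sym ((move \<union> move\<inverse>)\<^sup>*)"
    by (intro sym_rtrancl) (auto simp: sym_def)
  then show "(D, D') \<in> isotopic \<Longrightarrow> (D', D) \<in> isotopic"
    by (auto simp: isotopic_def sym_def)
qed (auto simp: isotopic_def)

lemma some_diagram:
  assumes "L \<in> oriented_links"
  shows "diagram (SOME D. D \<in> L)" and "D \<in> L \<Longrightarrow> (SOME D. D \<in> L, D) \<in> isotopic"
proof -
  obtain D0 where D0: "L = isotopic `` {D0}" "diagram D0"
    using assms by (auto simp: oriented_links_def quotient_def)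
  then have "D0 \<in> L"
    by (simp add: isotopic_refl)
  then have "(SOME D. D \<in> L) \<in> L"
    by (rule someI)
  then have iso: "(D0, SOME D. D \<in> L) \<in> isotopic"
    using D0(1) by blast
  then show "diagram (SOME D. D \<in> L)"
    by (simp add: isotopic_def)
  show "(SOME D. D \<in> L, D) \<in> isotopic" if "D \<in> L"
    using that D0(1) iso isotopic_sym isotopic_trans by blast
qed

lemma Phi_determines_jones:
  assumes "L \<in> oriented_links" "L' \<in> oriented_links" "Phi L = Phi L'"
  shows "jones L = jones L'"
proof -
  have Phi: "set_mset (Phi K) = beta (SOME D. D \<in> K) ` Col (SOME D. D \<in> K)" for K
    by (simp add: Phi_def Phi_diagram_def)
  have jones: "to_jones b = jones K" if "b \<in># Phi K" for b K
    using that unfolding Phi jones_def by (auto simp: to_jones_beta)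
  have "Phi L \<noteq> {#}"
    using Phi[of L] Col_nonempty[OF some_diagram(1)[OF assms(1)]] by auto
  then obtain b where "b \<in># Phi L"
    by blast
  then show ?thesis
    using jones assms(3) by metis
qed

text \<open>For such a value of A, a circle is worth the number N of labels.\<close>

lemma loop_parameter:
  assumes "N \<ge> 2"
  obtains a :: complex where "a \<noteq> 0" "of_nat N = - (a\<^sup>2) - inverse a ^ 2"
proof -
  \<comment> \<open>A root of s + 1/s = N; then A^2 = -s gives the required circle value.\<close>
  define s where "s = (of_nat N + csqrt (of_nat N ^ 2 - 4)) / 2"
  define a where "a = \<i> * csqrt s"
  have s: "s\<^sup>2 - of_nat N * s + 1 = 0"
    by (simp add: s_def power2_eq_square field_simps) (simp add: power2_eq_square[symmetric])
  then have "s \<noteq> 0"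
    by auto
  moreover have "a\<^sup>2 = - s"
    by (simp add: a_def power_mult_distrib)
  ultimately have "a \<noteq> 0" "of_nat N = - (a\<^sup>2) - inverse a ^ 2"
    using s by (auto simp: power_inverse field_simps power2_eq_square)
  then show ?thesis
    by (rule that)
qed

text \<open>The Kauffman variable is the power -1/4 of t, so the fourth root of t has to go to the
  inverse of \<open>a\<close>.\<close>

lemma eval_jones_diagram:
  fixes a :: complex
  assumes "diagram D" "a \<noteq> 0" "of_nat N = - (a\<^sup>2) - inverse a ^ 2"
  shows "laurent_eval (\<lambda>m. inverse a powi m) (jones_diagram D) = val {..<N} (jones_weight a) D [] (\<lambda>_. 1) []"
proof -
  have hom: "ring_hom (laurent_eval (\<lambda>m. inverse a powi m))"
    by (rule ring_hom_laurent_eval) (use assms(2) in \<open>simp_all add: power_int_add\<close>)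
  have "kauffman_var dvd 1"
  proof
    show "1 = kauffman_var * t_quarter 1"
      by (simp add: kauffman_var_def t_quarter_def mult_single)
  qed
  then have "laurent_eval (\<lambda>m. inverse a powi m) (jones_diagram D) =
      jones_at (laurent_eval (\<lambda>m. inverse a powi m) kauffman_var) D"
    unfolding jones_diagram_eq by (rule jones_at_hom[OF hom])
  also have "laurent_eval (\<lambda>m. inverse a powi m) kauffman_var = a"
    by (simp add: kauffman_var_def t_quarter_def laurent_eval_single power_int_minus)
  finally show ?thesis
    using jones_at_eq_val[OF assms] by simp
qed

section \<open>Comparison of the two ringed links\<close>

definition ringed_link :: "bool \<Rightarrow> slice list set" where
  "ringed_link t = isotopic `` {ringed_twist t}"

lemma ringed_link: "ringed_link t \<in> oriented_links"
  "(SOME D. D \<in> ringed_link t, ringed_twist t) \<in> isotopic"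
proof -
  show *: "ringed_link t \<in> oriented_links"
    unfolding ringed_link_def oriented_links_def
    by (rule quotientI) (simp add: diagram_ringed_twist)
  show "(SOME D. D \<in> ringed_link t, ringed_twist t) \<in> isotopic"
    by (rule some_diagram(2)[OF *])
      (simp add: ringed_link_def isotopic_refl diagram_ringed_twist)
qed

lemma val_some_ringed_link:
  assumes "state_model X W"
  shows "val X W (SOME D. D \<in> ringed_link t) [] F [] = val X W (ringed_twist t) [] F []"
  by (rule state_model.val_isotopic[OF assms ringed_link(2)])

lemma eval_jones_ringed_link:
  fixes a :: complex
  assumes "a \<noteq> 0" "of_nat N = - (a\<^sup>2) - inverse a ^ 2"
  shows "laurent_eval (\<lambda>m. inverse a powi m) (jones (ringed_link t)) =
    of_nat N ^ 7 - 6 * of_nat N ^ 5 + 10 * of_nat N ^ 3 - 4 * of_nat N"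
  unfolding jones_def eval_jones_diagram[OF some_diagram(1)[OF ringed_link(1)] assms]
    val_some_ringed_link[OF state_model_jones[OF assms]]
  by (rule val_jones_ringed_twist[OF assms])

lemma jones_ringed_link: "jones (ringed_link True) = jones (ringed_link False)"
proof (rule laurent_eqI)
  let ?ev = "\<lambda>z :: complex. laurent_eval (\<lambda>m. z powi m)"
  let ?f = "\<lambda>z :: complex. - (z\<^sup>2) - inverse z ^ 2"
  let ?Z = "{z. z \<noteq> 0 \<and> ?ev z (jones (ringed_link True)) = ?ev z (jones (ringed_link False))}"
  \<comment> \<open>The circle value \<open>?f\<close> takes infinitely many values on
    \<open>?Z\<close>, so \<open>?Z\<close> is infinite.\<close>
  have "of_nat ` {2..} \<subseteq> ?f ` ?Z"
  proof
    fix n :: complex assume "n \<in> of_nat ` {2..}"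
    then obtain N where N: "n = of_nat N" "N \<ge> 2"
      by auto
    obtain a :: complex where a: "a \<noteq> 0" "of_nat N = - (a\<^sup>2) - inverse a ^ 2"
      using loop_parameter[OF N(2)] .
    then have "inverse a \<in> ?Z"
      using eval_jones_ringed_link[OF a] by simp
    moreover have "n = ?f (inverse a)"
      using a by (simp add: N)
    ultimately show "n \<in> ?f ` ?Z"
      by blast
  qed
  moreover have "infinite (of_nat ` {2..} :: complex set)"
    by (simp add: finite_image_iff inj_on_def infinite_Ici)
  ultimately show "infinite ?Z"
    using finite_surj by blast
qed

text \<open>The substitution of \<open>hom_beta\<close> with \<open>q\<close> = 2. Any factor other
  than 1 would record linking numbers; roots of unity would record them only modulo their
  order.\<close>

definition exponent_value :: "complex \<Rightarrow> (5 \<Rightarrow>\<^sub>0 int) \<Rightarrow> complex" where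
  "exponent_value a e = a powi exponent_sum (\<lambda>i. if i = 5 then -1 else 1) e *
     2 powi exponent_sum (\<lambda>i. if i = 2 then 1 else 0) e"

text \<open>Every value in the multiset becomes the same Jones factor times a linking factor, so the
  sum splits into a product of two state sums that can be carried to any other diagram of the
  link.\<close>

lemma sum_beta_Phi:
  fixes a :: complex
  assumes "diagram D" "a \<noteq> 0"
  shows "(\<Sum>b\<in>#Phi_diagram D. laurent_eval (exponent_value a) b) =
    jones_at a D * (2 * val UNIV link_weight D [] (\<lambda>_. 1) [])"
proof -
  have hom: "ring_hom (laurent_eval (exponent_value a))"
    by (rule ring_hom_laurent_eval)
      (use assms(2) in \<open>simp_all add: exponent_value_def exponent_sum_hom power_int_add mult_ac\<close>)
  have x: "laurent_eval (exponent_value a) (xvar i) = (if i = 5 then inverse a else a) * (if i = 2 then 2 else 1)" for i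
    by (simp add: xvar_def laurent_eval_single exponent_value_def exponent_sum_hom power_int_minus)
  have "(\<Sum>b\<in>#Phi_diagram D. laurent_eval (exponent_value a) b) = (\<Sum>C\<in>Col D. laurent_eval (exponent_value a) (beta D C))"
    by (simp add: Phi_diagram_def image_mset.compositionality comp_def sum_unfold_sum_mset)
  also have "\<dots> = (\<Sum>C\<in>Col D. jones_at a D * (\<Prod>k\<in>crossings D. kappa 2 (cl D C k) ^^^ sign D k))"
    using assms(2) by (intro sum.cong refl hom_beta[OF hom]) (simp_all add: x unit_inv_field dvd_field_iff)
  also have "\<dots> = jones_at a D * (2 * val UNIV link_weight D [] (\<lambda>_. 1) [])"
    unfolding sum_distrib_left[symmetric] sum_Col_eq[OF assms(1)] sum_gap_colorings[OF assms(1)] ..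
  finally show ?thesis .
qed

lemma Phi_ringed_link: "Phi (ringed_link True) \<noteq> Phi (ringed_link False)"
proof
  assume eq: "Phi (ringed_link True) = Phi (ringed_link False)"
  \<comment> \<open>The common Jones factor must not vanish; at N = 3 it is 2187 - 1458 + 270 - 12 =
    987.\<close>
  obtain a :: complex where a: "a \<noteq> 0" "of_nat 3 = - (a\<^sup>2) - inverse a ^ 2"
    using loop_parameter[of 3] by auto
  have "(\<Sum>b\<in>#Phi (ringed_link t). laurent_eval (exponent_value a) b) = 987 * (2 * (if t then 12 else 21 / 2))" for t
    unfolding Phi_def sum_beta_Phi[OF some_diagram(1)[OF ringed_link(1)] a(1)]
      jones_at_eq_val[OF some_diagram(1)[OF ringed_link(1)] a]
      val_some_ringed_link[OF state_model_jones[OF a]] val_some_ringed_link[OF state_model_link]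
      val_jones_ringed_twist[OF a] val_link_ringed_twist
    by simp
  from this[of True] this[of False] eq show False
    by simp
qed

theorem proposition5p6:
  "(\<forall>L \<in> oriented_links. \<forall>L' \<in> oriented_links. Phi L = Phi L' \<longrightarrow> jones L = jones L') \<and>
   (\<exists>L \<in> oriented_links. \<exists>L' \<in> oriented_links. jones L = jones L' \<and> Phi L \<noteq> Phi L')"
  using Phi_determines_jones ringed_link(1) jones_ringed_link Phi_ringed_link by blast

end
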